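(* Let $\beta\in\{1,2,4\}$. The joint cumulant generating function $\sigma_n^{(\beta)}=\sigma_n^{(\beta)}(z,w)=\log\mathcal M_n^{(\beta)}(z,w)$ of conductance and shot noise satisfies the nonlinear PDE $$\eta_{1,4}^{(\beta)}w\frac{\partial^4\sigma_n^{(\beta)}}{\partial z^4}+6\eta_{1,4}^{(\beta)}w\left(\frac{\partial^2\sigma_n^{(\beta)}}{\partial z^2}\right)^2+2z\frac{\partial^2\sigma_n^{(\beta)}}{\partial z\,\partial w}+3w\frac{\partial^2\sigma_n^{(\beta)}}{\partial w^2}+2\frac{\partial\sigma_n^{(\beta)}}{\partial w}+\bigl(2(\alpha+\delta/2+n\beta+2-\beta)-w\bigr)\frac{\partial^2\sigma_n^{(\beta)}}{\partial z^2}$$ $$=\frac{12\,b_n^{(\beta)}}{\beta}\,w\exp\left(\sigma^{(\beta)}_{n-i(\beta)}+\sigma^{(\beta)}_{n+i(\beta)}-2\sigma_n^{(\beta)}\right).$$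
   Context: Let $m\ge n\ge 1$ be integers, $\alpha=\frac{\beta}{2}(m-n+1)-1$, and $\delta$ an integer; the pairs considered are $(\beta,\delta)\in\{(1,0),(2,0),(4,0),(4,2),(2,1),(1,-1),(2,-1)\}$. Define $$c_n^{(\beta)}=\int_{[0,1]^n}\prod_{j=1}^nT_j^{\alpha}(1-T_j)^{\delta/2}\prod_{1\le j<k\le n}|T_k-T_j|^\beta\,dT_1\cdots dT_n,$$ $$\mathcal M_n^{(\beta)}(z,w)=\frac1{c_n^{(\beta)}}\int_{[0,1]^n}\prod_{j=1}^nT_j^\alpha(1-T_j)^{\delta/2}\exp\bigl(-zT_j-wT_j(1-T_j)\bigr)\prod_{1\le j<k\le n}|T_k-T_j|^\beta\,dT_1\cdots dT_n.$$ The quantities with shifted index $n\pm i(\beta)$ are computed with the same values of $\alpha$ and $\delta$ (only the number of integration variables changes); $c_0^{(\beta)}=1$ and $\sigma_0^{(\beta)}=0$. Set $$b_n^{(1)}=\frac{n(n-1)}{(n+1)(n+2)}\frac{c^{(1)}_{n-2}c^{(1)}_{n+2}}{(c^{(1)}_n)^2},\qquad b_n^{(2)}=0,\qquad b_n^{(4)}=\frac{n}{n+1}\frac{c^{(4)}_{n-1}c^{(4)}_{n+1}}{(c^{(4)}_n)^2},$$ $\eta^{(4)}_{1,4}=4$, $\eta^{(1)}_{1,4}=\eta^{(2)}_{1,4}=1$, $i(4)=1$, $i(1)=2$. When $\beta=2$ the right-hand side of the PDE is $0$; when $\beta=1$ and $n=1$, $b_1^{(1)}=0$ and the right-hand side is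 also $0$. *)

theory Defs
  imports "HOL-Analysis.Analysis"
begin

definition selberg_density :: "nat \<Rightarrow> real \<Rightarrow> int \<Rightarrow> nat \<Rightarrow> (nat \<Rightarrow> real) \<Rightarrow> real" where
  "selberg_density \<beta> \<alpha> \<delta> n T =
     (\<Prod>j<n. T j powr \<alpha> * (1 - T j) powr (real_of_int \<delta> / 2)) *
     (\<Prod>k<n. \<Prod>j<k. \<bar>T k - T j\<bar> ^ \<beta>)"

text \<open>
  Since the number of variables is shifted by \<open>n \<plusminus> i(\<beta>)\<close>, the integral is taken with respect to
  the product Lebesgue measure on extensional functions on \<open>{..<n}\<close> (variables indexed from 0).
  For \<open>n = 0\<close> this is a one-point probability space, so the conventions \<open>c\<^sub>0 = 1\<close> and
  \<open>\<sigma>\<^sub>0 = 0\<close> hold automatically; see the two lemmas below.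
\<close>

definition cube_integral :: "nat \<Rightarrow> ((nat \<Rightarrow> real) \<Rightarrow> real) \<Rightarrow> real" where
  "cube_integral n f =
     (LINT T : ({..<n} \<rightarrow>\<^sub>E {0..1}) | (\<Pi>\<^sub>M j\<in>{..<n}. lborel). f T)"

definition norm_const :: "nat \<Rightarrow> real \<Rightarrow> int \<Rightarrow> nat \<Rightarrow> real" where
  "norm_const \<beta> \<alpha> \<delta> n = cube_integral n (selberg_density \<beta> \<alpha> \<delta> n)"

definition joint_mgf :: "nat \<Rightarrow> real \<Rightarrow> int \<Rightarrow> nat \<Rightarrow> real \<Rightarrow> real \<Rightarrow> real" where
  "joint_mgf \<beta> \<alpha> \<delta> n z w =
     1 / norm_const \<beta> \<alpha> \<delta> n *
     cube_integral n (\<lambda>T. (\<Prod>j<n. exp (- z * T j - w * T j * (1 - T j))) *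
                          selberg_density \<beta> \<alpha> \<delta> n T)"

definition joint_cgf :: "nat \<Rightarrow> real \<Rightarrow> int \<Rightarrow> nat \<Rightarrow> real \<Rightarrow> real \<Rightarrow> real" where
  "joint_cgf \<beta> \<alpha> \<delta> n z w = ln (joint_mgf \<beta> \<alpha> \<delta> n z w)"

lemma norm_const_0: "norm_const \<beta> \<alpha> \<delta> 0 = 1"
  by (simp add: norm_const_def cube_integral_def set_lebesgue_integral_def selberg_density_def
      PiM_empty lebesgue_integral_count_space_finite)

lemma joint_cgf_0: "joint_cgf \<beta> \<alpha> \<delta> 0 z w = 0"
proof -
  have "cube_integral 0 (\<lambda>T. (\<Prod>j<0. exp (- z * T j - w * T j * (1 - T j))) *
          selberg_density \<beta> \<alpha> \<delta> 0 T) = norm_const \<beta> \<alpha> \<delta> 0"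
    by (simp add: norm_const_def)
  then show ?thesis
    by (simp add: joint_cgf_def joint_mgf_def norm_const_0)
qed

text \<open>
  The shift \<open>i(\<beta>)\<close> is only meaningful for \<open>\<beta> = 1\<close> and \<open>\<beta> = 4\<close>; the value at \<open>\<beta> = 2\<close> is
  a dummy, as it only occurs multiplied by \<open>b\<^sub>n = 0\<close>.
\<close>

definition index_shift :: "nat \<Rightarrow> nat" where
  "index_shift \<beta> = (if \<beta> = 1 then 2 else 1)"

definition eta_coeff :: "nat \<Rightarrow> real" where
  "eta_coeff \<beta> = (if \<beta> = 4 then 4 else 1)"

text \<open>
  For \<open>\<beta> = 1\<close> and \<open>n = 1\<close> the index \<open>n - 2\<close> truncates to \<open>0\<close>, which is harmless since the
  prefactor \<open>n (n - 1)\<close>, computed in the reals, vanishes.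
\<close>

definition b_coeff :: "nat \<Rightarrow> real \<Rightarrow> int \<Rightarrow> nat \<Rightarrow> real" where
  "b_coeff \<beta> \<alpha> \<delta> n =
     (if \<beta> = 1 then
        real n * (real n - 1) / ((real n + 1) * (real n + 2)) *
        (norm_const 1 \<alpha> \<delta> (n - 2) * norm_const 1 \<alpha> \<delta> (n + 2) / (norm_const 1 \<alpha> \<delta> n)\<^sup>2)
      else if \<beta> = 4 then
        real n / (real n + 1) *
        (norm_const 4 \<alpha> \<delta> (n - 1) * norm_const 4 \<alpha> \<delta> (n + 1) / (norm_const 4 \<alpha> \<delta> n)\<^sup>2)
      else 0)"

definition partial_z :: "(real \<Rightarrow> real \<Rightarrow> real) \<Rightarrow> real \<Rightarrow> real \<Rightarrow> real" where
  "partial_z f z w = deriv (\<lambda>s. f s w) z"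

definition partial_w :: "(real \<Rightarrow> real \<Rightarrow> real) \<Rightarrow> real \<Rightarrow> real \<Rightarrow> real" where
  "partial_w f z w = deriv (\<lambda>t. f z t) w"

end

(*
  All pointwise weights |Vandermonde|^beta are handled uniformly. Let p_k(S) be the k-th power sum of the
  points labelled by S and d_k = p_k(S) - p_k(I - S) for a splitting of 2n labelled points. Summing
  eta d_1^4 + 3 d_2^2 - 4 d_1 d_3 against the product of the two Vandermonde weights over all splittings
  into n + n points gives a constant multiple of the sum of the plain weights over the splittings into
  (n - i) + (n + i) points (zero for beta = 2). After division by the full Vandermonde this is an
  identity of rational functions in one distinguished point; the residues at the other points reduce it to
  two points fewer, and a degree count finishes the induction. Integrating the identity is the Hirota form
  of the (Pfaff-)KP equation for the moments. Integration by parts along t(1 - t) d/dt in every variable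
  gives two linear relations which eliminate the third power sum, and the PDE follows by algebra.
*)

theory Submission
  imports Defs
begin

text \<open>A product of two n-fold integrals is one integral over 2n points whose integrand may be
  averaged over all splittings; a Hirota derivative then acts as multiplication by some d_k, so the
  bilinear equation becomes a pointwise identity. Two points are removed at a time because, when
  \<open>x a\<close> meets \<open>x b\<close>, only splittings that separate them survive, and such
  a pair drops out of every d_k. For \<beta> = 1 the absolute values are not rational. Labels +1 and
  -1 with sum zero replace them, and the induction runs over all balanced labellings: a colliding
  pair with equal labels gives a root outright, a pair with opposite labels leaves a balanced rest.
  For \<beta> = 2 and \<beta> = 4 simple roots are too few for the degree, so double roots are used;
  for \<beta> = 4 even these suffice only because the value \<eta> = 4 makes the top coefficients
  cancel. The constants come from four points (24), from leading coefficients (6) and from ratios of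
  binomial coefficients (\<open>b_coeff\<close>). The parameters z and w generate only p_1 and p_1 -
  p_2, which is why p_3 stands apart.\<close>

section \<open>The rational splitting identity\<close>

text \<open>The condition is additive because \<open>card S = n - i\<close> would be satisfiable for \<open>n < i\<close>.\<close>

definition sel :: "nat set \<Rightarrow> nat \<Rightarrow> nat \<Rightarrow> nat set set" where
  "sel I n i = {S. S \<subseteq> I \<and> card S + i = n}"

definition cross :: "nat \<Rightarrow> (nat \<Rightarrow> real) \<Rightarrow> nat set \<Rightarrow> nat set \<Rightarrow> real" where
  "cross \<beta> x S T = (\<Prod>s\<in>S. \<Prod>t\<in>T. (x t - x s) ^ \<beta>)"

definition psum :: "nat \<Rightarrow> nat set \<Rightarrow> (nat \<Rightarrow> real) \<Rightarrow> real" where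
  "psum k S x = (\<Sum>i\<in>S. x i ^ k)"

definition pdiff :: "nat \<Rightarrow> nat set \<Rightarrow> nat set \<Rightarrow> (nat \<Rightarrow> real) \<Rightarrow> real" where
  "pdiff k S T x = psum k S x - psum k T x"

text \<open>The symbol of the Hirota operator \<open>\<eta> D\<^sub>1\<^sup>4 + 3 D\<^sub>2\<^sup>2 - 4 D\<^sub>1 D\<^sub>3\<close> of the KP equation.\<close>

definition kp :: "real \<Rightarrow> real \<Rightarrow> real \<Rightarrow> real \<Rightarrow> real" where
  "kp \<eta> a b c = \<eta> * a ^ 4 + 3 * b\<^sup>2 - 4 * a * c"

text \<open>Division by the full Vandermonde weight leaves \<open>1 / cross\<close> as the weight of
  a splitting. The labels \<open>\<epsilon>\<close> carry the signs needed for \<beta> = 1;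
  \<open>\<kappa>\<close> is \<open>kp\<close> on the left of the final identity and the constant 1
  on the right.\<close>

definition Qsum :: "nat \<Rightarrow> (nat \<Rightarrow> real) \<Rightarrow> (real \<Rightarrow> real \<Rightarrow> real \<Rightarrow> real) \<Rightarrow> (nat \<Rightarrow> real) \<Rightarrow> nat set \<Rightarrow> nat \<Rightarrow> nat \<Rightarrow> real" where
  "Qsum \<beta> \<epsilon> \<kappa> x I n i = (\<Sum>S\<in>sel I n i. (\<Prod>s\<in>S. \<epsilon> s) *
     \<kappa> (pdiff 1 S (I - S) x) (pdiff 2 S (I - S) x) (pdiff 3 S (I - S) x) / cross \<beta> x S (I - S))"

text \<open>
  The sum \<open>Qsum\<close> over \<open>insert a J\<close>, multiplied by \<open>\<Prod>j\<in>J. (x a - x j) ^ \<beta>\<close>, as a polynomial in \<open>y = x a\<close>;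
  the two sums collect the splittings with \<open>a\<close> in the first and in the second block.
\<close>

definition Nsum :: "nat \<Rightarrow> (nat \<Rightarrow> real) \<Rightarrow> (real \<Rightarrow> real \<Rightarrow> real \<Rightarrow> real) \<Rightarrow> (nat \<Rightarrow> real) \<Rightarrow> nat \<Rightarrow> nat set \<Rightarrow> nat \<Rightarrow> nat \<Rightarrow> real \<Rightarrow> real" where
  "Nsum \<beta> \<epsilon> \<kappa> x a J n i y =
    (\<Sum>S\<in>sel J n (Suc i). (\<Prod>s\<in>S. \<epsilon> s) * \<epsilon> a * (-1) ^ (\<beta> * card (J - S)) * (\<Prod>s\<in>S. (y - x s) ^ \<beta>) *
       \<kappa> (pdiff 1 S (J - S) x + y) (pdiff 2 S (J - S) x + y\<^sup>2) (pdiff 3 S (J - S) x + y ^ 3) / cross \<beta> x S (J - S))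
  + (\<Sum>S\<in>sel J n i. (\<Prod>s\<in>S. \<epsilon> s) * (\<Prod>t\<in>J - S. (y - x t) ^ \<beta>) *
       \<kappa> (pdiff 1 S (J - S) x - y) (pdiff 2 S (J - S) x - y\<^sup>2) (pdiff 3 S (J - S) x - y ^ 3) / cross \<beta> x S (J - S))"

lemma finite_sel: "finite I \<Longrightarrow> finite (sel I n i)"
  unfolding sel_def by (rule finite_subset[of _ "Pow I"]) auto

text \<open>A block containing \<open>a\<close> leaves one element less to choose from
  \<open>J\<close>; in the additive encoding of \<open>sel\<close> this raises \<open>i\<close>
  instead of lowering \<open>n\<close>.\<close>

lemma sum_sel_insert:
  assumes "finite J" "a \<notin> J"
  shows "(\<Sum>S\<in>sel (insert a J) n i. f S) = (\<Sum>S\<in>sel J n (Suc i). f (insert a S)) + (\<Sum>S\<in>sel J n i. f S)"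
proof -
  have eq: "sel (insert a J) n i = insert a ` sel J n (Suc i) \<union> sel J n i"
  proof (intro equalityI subsetI)
    fix S assume S: "S \<in> sel (insert a J) n i"
    show "S \<in> insert a ` sel J n (Suc i) \<union> sel J n i"
    proof (cases "a \<in> S")
      case True
      have fS: "finite S" using S assms finite_subset unfolding sel_def by auto
      have "card S = Suc (card (S - {a}))" using True fS by (metis card_Suc_Diff1)
      then have "S - {a} \<in> sel J n (Suc i)" using S unfolding sel_def by auto
      moreover have "S = insert a (S - {a})" using True by auto
      ultimately show ?thesis by blast
    next
      case False
      then show ?thesis using S unfolding sel_def by auto
    qed
  next
    fix S assume S: "S \<in> insert a ` sel J n (Suc i) \<union> sel J n i"
    then show "S \<in> sel (insert a J) n i"
    proof
      assume "S \<in> insert a ` sel J n (Suc i)"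
      then obtain T where T: "S = insert a T" "T \<subseteq> J" "card T + Suc i = n" unfolding sel_def by auto
      then have "card S = Suc (card T)" using assms
        by (metis card_insert_disjoint finite_subset subsetD)
      then show ?thesis using T unfolding sel_def by auto
    qed (auto simp: sel_def)
  qed
  have inj: "inj_on (insert a) (sel J n (Suc i))"
    using assms unfolding inj_on_def sel_def by (auto simp: insert_ident)
  have disj: "insert a ` sel J n (Suc i) \<inter> sel J n i = {}"
    using assms unfolding sel_def by auto
  show ?thesis unfolding eq
    by (subst sum.union_disjoint) (use assms disj in \<open>auto simp: finite_sel sum.reindex[OF inj]\<close>)
qed

lemma cross_insert_left: "finite S \<Longrightarrow> a \<notin> S \<Longrightarrow> cross \<beta> x (insert a S) T = (\<Prod>t\<in>T. (x t - x a) ^ \<beta>) * cross \<beta> x S T"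
  unfolding cross_def by simp

lemma cross_insert_right: "finite T \<Longrightarrow> a \<notin> T \<Longrightarrow> cross \<beta> x S (insert a T) = (\<Prod>s\<in>S. (x a - x s) ^ \<beta>) * cross \<beta> x S T"
  unfolding cross_def by (simp add: prod.distrib)

lemma psum_insert: "finite S \<Longrightarrow> a \<notin> S \<Longrightarrow> psum k (insert a S) x = x a ^ k + psum k S x"
  unfolding psum_def by simp

lemma prod_swap_sign:
  fixes x :: "nat \<Rightarrow> real"
  shows "finite T \<Longrightarrow> (\<Prod>t\<in>T. (x t - y) ^ \<beta>) = (-1) ^ (\<beta> * card T) * (\<Prod>t\<in>T. (y - x t) ^ \<beta>)"
proof (induction T rule: finite_induct)
  case (insert t T)
  have "(x t - y) ^ \<beta> = (-1) ^ \<beta> * (y - x t) ^ \<beta>"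
    by (simp flip: power_mult_distrib)
  then show ?case using insert by (simp add: power_add)
qed simp

text \<open>In each splitting the pole factors at \<open>x a\<close> come from the block opposite to
  \<open>a\<close>, so clearing all poles leaves the factors of the block of \<open>a\<close> as
  numerator. The sign in \<open>Nsum\<close> comes from reversing the factors
  \<open>x t - x a\<close>.\<close>

lemma Nsum_eq_Qsum:
  assumes "finite J" "a \<notin> J" "x a \<notin> x ` J"
  shows "Nsum \<beta> \<epsilon> \<kappa> x a J n i (x a) = (\<Prod>j\<in>J. (x a - x j) ^ \<beta>) * Qsum \<beta> \<epsilon> \<kappa> x (insert a J) n i"
proof -
  have nz: "(\<Prod>j\<in>A. (x a - x j) ^ \<beta>) \<noteq> 0" if "A \<subseteq> J" for A
    using that assms finite_subset[OF that] by (auto simp: prod_zero_iff)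
  have split: "(\<Prod>j\<in>J. (x a - x j) ^ \<beta>) = (\<Prod>j\<in>S. (x a - x j) ^ \<beta>) * (\<Prod>j\<in>J - S. (x a - x j) ^ \<beta>)" if "S \<subseteq> J" for S
    using prod.subset_diff[OF that assms(1)] by (simp add: mult.commute)
  show ?thesis
    unfolding Qsum_def Nsum_def sum_sel_insert[OF assms(1,2)] distrib_left sum_distrib_left
  proof (intro arg_cong2[of _ _ _ _ "(+)"] sum.cong refl)
    fix S assume "S \<in> sel J n (Suc i)"
    then have S: "S \<subseteq> J" "finite S" "a \<notin> S" "finite (J - S)" using assms finite_subset unfolding sel_def by auto
    have d: "insert a J - insert a S = J - S" using assms by auto
    have c: "cross \<beta> x (insert a S) (J - S) = (-1) ^ (\<beta> * card (J - S)) * (\<Prod>t\<in>J - S. (x a - x t) ^ \<beta>) * cross \<beta> x S (J - S)"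
      by (simp add: cross_insert_left S prod_swap_sign)
    have p: "pdiff k (insert a S) (J - S) x = pdiff k S (J - S) x + x a ^ k" for k
      by (simp add: pdiff_def psum_insert S)
    have s: "z / ((-1) ^ k * v * w) = z * (-1) ^ k / (v * w)" for z v w :: real and k :: nat
      by (cases "even k") auto
    show "(\<Prod>s\<in>S. \<epsilon> s) * \<epsilon> a * (- 1) ^ (\<beta> * card (J - S)) * (\<Prod>s\<in>S. (x a - x s) ^ \<beta>) *
         \<kappa> (pdiff 1 S (J - S) x + x a) (pdiff 2 S (J - S) x + (x a)\<^sup>2) (pdiff 3 S (J - S) x + x a ^ 3) / cross \<beta> x S (J - S) =
         (\<Prod>j\<in>J. (x a - x j) ^ \<beta>) * ((\<Prod>s\<in>insert a S. \<epsilon> s) *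
          \<kappa> (pdiff 1 (insert a S) (insert a J - insert a S) x) (pdiff 2 (insert a S) (insert a J - insert a S) x)
           (pdiff 3 (insert a S) (insert a J - insert a S) x) / cross \<beta> x (insert a S) (insert a J - insert a S))"
      unfolding d c p split[OF S(1)] s using nz[of "J - S"] S by (auto simp: field_simps)
  next
    fix S assume "S \<in> sel J n i"
    then have S: "S \<subseteq> J" "finite S" "a \<notin> S" "finite (J - S)" "a \<notin> J - S" using assms finite_subset unfolding sel_def by auto
    have d: "insert a J - S = insert a (J - S)" using S by auto
    have p: "pdiff k S (insert a (J - S)) x = pdiff k S (J - S) x - x a ^ k" for k
      using psum_insert[OF S(4,5)] by (simp add: pdiff_def)
    show "(\<Prod>s\<in>S. \<epsilon> s) * (\<Prod>t\<in>J - S. (x a - x t) ^ \<beta>) *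
         \<kappa> (pdiff 1 S (J - S) x - x a) (pdiff 2 S (J - S) x - (x a)\<^sup>2) (pdiff 3 S (J - S) x - x a ^ 3) / cross \<beta> x S (J - S) =
         (\<Prod>j\<in>J. (x a - x j) ^ \<beta>) * ((\<Prod>s\<in>S. \<epsilon> s) *
          \<kappa> (pdiff 1 S (insert a J - S) x) (pdiff 2 S (insert a J - S) x) (pdiff 3 S (insert a J - S) x) / cross \<beta> x S (insert a J - S))"
      unfolding d p split[OF S(1)] cross_insert_right[OF S(4,5)] using nz[of S] S by (auto simp: field_simps)
  qed
qed

section \<open>Collision of two points\<close>

lemma sel_Suc_Suc: "sel J (Suc n) (Suc i) = sel J n i"
  unfolding sel_def by simp

text \<open>The terms are sorted by the positions of \<open>a\<close> and \<open>b\<close>. If both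
  lie in one block, a factor \<open>(y - x b) ^ \<beta>\<close> appears. If they are separated, the
  two possible placements share the same \<open>S\<close> and the same sign; their quotients are
  normalised to 1 at \<open>y = x b\<close>, and \<open>y\<close> enters the power sum differences
  only through terms that vanish there.\<close>

lemma Nsum_insert:
  assumes "finite J" "b \<notin> J" "x b \<notin> x ` J" "inj_on x J"
  shows "Nsum \<beta> \<epsilon> \<kappa> x a (insert b J) (Suc n) i y =
    (\<Sum>S\<in>sel J n (Suc i). (y - x b) ^ \<beta> * ((\<Prod>s\<in>insert b S. \<epsilon> s) * \<epsilon> a * (-1) ^ (\<beta> * card (J - S)) * (\<Prod>s\<in>S. (y - x s) ^ \<beta>) *
       \<kappa> (pdiff 1 (insert b S) (J - S) x + y) (pdiff 2 (insert b S) (J - S) x + y\<^sup>2) (pdiff 3 (insert b S) (J - S) x + y ^ 3) / cross \<beta> x (insert b S) (J - S)))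
  + (\<Sum>S\<in>sel J (Suc n) i. (y - x b) ^ \<beta> * ((\<Prod>s\<in>S. \<epsilon> s) * (\<Prod>t\<in>J - S. (y - x t) ^ \<beta>) *
       \<kappa> (pdiff 1 S (insert b (J - S)) x - y) (pdiff 2 S (insert b (J - S)) x - y\<^sup>2) (pdiff 3 S (insert b (J - S)) x - y ^ 3) / cross \<beta> x S (insert b (J - S))))
  + (-1) ^ (\<beta> * (card J - (n - i))) * (\<Sum>S\<in>sel J n i. (\<Prod>s\<in>S. \<epsilon> s) / cross \<beta> x S (J - S) *
      ((-1) ^ \<beta> * \<epsilon> a * (\<Prod>s\<in>S. ((y - x s) / (x b - x s)) ^ \<beta>) * \<kappa> (pdiff 1 S (J - S) x + (y - x b)) (pdiff 2 S (J - S) x + (y\<^sup>2 - (x b)\<^sup>2)) (pdiff 3 S (J - S) x + (y ^ 3 - x b ^ 3))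
     + \<epsilon> b * (\<Prod>t\<in>J - S. ((y - x t) / (x b - x t)) ^ \<beta>) * \<kappa> (pdiff 1 S (J - S) x - (y - x b)) (pdiff 2 S (J - S) x - (y\<^sup>2 - (x b)\<^sup>2)) (pdiff 3 S (J - S) x - (y ^ 3 - x b ^ 3))))"
    (is "_ = ?V1 + ?V2 + ?W")
proof -
  have nz: "(\<Prod>j\<in>A. (x b - x j) ^ \<beta>) \<noteq> 0" if "A \<subseteq> J" for A
    using that assms finite_subset[OF that] by (auto simp: prod_zero_iff)
  let ?f1 = "\<lambda>S. (\<Prod>s\<in>S. \<epsilon> s) * \<epsilon> a * (-1) ^ (\<beta> * card (insert b J - S)) * (\<Prod>s\<in>S. (y - x s) ^ \<beta>) *
       \<kappa> (pdiff 1 S (insert b J - S) x + y) (pdiff 2 S (insert b J - S) x + y\<^sup>2) (pdiff 3 S (insert b J - S) x + y ^ 3) / cross \<beta> x S (insert b J - S)"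
  let ?f2 = "\<lambda>S. (\<Prod>s\<in>S. \<epsilon> s) * (\<Prod>t\<in>insert b J - S. (y - x t) ^ \<beta>) *
       \<kappa> (pdiff 1 S (insert b J - S) x - y) (pdiff 2 S (insert b J - S) x - y\<^sup>2) (pdiff 3 S (insert b J - S) x - y ^ 3) / cross \<beta> x S (insert b J - S)"
  have "Nsum \<beta> \<epsilon> \<kappa> x a (insert b J) (Suc n) i y =
      (\<Sum>S\<in>sel J n (Suc i). ?f1 (insert b S)) + (\<Sum>S\<in>sel J n i. ?f1 S) + ((\<Sum>S\<in>sel J n i. ?f2 (insert b S)) + (\<Sum>S\<in>sel J (Suc n) i. ?f2 S))"
    unfolding Nsum_def sum_sel_insert[OF assms(1,2)] sel_Suc_Suc ..
  moreover have "(\<Sum>S\<in>sel J n (Suc i). ?f1 (insert b S)) = ?V1"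
  proof (rule sum.cong[OF refl])
    fix S assume "S \<in> sel J n (Suc i)"
    then have S: "S \<subseteq> J" "finite S" "b \<notin> S" using assms finite_subset unfolding sel_def by auto
    have d: "insert b J - insert b S = J - S" using assms by auto
    show "?f1 (insert b S) = (y - x b) ^ \<beta> * ((\<Prod>s\<in>insert b S. \<epsilon> s) * \<epsilon> a * (-1) ^ (\<beta> * card (J - S)) * (\<Prod>s\<in>S. (y - x s) ^ \<beta>) *
       \<kappa> (pdiff 1 (insert b S) (J - S) x + y) (pdiff 2 (insert b S) (J - S) x + y\<^sup>2) (pdiff 3 (insert b S) (J - S) x + y ^ 3) / cross \<beta> x (insert b S) (J - S))"
      unfolding d using S by simp
  qed
  moreover have "(\<Sum>S\<in>sel J (Suc n) i. ?f2 S) = ?V2"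
  proof (rule sum.cong[OF refl])
    fix S assume "S \<in> sel J (Suc n) i"
    then have S: "S \<subseteq> J" "finite S" "b \<notin> S" "finite (J - S)" "b \<notin> J - S" using assms finite_subset unfolding sel_def by auto
    have d: "insert b J - S = insert b (J - S)" using S by auto
    show "?f2 S = (y - x b) ^ \<beta> * ((\<Prod>s\<in>S. \<epsilon> s) * (\<Prod>t\<in>J - S. (y - x t) ^ \<beta>) *
       \<kappa> (pdiff 1 S (insert b (J - S)) x - y) (pdiff 2 S (insert b (J - S)) x - y\<^sup>2) (pdiff 3 S (insert b (J - S)) x - y ^ 3) / cross \<beta> x S (insert b (J - S)))"
      unfolding d using S by simp
  qed
  moreover have "(\<Sum>S\<in>sel J n i. ?f1 S) + (\<Sum>S\<in>sel J n i. ?f2 (insert b S)) = ?W"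
    unfolding sum.distrib[symmetric] sum_distrib_left
  proof (rule sum.cong[OF refl])
    fix S assume S0: "S \<in> sel J n i"
    then have S: "S \<subseteq> J" "finite S" "b \<notin> S" "finite (J - S)" "b \<notin> J - S" using assms finite_subset unfolding sel_def by auto
    have d: "insert b J - S = insert b (J - S)" "insert b J - insert b S = J - S" using S assms by auto
    have c: "card (J - S) = card J - (n - i)"
      using S S0 by (simp add: card_Diff_subset sel_def)
    have p1: "pdiff k S (insert b (J - S)) x + u = pdiff k S (J - S) x + (u - x b ^ k)" for k u
      using psum_insert[OF S(4,5)] by (simp add: pdiff_def)
    have p2: "pdiff k (insert b S) (J - S) x - u = pdiff k S (J - S) x - (u - x b ^ k)" for k u
      using psum_insert[OF S(2,3)] by (simp add: pdiff_def)
    have s: "z / ((-1) ^ k * v * w) = z * (-1) ^ k / (v * w)" for z v w :: real and k :: nat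
      by (cases "even k") auto
    have "?f1 S = (-1) ^ (\<beta> * (card J - (n - i))) * ((\<Prod>s\<in>S. \<epsilon> s) / cross \<beta> x S (J - S) *
        ((-1) ^ \<beta> * \<epsilon> a * (\<Prod>s\<in>S. ((y - x s) / (x b - x s)) ^ \<beta>) * \<kappa> (pdiff 1 S (J - S) x + (y - x b)) (pdiff 2 S (J - S) x + (y\<^sup>2 - (x b)\<^sup>2)) (pdiff 3 S (J - S) x + (y ^ 3 - x b ^ 3))))"
      unfolding d p1 cross_insert_right[OF S(4,5)] using nz[of S] S
      by (simp add: c power_add power_divide prod_dividef field_simps)
    moreover have "?f2 (insert b S) = (-1) ^ (\<beta> * (card J - (n - i))) * ((\<Prod>s\<in>S. \<epsilon> s) / cross \<beta> x S (J - S) * (\<epsilon> b * (\<Prod>t\<in>J - S. ((y - x t) / (x b - x t)) ^ \<beta>) * \<kappa> (pdiff 1 S (J - S) x - (y - x b)) (pdiff 2 S (J - S) x - (y\<^sup>2 - (x b)\<^sup>2)) (pdiff 3 S (J - S) x - (y ^ 3 - x b ^ 3))))"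
      unfolding d p2 cross_insert_left[OF S(2,3)] prod_swap_sign[OF S(4)] s c using nz[of "J - S"] S
      by (simp add: power_add power_divide prod_dividef field_simps)
    ultimately show "?f1 S + ?f2 (insert b S) = (-1) ^ (\<beta> * (card J - (n - i))) * ((\<Prod>s\<in>S. \<epsilon> s) / cross \<beta> x S (J - S) *
      ((-1) ^ \<beta> * \<epsilon> a * (\<Prod>s\<in>S. ((y - x s) / (x b - x s)) ^ \<beta>) * \<kappa> (pdiff 1 S (J - S) x + (y - x b)) (pdiff 2 S (J - S) x + (y\<^sup>2 - (x b)\<^sup>2)) (pdiff 3 S (J - S) x + (y ^ 3 - x b ^ 3))
     + \<epsilon> b * (\<Prod>t\<in>J - S. ((y - x t) / (x b - x t)) ^ \<beta>) * \<kappa> (pdiff 1 S (J - S) x - (y - x b)) (pdiff 2 S (J - S) x - (y\<^sup>2 - (x b)\<^sup>2)) (pdiff 3 S (J - S) x - (y ^ 3 - x b ^ 3))))"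
      by (simp only: distrib_left)
  qed
  ultimately show ?thesis by linarith
qed

text \<open>At the collision every separating splitting occurs twice, with \<open>a\<close> or with
  \<open>b\<close> in the first block, which produces
  \<open>(-1) ^ \<beta> * \<epsilon> a + \<epsilon> b\<close>. This factor is 2 for even \<beta>
  with trivial labels; for \<beta> = 1 it vanishes exactly when the labels agree.\<close>

lemma Nsum_root:
  assumes "finite J" "b \<notin> J" "x b \<notin> x ` J" "inj_on x J" "\<beta> > 0"
  shows "Nsum \<beta> \<epsilon> \<kappa> x a (insert b J) (Suc n) i (x b) =
    (-1) ^ (\<beta> * (card J - (n - i))) * ((-1) ^ \<beta> * \<epsilon> a + \<epsilon> b) * Qsum \<beta> \<epsilon> \<kappa> x J n i"
proof -
  have one: "(\<Prod>s\<in>S. ((x b - x s) / (x b - x s)) ^ \<beta>) = 1" if "S \<subseteq> J" for S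
    by (rule prod.neutral) (use that assms in auto)
  show ?thesis
  proof -
    have z: "(x b - x b) ^ \<beta> * u = 0" for u using \<open>\<beta> > 0\<close> by simp
    have w: "(\<Prod>s\<in>S. \<epsilon> s) / cross \<beta> x S (J - S) *
      ((-1) ^ \<beta> * \<epsilon> a * (\<Prod>s\<in>S. ((x b - x s) / (x b - x s)) ^ \<beta>) * \<kappa> (pdiff 1 S (J - S) x + (x b - x b)) (pdiff 2 S (J - S) x + ((x b)\<^sup>2 - (x b)\<^sup>2)) (pdiff 3 S (J - S) x + (x b ^ 3 - x b ^ 3))
     + \<epsilon> b * (\<Prod>t\<in>J - S. ((x b - x t) / (x b - x t)) ^ \<beta>) * \<kappa> (pdiff 1 S (J - S) x - (x b - x b)) (pdiff 2 S (J - S) x - ((x b)\<^sup>2 - (x b)\<^sup>2)) (pdiff 3 S (J - S) x - (x b ^ 3 - x b ^ 3)))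
     = ((-1) ^ \<beta> * \<epsilon> a + \<epsilon> b) * ((\<Prod>s\<in>S. \<epsilon> s) * \<kappa> (pdiff 1 S (J - S) x) (pdiff 2 S (J - S) x) (pdiff 3 S (J - S) x) / cross \<beta> x S (J - S))"
      if "S \<in> sel J n i" for S
    proof -
      have S: "S \<subseteq> J" "J - S \<subseteq> J" using that by (auto simp: sel_def)
      show ?thesis unfolding one[OF S(1)] one[OF S(2)] diff_self add_0_right diff_0_right mult_1_right
        by (simp add: algebra_simps add_divide_distrib)
    qed
    show ?thesis
      unfolding Nsum_insert[OF assms(1-4)] Qsum_def z sum.neutral_const
      by (subst sum.cong[OF refl w], assumption) (simp add: sum_distrib_left mult.assoc)
  qed
qed

text \<open>
  The logarithmic derivatives of the two blocks add up to one that does not depend on the splitting,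
  and the derivatives of \<open>\<kappa>\<close> cancel. So for even \<open>\<beta>\<close> the induction hypothesis yields double roots.
\<close>

lemma Nsum_deriv:
  assumes "finite J" "b \<notin> J" "x b \<notin> x ` J" "inj_on x J" "\<beta> \<ge> 2" "even \<beta>"
    and \<kappa>1: "\<And>A B C y. ((\<lambda>y. \<kappa> (A + y) (B + y\<^sup>2) (C + y ^ 3)) has_field_derivative \<kappa>' (A + y) (B + y\<^sup>2) (C + y ^ 3) y) (at y)"
    and \<kappa>2: "\<And>A B C y. ((\<lambda>y. \<kappa> (A - y) (B - y\<^sup>2) (C - y ^ 3)) has_field_derivative - \<kappa>' (A - y) (B - y\<^sup>2) (C - y ^ 3) y) (at y)"
  shows "(Nsum \<beta> (\<lambda>_. 1) \<kappa> x a (insert b J) (Suc n) i has_field_derivative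
     (\<Sum>s\<in>J. \<beta> / (x b - x s)) * Qsum \<beta> (\<lambda>_. 1) \<kappa> x J n i) (at (x b))"
proof -
  have one: "(\<Prod>s\<in>S. ((x b - x s) / (x b - x s)) ^ \<beta>) = 1" if "S \<subseteq> J" for S
    by (rule prod.neutral) (use that assms in auto)
  \<comment> \<open>Terms with \<open>a\<close> and \<open>b\<close> in the same block have a zero
    of order at least two at \<open>x b\<close>.\<close>
  have van: "((\<lambda>y. (y - x b) ^ \<beta> * f y) has_field_derivative 0) (at (x b))" if "(f has_field_derivative f') (at (x b))" for f f'
  proof -
    have "((\<lambda>y. (y - x b) ^ \<beta>) has_field_derivative 0) (at (x b))"
      using \<open>\<beta> \<ge> 2\<close> by (auto intro!: derivative_eq_intros)
    from DERIV_mult[OF this that] show ?thesis using \<open>\<beta> \<ge> 2\<close> by (simp add: zero_power)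
  qed
  have dpow: "((\<lambda>y. (\<Prod>s\<in>S. (y - x s) ^ \<beta>)) has_field_derivative (\<Sum>s\<in>S. (\<beta> * (z - x s) ^ (\<beta> - 1)) * (\<Prod>t\<in>S - {s}. (z - x t) ^ \<beta>))) (at z)" for S z
    by (rule has_field_derivative_prod) (auto intro!: derivative_eq_intros)
  \<comment> \<open>Every quotient equals 1 at \<open>x b\<close>, so the derivative of the product
    is the sum of the logarithmic derivatives.\<close>
  have dq: "((\<lambda>y. (\<Prod>s\<in>S. ((y - x s) / (x b - x s)) ^ \<beta>)) has_field_derivative (\<Sum>s\<in>S. \<beta> / (x b - x s))) (at (x b))"
    if "S \<subseteq> J" for S
  proof -
    have "((\<lambda>y. (\<Prod>s\<in>S. ((y - x s) / (x b - x s)) ^ \<beta>)) has_field_derivative (\<Prod>s\<in>S. ((x b - x s) / (x b - x s)) ^ \<beta>) *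
       (\<Sum>s\<in>S. (\<beta> / (x b - x s)) / ((x b - x s) / (x b - x s)) ^ \<beta>)) (at (x b))"
    proof (rule has_field_derivative_prod')
      fix s assume "s \<in> S"
      then have nz: "x b - x s \<noteq> 0" using that assms by auto
      show "((x b - x s) / (x b - x s)) ^ \<beta> \<noteq> 0" using nz by simp
      show "((\<lambda>y. ((y - x s) / (x b - x s)) ^ \<beta>) has_field_derivative \<beta> / (x b - x s)) (at (x b))"
        using nz by (auto intro!: derivative_eq_intros)
    qed
    also have "(\<Prod>s\<in>S. ((x b - x s) / (x b - x s)) ^ \<beta>) *
       (\<Sum>s\<in>S. (\<beta> / (x b - x s)) / ((x b - x s) / (x b - x s)) ^ \<beta>) = (\<Sum>s\<in>S. \<beta> / (x b - x s))"
      unfolding one[OF that] using that assms by (auto intro!: sum.cong)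
    finally show ?thesis .
  qed
  have k1: "((\<lambda>y. \<kappa> (A + (y - x b)) (B + (y\<^sup>2 - (x b)\<^sup>2)) (C + (y ^ 3 - x b ^ 3))) has_field_derivative \<kappa>' A B C (x b)) (at (x b))" for A B C
    using \<kappa>1[of "A - x b" "B - (x b)\<^sup>2" "C - x b ^ 3" "x b"] by (simp add: algebra_simps)
  have k2: "((\<lambda>y. \<kappa> (A - (y - x b)) (B - (y\<^sup>2 - (x b)\<^sup>2)) (C - (y ^ 3 - x b ^ 3))) has_field_derivative - \<kappa>' A B C (x b)) (at (x b))" for A B C
    using \<kappa>2[of "A + x b" "B + (x b)\<^sup>2" "C + x b ^ 3" "x b"] by (simp add: algebra_simps)
  let ?L = "\<Sum>s\<in>J. \<beta> / (x b - x s)"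
  have main: "((\<lambda>y. (\<Prod>s\<in>S. ((y - x s) / (x b - x s)) ^ \<beta>) * \<kappa> (pdiff 1 S (J - S) x + (y - x b)) (pdiff 2 S (J - S) x + (y\<^sup>2 - (x b)\<^sup>2)) (pdiff 3 S (J - S) x + (y ^ 3 - x b ^ 3))
     + (\<Prod>t\<in>J - S. ((y - x t) / (x b - x t)) ^ \<beta>) * \<kappa> (pdiff 1 S (J - S) x - (y - x b)) (pdiff 2 S (J - S) x - (y\<^sup>2 - (x b)\<^sup>2)) (pdiff 3 S (J - S) x - (y ^ 3 - x b ^ 3)))
     has_field_derivative ?L * \<kappa> (pdiff 1 S (J - S) x) (pdiff 2 S (J - S) x) (pdiff 3 S (J - S) x)) (at (x b))"
    if "S \<in> sel J n i" for S
  proof -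
    have S: "S \<subseteq> J" using that by (auto simp: sel_def)
    have "?L = (\<Sum>s\<in>S. \<beta> / (x b - x s)) + (\<Sum>s\<in>J - S. \<beta> / (x b - x s))"
      using sum.subset_diff[OF S assms(1)] by (simp add: add.commute)
    then have L: "k * (\<Sum>s\<in>S. \<beta> / (x b - x s)) + k * (\<Sum>s\<in>J - S. \<beta> / (x b - x s)) = ?L * k" for k
      by (simp add: algebra_simps)
    show ?thesis
      using DERIV_add[OF DERIV_mult[OF dq[OF S] k1] DERIV_mult[OF dq[OF Diff_subset[of J S]] k2],
          of "pdiff 1 S (J - S) x" "pdiff 2 S (J - S) x" "pdiff 3 S (J - S) x" "pdiff 1 S (J - S) x" "pdiff 2 S (J - S) x" "pdiff 3 S (J - S) x"]
      unfolding one[OF S] one[OF Diff_subset[of J S]] diff_self add_0_right diff_0_right L[symmetric]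
      by (elim DERIV_cong) (simp add: algebra_simps)
  qed
  have e: "(-1) ^ (\<beta> * m) = (1::real)" "(-1) ^ \<beta> = (1::real)" for m using \<open>even \<beta>\<close> by auto
  have val: "?L * Qsum \<beta> (\<lambda>_. 1) \<kappa> x J n i = (\<Sum>S\<in>sel J n (Suc i). 0) + (\<Sum>S\<in>sel J (Suc n) i. 0) +
      (\<Sum>S\<in>sel J n i. 1 / cross \<beta> x S (J - S) * (?L * \<kappa> (pdiff 1 S (J - S) x) (pdiff 2 S (J - S) x) (pdiff 3 S (J - S) x)))"
    unfolding Qsum_def sum_distrib_left by (auto intro!: sum.cong)
  have "((\<lambda>y. Nsum \<beta> (\<lambda>_. 1) \<kappa> x a (insert b J) (Suc n) i y) has_field_derivative
     ?L * Qsum \<beta> (\<lambda>_. 1) \<kappa> x J n i) (at (x b))"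
    unfolding val Nsum_insert[OF assms(1-4)] e prod.neutral_const mult_1
    apply (intro DERIV_add DERIV_sum DERIV_cmult)
    subgoal by (rule van, unfold divide_inverse, (rule DERIV_mult DERIV_const dpow \<kappa>1)+)
    subgoal by (rule van, unfold divide_inverse, (rule DERIV_mult DERIV_const dpow \<kappa>2)+)
    subgoal by (rule main)
    done
  then show ?thesis .
qed


section \<open>Root counting and degree bounds\<close>

lemma poly_eq_0_if_many_roots:
  fixes p :: "real poly"
  assumes "finite B" "\<And>b. b \<in> B \<Longrightarrow> poly p b = 0" "degree p < card B"
  shows "p = 0"
proof (rule ccontr)
  assume p: "p \<noteq> 0"
  have "card B \<le> card {x. poly p x = 0}"
    using assms p by (intro card_mono poly_roots_finite) auto
  also have "\<dots> \<le> degree p" using p by (rule card_poly_roots_bound)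
  finally show False using assms(3) by simp
qed

lemma poly_eq_0_if_many_double_roots:
  fixes p :: "real poly"
  assumes "finite B" "\<And>b. b \<in> B \<Longrightarrow> poly p b = 0" "\<And>b. b \<in> B \<Longrightarrow> poly (pderiv p) b = 0" "degree p < 2 * card B"
  shows "p = 0"
proof (rule ccontr)
  assume p: "p \<noteq> 0"
  have "2 \<le> order b p" if b: "b \<in> B" for b
  proof -
    obtain q where q: "p = [:-b, 1:] * q" using assms(2)[OF b] unfolding poly_eq_0_iff_dvd by (elim dvdE)
    have "poly q b = 0" using assms(3)[OF b] unfolding q pderiv_mult by (simp add: pderiv_pCons)
    then obtain r where r: "q = [:-b, 1:] * r" unfolding poly_eq_0_iff_dvd by (elim dvdE)
    have "p = [:-b, 1:] ^ 2 * r" by (simp only: q r power2_eq_square mult.assoc)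
    then have "[:-b, 1:] ^ 2 dvd p" by (rule dvdI)
    then show ?thesis using p order_divides by blast
  qed
  then have "2 * card B \<le> (\<Sum>b\<in>B. order b p)" using sum_mono[of B "\<lambda>_. 2" "\<lambda>b. order b p"] by simp
  also have "\<dots> \<le> (\<Sum>b | poly p b = 0. order b p)"
    using assms p by (intro sum_mono2 poly_roots_finite) auto
  also have "\<dots> \<le> degree p" using p by (rule sum_order_le_degree)
  finally show False using assms(4) by simp
qed

text \<open>The coefficients of y^3 and y^4 carry the factor \<open>\<eta> - 1\<close>. For
  \<open>\<eta> = 1\<close> the degree therefore falls from 4 to 2, and for
  \<open>\<eta> = 4\<close> the leading coefficient is 3.\<close>

definition kpoly :: "real \<Rightarrow> real \<Rightarrow> real \<Rightarrow> real \<Rightarrow> real poly" where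
  "kpoly \<eta> a b c = [:\<eta> * a ^ 4 + 3 * b\<^sup>2 - 4 * a * c, 4 * \<eta> * a ^ 3 - 4 * c, 6 * \<eta> * a\<^sup>2 + 6 * b, 4 * (\<eta> - 1) * a, \<eta> - 1:]"

lemma poly_kpoly: "poly (kpoly \<eta> a b c) y = kp \<eta> (a + y) (b + y\<^sup>2) (c + y ^ 3)"
  unfolding kpoly_def kp_def by simp algebra

lemma kp_minus: "kp \<eta> (- a) (- b) (- c) = kp \<eta> a b c"
  unfolding kp_def by simp

lemma degree_kpoly: "degree (kpoly \<eta> a b c) \<le> 4"
  unfolding kpoly_def by simp

lemma degree_kpoly_1: "degree (kpoly 1 a b c) \<le> 2"
  unfolding kpoly_def by simp

text \<open>Since \<open>kp\<close> is invariant under a joint sign change of its arguments, the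
  terms with \<open>a\<close> in the second block can use the same \<open>K\<close> at negated power
  sum differences.\<close>

definition Npoly :: "nat \<Rightarrow> (nat \<Rightarrow> real) \<Rightarrow> (real \<Rightarrow> real \<Rightarrow> real \<Rightarrow> real poly) \<Rightarrow> (nat \<Rightarrow> real) \<Rightarrow> nat \<Rightarrow> nat set \<Rightarrow> nat \<Rightarrow> nat \<Rightarrow> real poly" where
  "Npoly \<beta> \<epsilon> K x a J n i =
    (\<Sum>S\<in>sel J n (Suc i). smult ((\<Prod>s\<in>S. \<epsilon> s) * \<epsilon> a * (-1) ^ (\<beta> * card (J - S)) / cross \<beta> x S (J - S))
       ((\<Prod>s\<in>S. [:- x s, 1:] ^ \<beta>) * K (pdiff 1 S (J - S) x) (pdiff 2 S (J - S) x) (pdiff 3 S (J - S) x)))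
  + (\<Sum>S\<in>sel J n i. smult ((\<Prod>s\<in>S. \<epsilon> s) / cross \<beta> x S (J - S))
       ((\<Prod>t\<in>J - S. [:- x t, 1:] ^ \<beta>) * K (- pdiff 1 S (J - S) x) (- pdiff 2 S (J - S) x) (- pdiff 3 S (J - S) x)))"

lemma poly_Npoly:
  assumes "\<And>a b c y. poly (K a b c) y = \<kappa> (a + y) (b + y\<^sup>2) (c + y ^ 3)"
    and "\<And>a b c. \<kappa> (- a) (- b) (- c) = \<kappa> a b c"
  shows "poly (Npoly \<beta> \<epsilon> K x a J n i) y = Nsum \<beta> \<epsilon> \<kappa> x a J n i y"
proof -
  have m: "\<kappa> (u - a) (v - b) (w - c) = \<kappa> (a - u) (b - v) (c - w)" for a b c u v w
    using assms(2)[of "a - u" "b - v" "c - w"] by simp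
  show ?thesis
    unfolding Npoly_def Nsum_def by (simp add: poly_sum poly_prod assms(1) mult.assoc) (simp add: m)
qed

lemma degree_prod_linear: "degree (\<Prod>s\<in>S. [:- x s, 1::real:] ^ \<beta>) \<le> \<beta> * card S"
proof (cases "finite S")
  case True
  then show ?thesis
  proof (induction S rule: finite_induct)
    case (insert s S)
    have "degree ([:- x s, 1:] ^ \<beta> * (\<Prod>s\<in>S. [:- x s, 1:] ^ \<beta>)) \<le> degree ([:- x s, 1:] ^ \<beta>) + degree (\<Prod>s\<in>S. [:- x s, 1:] ^ \<beta>)"
      by (rule degree_mult_le)
    also have "degree ([:- x s, 1:] ^ \<beta>) \<le> \<beta>" using degree_power_le[of "[:- x s, 1:]" \<beta>] by simp
    finally show ?case using insert by simp
  qed simp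
qed simp

lemma degree_Npoly:
  assumes "\<And>a b c. degree (K a b c) \<le> k"
    and "\<And>S. S \<in> sel J n (Suc i) \<Longrightarrow> \<beta> * card S + k \<le> d" "\<And>S. S \<in> sel J n i \<Longrightarrow> \<beta> * card (J - S) + k \<le> d" "finite J"
  shows "degree (Npoly \<beta> \<epsilon> K x a J n i) \<le> d"
proof -
  have h: "degree (smult r ((\<Prod>s\<in>S. [:- x s, 1:] ^ \<beta>) * K a b c)) \<le> \<beta> * card S + k" for r S a b c
    using degree_smult_le[of r "(\<Prod>s\<in>S. [:- x s, 1:] ^ \<beta>) * K a b c"] degree_mult_le[of "(\<Prod>s\<in>S. [:- x s, 1:] ^ \<beta>)" "K a b c"]
      degree_prod_linear[of x \<beta> S] assms(1)[of a b c] by linarith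
  show ?thesis
    unfolding Npoly_def
    by (intro degree_add_le degree_sum_le finite_sel assms(4); rule order_trans[OF h]) (simp_all add: assms)
qed

lemma kp_deriv_plus:
  "((\<lambda>y. kp \<eta> (A + y) (B + y\<^sup>2) (C + y ^ 3)) has_field_derivative
     (\<lambda>a b c y. 4 * \<eta> * a ^ 3 + 12 * b * y - 4 * c - 12 * a * y\<^sup>2) (A + y) (B + y\<^sup>2) (C + y ^ 3) y) (at y)"
  unfolding kp_def by (auto intro!: derivative_eq_intros) algebra

lemma kp_deriv_minus:
  "((\<lambda>y. kp \<eta> (A - y) (B - y\<^sup>2) (C - y ^ 3)) has_field_derivative
     - (\<lambda>a b c y. 4 * \<eta> * a ^ 3 + 12 * b * y - 4 * c - 12 * a * y\<^sup>2) (A - y) (B - y\<^sup>2) (C - y ^ 3) y) (at y)"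
  unfolding kp_def by (auto intro!: derivative_eq_intros) algebra

text \<open>These are Newton's identities for the roots \<open>x s\<close> taken four times: e_1 = 4
  p_1 and e_2 = (16 p_1^2 - 4 p_2) / 2. The extra factor y^3 keeps the exponents and the bound on
  \<open>R\<close> free of subtraction, even for empty \<open>S\<close>.\<close>

lemma prod_linear_expansion:
  assumes "finite S"
  shows "\<exists>R. degree R \<le> 4 * card S \<and>
    monom 1 3 * (\<Prod>s\<in>S. [:- x s, 1:] ^ 4) =
      monom 1 (4 * card S + 1) * [:8 * (psum 1 S x)\<^sup>2 - 2 * psum 2 S x, - 4 * psum 1 S x, 1:] + (R :: real poly)"
  using assms
proof (induction S rule: finite_induct)
  case empty
  have "(monom 1 3 :: real poly) = monom 1 1 * [:0, 0, 1:]" by (simp add: monom_altdef power3_eq_cube)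
  then show ?case by (intro exI[of _ 0]) (simp add: psum_def)
next
  case (insert s S)
  then obtain R where R: "degree R \<le> 4 * card S"
    "monom 1 3 * (\<Prod>s\<in>S. [:- x s, 1:] ^ 4) =
      monom 1 (4 * card S + 1) * [:8 * (psum 1 S x)\<^sup>2 - 2 * psum 2 S x, - 4 * psum 1 S x, 1:] + R" by auto
  define p q u where "p = psum 1 S x" "q = 8 * (psum 1 S x)\<^sup>2 - 2 * psum 2 S x" "u = x s"
  \<comment> \<open>\<open>B\<close> collects the coefficients of y^0 to y^3 that remain below the
    new leading part after multiplication by the quartic \<open>[:- u, 1:] ^ 4\<close>.\<close>
  define B where "B = [:q * u ^ 4, - 4 * p * u ^ 4 - 4 * q * u ^ 3, u ^ 4 + 16 * p * u ^ 3 + 6 * q * u\<^sup>2, - 4 * u ^ 3 - 24 * p * u\<^sup>2 - 4 * q * u:]"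
  have p4: "[:- u, 1:] ^ 4 = [:u ^ 4, - 4 * u ^ 3, 6 * u\<^sup>2, - 4 * u, 1:]"
    by (simp add: numeral_eq_Suc algebra_simps)
  have x4: "monom 1 (n + 4) = monom 1 n * [:0, 0, 0, 0, 1::real:]" for n
    by (simp add: monom_altdef power_add numeral_eq_Suc)
  have br: "[:q, - 4 * p, 1:] * [:u ^ 4, - 4 * u ^ 3, 6 * u\<^sup>2, - 4 * u, 1:] =
      [:0, 0, 0, 0, 1:] * [:8 * (u + p)\<^sup>2 - 2 * (u\<^sup>2 + psum 2 S x), - 4 * (u + p), 1:] + B"
    unfolding B_def p_q_u_def(2) p_q_u_def(1)[symmetric] by (simp add: algebra_simps power2_eq_square power3_eq_cube numeral_eq_Suc)
  have "monom 1 3 * (\<Prod>s\<in>insert s S. [:- x s, 1:] ^ 4) = [:- u, 1:] ^ 4 * (monom 1 3 * (\<Prod>s\<in>S. [:- x s, 1:] ^ 4))"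
    using insert by (simp add: p_q_u_def)
  also have "\<dots> = monom 1 (4 * card S + 1) * ([:q, - 4 * p, 1:] * [:- u, 1:] ^ 4) + R * [:- u, 1:] ^ 4"
    unfolding R p_q_u_def by (simp only: distrib_left mult.assoc mult.commute mult.left_commute)
  also have "\<dots> = monom 1 (4 * card S + 1) * [:0, 0, 0, 0, 1:] * [:8 * (u + p)\<^sup>2 - 2 * (u\<^sup>2 + psum 2 S x), - 4 * (u + p), 1:]
      + (monom 1 (4 * card S + 1) * B + R * [:- u, 1:] ^ 4)"
    unfolding p4 br by (simp only: distrib_left mult.assoc add.assoc)
  also have "monom 1 (4 * card S + 1) * [:0, 0, 0, 0, 1:] = monom (1::real) (4 * card (insert s S) + 1)"
    using insert x4[of "4 * card S + 1"] by (simp add: algebra_simps)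
  finally have eq: "monom 1 3 * (\<Prod>s\<in>insert s S. [:- x s, 1:] ^ 4) =
      monom 1 (4 * card (insert s S) + 1) * [:8 * (psum 1 (insert s S) x)\<^sup>2 - 2 * psum 2 (insert s S) x, - 4 * psum 1 (insert s S) x, 1:]
      + (monom 1 (4 * card S + 1) * B + R * [:- u, 1:] ^ 4)"
    using insert by (simp add: psum_insert p_q_u_def)
  have "degree (monom 1 (4 * card S + 1) * B) \<le> (4 * card S + 1) + 3"
    by (rule order_trans[OF degree_mult_le]) (intro add_mono degree_monom_le, simp add: B_def)
  moreover have "degree (R * [:- u, 1:] ^ 4) \<le> 4 * card S + 4"
    by (rule order_trans[OF degree_mult_le]) (intro add_mono R(1), simp add: p4)
  ultimately have "degree (monom 1 (4 * card S + 1) * B + R * [:- u, 1:] ^ 4) \<le> 4 * card (insert s S)"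
    using insert by (intro degree_add_le) auto
  then show ?case using eq by blast
qed

text \<open>
  For \<open>\<beta> = 4\<close> the naive degree bound is too large by three; the three leading coefficients of the term
  with \<open>a\<close> in the first block cancel against those of the matching term on the right-hand side.
\<close>

lemma degree_quartic_cancellation:
  assumes "finite S" "finite T" "card T = Suc (card S)"
  shows "degree ((\<Prod>s\<in>S. [:- x s, 1:] ^ 4) * kpoly 4 (pdiff 1 S T x) (pdiff 2 S T x) (pdiff 3 S T x)
      - smult 3 (\<Prod>t\<in>T. [:- x t, 1:] ^ 4)) \<le> 4 * card S + 1" (is "degree ?d \<le> _")
proof (cases "?d = 0")
  case False
  define a b a2 b2 where ab: "a = psum 1 S x" "b = psum 1 T x" "a2 = psum 2 S x" "b2 = psum 2 T x"
  let ?K = "kpoly 4 (pdiff 1 S T x) (pdiff 2 S T x) (pdiff 3 S T x)"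
  obtain R where R: "degree R \<le> 4 * card S"
    "monom 1 3 * (\<Prod>s\<in>S. [:- x s, 1:] ^ 4) = monom 1 (4 * card S + 1) * [:8 * a\<^sup>2 - 2 * a2, - 4 * a, 1:] + R"
    using prod_linear_expansion[OF assms(1), of x] unfolding ab by blast
  obtain Q where Q: "degree Q \<le> 4 * card T"
    "monom 1 3 * (\<Prod>s\<in>T. [:- x s, 1:] ^ 4) = monom 1 (4 * card T + 1) * [:8 * b\<^sup>2 - 2 * b2, - 4 * b, 1:] + Q"
    using prod_linear_expansion[OF assms(2), of x] unfolding ab by blast
  have x4: "monom 1 (4 * card T + 1) = monom 1 (4 * card S + 1) * [:0, 0, 0, 0, 1::real:]"
    by (simp add: monom_altdef power_add numeral_eq_Suc assms(3))
  define c0 c1 where c: "c0 = 4 * (a - b) ^ 4 + 3 * (a2 - b2)\<^sup>2 - 4 * (a - b) * pdiff 3 S T x" "c1 = 16 * (a - b) ^ 3 - 4 * pdiff 3 S T x"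
  have K: "?K = [:c0, c1, 24 * (a - b)\<^sup>2 + 6 * (a2 - b2), 12 * (a - b), 3:]"
    unfolding kpoly_def c ab by (simp add: pdiff_def)
  define B where "B = [:(8 * a\<^sup>2 - 2 * a2) * c0, (8 * a\<^sup>2 - 2 * a2) * c1 - 4 * a * c0,
     (8 * a\<^sup>2 - 2 * a2) * (24 * (a - b)\<^sup>2 + 6 * (a2 - b2)) - 4 * a * c1 + c0,
     (8 * a\<^sup>2 - 2 * a2) * (12 * (a - b)) - 4 * a * (24 * (a - b)\<^sup>2 + 6 * (a2 - b2)) + c1:]"
  \<comment> \<open>The cancellation: the coefficients of y^6, y^5 and y^4 on the left are 3, then
    12 (a - b) - 12 a = - 12 b, then 24 (a - b)^2 + 6 (a2 - b2) - 48 a (a - b) + 24 a^2 - 6 a2 = 24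
    b^2 - 6 b2, that is, three times those belonging to \<open>T\<close>.\<close>
  have br: "[:8 * a\<^sup>2 - 2 * a2, - 4 * a, 1:] * ?K = smult 3 ([:0, 0, 0, 0, 1:] * [:8 * b\<^sup>2 - 2 * b2, - 4 * b, 1:]) + B"
    unfolding K B_def by (simp add: algebra_simps power2_eq_square)
  have "monom 1 3 * ?d = (monom 1 3 * (\<Prod>s\<in>S. [:- x s, 1:] ^ 4)) * ?K - smult 3 (monom 1 3 * (\<Prod>s\<in>T. [:- x s, 1:] ^ 4))"
    by (simp add: algebra_simps)
  also have "\<dots> = monom 1 (4 * card S + 1) * ([:8 * a\<^sup>2 - 2 * a2, - 4 * a, 1:] * ?K) + R * ?K
       - smult 3 (monom 1 (4 * card S + 1) * ([:0, 0, 0, 0, 1:] * [:8 * b\<^sup>2 - 2 * b2, - 4 * b, 1:])) - smult 3 Q"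
    unfolding R Q x4 by (simp only: distrib_right mult.assoc smult_add_right diff_diff_eq)
  also have "\<dots> = monom 1 (4 * card S + 1) * B + R * ?K - smult 3 Q"
    unfolding br by (simp only: distrib_left mult_smult_right)
  finally have eq: "monom 1 3 * ?d = monom 1 (4 * card S + 1) * B + R * ?K - smult 3 Q" .
  have "degree (monom 1 (4 * card S + 1) * B) \<le> (4 * card S + 1) + 3"
    by (rule order_trans[OF degree_mult_le]) (intro add_mono degree_monom_le, simp add: B_def)
  moreover have "degree (R * ?K) \<le> 4 * card S + 4"
    by (rule order_trans[OF degree_mult_le]) (intro add_mono R(1) degree_kpoly)
  moreover have "degree (smult 3 Q) \<le> 4 * card S + 4" using Q(1) assms(3) by simp
  ultimately have "degree (monom 1 3 * ?d) \<le> 4 * card S + 4"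
    unfolding eq by (intro degree_add_le degree_diff_le) auto
  \<comment> \<open>Removing the auxiliary factor y^3 turns the bound 4 card S + 4 into 4 card S +
    1.\<close>
  moreover have "degree (monom 1 3 * ?d) = 3 + degree ?d"
    using False by (subst degree_mult_eq) (auto simp: degree_monom_eq monom_eq_0_iff)
  ultimately show ?thesis by simp
qed (simp only: degree_0)

section \<open>Small cases and the three inductions\<close>

lemma sel_0: "finite I \<Longrightarrow> sel I 0 0 = {{}}"
  unfolding sel_def using finite_subset by fastforce

lemma sel_eq_empty: "n < i \<Longrightarrow> sel I n i = {}"
  unfolding sel_def by auto

lemma kp_0: "kp \<eta> 0 0 0 = 0"
  unfolding kp_def by simp

lemma kp_two_points: "kp 1 (u - v) (u\<^sup>2 - v\<^sup>2) (u ^ 3 - v ^ 3) = 0"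
  unfolding kp_def by algebra

text \<open>The right-hand side is 12 times \<open>cross\<close> for \<beta> = 1, so all splittings
  of four points into two pairs contribute equally up to their labels.\<close>

lemma kp_four_points:
  "kp 1 (a + b - (c + d)) (a\<^sup>2 + b\<^sup>2 - (c\<^sup>2 + d\<^sup>2)) (a ^ 3 + b ^ 3 - (c ^ 3 + d ^ 3)) = 12 * ((c - a) * (d - a) * (c - b) * (d - b))"
  unfolding kp_def by algebra

lemma Qsum_two_points:
  assumes "card I = 2"
  shows "Qsum \<beta> \<epsilon> (kp 1) x I 1 0 = 0"
proof -
  have "kp 1 (pdiff 1 S (I - S) x) (pdiff 2 S (I - S) x) (pdiff 3 S (I - S) x) = 0" if "S \<in> sel I 1 0" for S
  proof -
    have S: "S \<subseteq> I" "card S = 1" using that by (auto simp: sel_def)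
    then obtain s where s: "S = {s}" by (auto simp: card_1_singleton_iff)
    have "card (I - S) = 1" using S assms by (simp add: card_Diff_subset s)
    then obtain t where t: "I - S = {t}" by (auto simp: card_1_singleton_iff)
    show ?thesis unfolding t unfolding s pdiff_def psum_def using kp_two_points by simp
  qed
  then show ?thesis unfolding Qsum_def by simp
qed

text \<open>Each splitting contributes 12 times a product of two labels. The labels have sum 0 and
  squares 1, so their second elementary symmetric function is (0 - 4) / 2 = -2; this is the origin
  of -24.\<close>

lemma Qsum_four_points:
  assumes "card I = 4" "inj_on x I" "\<And>i. i \<in> I \<Longrightarrow> \<epsilon> i = 1 \<or> \<epsilon> i = -1" "(\<Sum>i\<in>I. \<epsilon> i) = 0"
  shows "Qsum 1 \<epsilon> (kp 1) x I 2 0 = - 24"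
proof -
  have fin: "finite I" using assms(1) by (metis card.infinite zero_neq_numeral)
  have "\<exists>a b c d. I = {a, b, c, d} \<and> distinct [a, b, c, d]"
  proof -
    obtain l where l: "set l = I" "distinct l" using finite_distinct_list[OF fin] by auto
    then have "length l = 4" using assms(1) distinct_card by fastforce
    then obtain a b c d where "l = [a, b, c, d]"
      by (auto simp: numeral_eq_Suc length_Suc_conv)
    with l show ?thesis by (metis list.set(1,2))
  qed
  then obtain a b c d where I: "I = {a, b, c, d}" and dist: "distinct [a, b, c, d]" by auto
  have q: "kp 1 (pdiff 1 S (I - S) x) (pdiff 2 S (I - S) x) (pdiff 3 S (I - S) x) / cross 1 x S (I - S) = 12"
    if "S \<in> sel I 2 0" for S
  proof -
    have S: "S \<subseteq> I" "card S = 2" using that by (auto simp: sel_def)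
    then obtain s s' where s: "S = {s, s'}" "s \<noteq> s'" by (auto simp: card_2_iff)
    have "card (I - S) = 2" using S assms(1) s finite_subset[OF S(1) fin] by (subst card_Diff_subset) auto
    then obtain t t' where t: "I - S = {t, t'}" "t \<noteq> t'" by (auto simp: card_2_iff)
    have "x t \<noteq> x s" "x t' \<noteq> x s" "x t \<noteq> x s'" "x t' \<noteq> x s'"
      using t s S assms(2) by (auto simp: inj_on_def)
    then have nz: "(x t - x s) * (x t' - x s) * (x t - x s') * (x t' - x s') \<noteq> 0" by simp
    have "cross 1 x S (I - S) = (x t - x s) * (x t' - x s) * (x t - x s') * (x t' - x s')"
      unfolding t(1) unfolding s(1) cross_def using s t by simp
    moreover have "kp 1 (pdiff 1 S (I - S) x) (pdiff 2 S (I - S) x) (pdiff 3 S (I - S) x) = 12 * ((x t - x s) * (x t' - x s) * (x t - x s') * (x t' - x s'))"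
      unfolding t(1) unfolding s(1) pdiff_def psum_def using s t kp_four_points by simp
    ultimately show ?thesis using nz by (simp del: mult_eq_0_iff)
  qed
  have "Qsum 1 \<epsilon> (kp 1) x I 2 0 = (\<Sum>S\<in>sel I 2 0. (\<Prod>s\<in>S. \<epsilon> s) * 12)"
    unfolding Qsum_def using q by (intro sum.cong refl) (metis times_divide_eq_right)
  also have "\<dots> = 12 * (\<Sum>S\<in>sel I 2 0. \<Prod>s\<in>S. \<epsilon> s)" by (simp add: sum_distrib_left mult.commute)
  also have "(\<Sum>S\<in>sel I 2 0. \<Prod>s\<in>S. \<epsilon> s) = \<epsilon> a * \<epsilon> b + \<epsilon> a * \<epsilon> c + \<epsilon> a * \<epsilon> d + \<epsilon> b * \<epsilon> c + \<epsilon> b * \<epsilon> d + \<epsilon> c * \<epsilon> d"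
  proof -
    have e: "sel {} k i = (if k = i then {{}} else {})" for k i unfolding sel_def by auto
    show ?thesis unfolding I using dist by (simp add: sum_sel_insert e algebra_simps)
  qed
  also have "12 * \<dots> = 6 * ((\<Sum>i\<in>I. \<epsilon> i)\<^sup>2 - ((\<epsilon> a)\<^sup>2 + (\<epsilon> b)\<^sup>2 + (\<epsilon> c)\<^sup>2 + (\<epsilon> d)\<^sup>2))"
    unfolding I using dist by (simp add: algebra_simps power2_eq_square)
  also have "(\<epsilon> i)\<^sup>2 = 1" if "i \<in> I" for i using assms(3)[OF that] by auto
  then have "6 * ((\<Sum>i\<in>I. \<epsilon> i)\<^sup>2 - ((\<epsilon> a)\<^sup>2 + (\<epsilon> b)\<^sup>2 + (\<epsilon> c)\<^sup>2 + (\<epsilon> d)\<^sup>2)) = - 24"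
    using assms(4) by (simp add: I)
  finally show ?thesis .
qed

lemma Qsum_eq_from_Npoly:
  assumes "poly p (x a) = Nsum \<beta> \<epsilon> \<kappa> x a J n i (x a) + c * Nsum \<beta> \<epsilon> \<kappa>' x a J n j (x a)" "p = 0"
    "finite J" "a \<notin> J" "inj_on x (insert a J)"
  shows "Qsum \<beta> \<epsilon> \<kappa> x (insert a J) n i = - c * Qsum \<beta> \<epsilon> \<kappa>' x (insert a J) n j"
proof -
  have xa: "x a \<notin> x ` J" using assms by auto
  have "(\<Prod>j\<in>J. (x a - x j) ^ \<beta>) \<noteq> 0" using assms by (auto simp: prod_zero_iff)
  moreover have "(\<Prod>j\<in>J. (x a - x j) ^ \<beta>) * (Qsum \<beta> \<epsilon> \<kappa> x (insert a J) n i + c * Qsum \<beta> \<epsilon> \<kappa>' x (insert a J) n j) = 0"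
    using assms(1,2) unfolding Nsum_eq_Qsum[OF assms(3,4) xa] by (simp add: algebra_simps)
  ultimately show ?thesis by simp
qed

abbreviation "one3 \<equiv> (\<lambda>_ _ _ :: real. 1 :: real)"

lemma poly_Npoly_kpoly: "poly (Npoly \<beta> \<epsilon> (kpoly \<eta>) x a J n i) y = Nsum \<beta> \<epsilon> (kp \<eta>) x a J n i y"
  by (rule poly_Npoly) (auto simp: poly_kpoly kp_minus)

lemma poly_Npoly_1: "poly (Npoly \<beta> \<epsilon> (\<lambda>_ _ _. 1) x a J n i) y = Nsum \<beta> \<epsilon> one3 x a J n i y"
  by (rule poly_Npoly) auto

text \<open>Arbitrary balanced labels are allowed because the alternating pattern of
  \<open>split_sign\<close> is not stable under the induction: dropping the first and the fourth of
  six alternating labels destroys it, while balance is preserved.\<close>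

lemma Qsum_beta1:
  assumes "finite I" "card I = 2 * n" "inj_on x I" "\<And>i. i \<in> I \<Longrightarrow> \<epsilon> i = 1 \<or> \<epsilon> i = -1" "(\<Sum>i\<in>I. \<epsilon> i) = 0"
  shows "Qsum 1 \<epsilon> (kp 1) x I n 0 = - 24 * Qsum 1 \<epsilon> one3 x I n 2"
  using assms
proof (induction n arbitrary: I)
  case 0
  then have "I = {}" by simp
  then show ?case by (simp add: Qsum_def sel_0 sel_eq_empty pdiff_def psum_def kp_0)
next
  case (Suc n)
  \<comment> \<open>The degree bound \<open>n + 2\<close> is below the number
    \<open>2 * n + 1\<close> of roots only for \<open>n \<ge> 2\<close>, so blocks of one and of two
    points are treated directly.\<close>
  consider "n = 0" | "n = 1" | "n \<ge> 2" by linarith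
  then show ?case
  proof cases
    case 1
    then show ?thesis using Qsum_two_points[of I 1 \<epsilon> x] Suc by (simp add: Qsum_def sel_eq_empty)
  next
    case 2
    have "sel I 2 2 = {{}}" using sel_0[OF Suc.prems(1)] sel_Suc_Suc[of I] by (simp add: numeral_2_eq_2)
    then have "Qsum 1 \<epsilon> one3 x I 2 2 = 1" by (simp add: Qsum_def cross_def)
    then show ?thesis using Qsum_four_points[of I x \<epsilon>] Suc.prems 2 by (simp add: numeral_2_eq_2[symmetric])
  next
    case 3
    have "I \<noteq> {}" using Suc.prems by auto
    then obtain a where a: "a \<in> I" by auto
    define J where "J = I - {a}"
    have J: "finite J" "a \<notin> J" "I = insert a J" "card J = 2 * n + 1" "inj_on x J"
      using Suc.prems a by (auto simp: J_def inj_on_diff)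
    define p where "p = Npoly 1 \<epsilon> (kpoly 1) x a J (Suc n) 0 + smult 24 (Npoly 1 \<epsilon> (\<lambda>_ _ _. 1) x a J (Suc n) 2)"
    have pp: "poly p y = Nsum 1 \<epsilon> (kp 1) x a J (Suc n) 0 y + 24 * Nsum 1 \<epsilon> one3 x a J (Suc n) 2 y" for y
      unfolding p_def by (simp add: poly_Npoly_kpoly poly_Npoly_1)
    have "p = 0"
    proof (rule poly_eq_0_if_many_roots[of "x ` J"])
      fix y assume "y \<in> x ` J"
      then obtain b where b: "b \<in> J" "y = x b" by auto
      define J' where "J' = J - {b}"
      have J': "finite J'" "b \<notin> J'" "J = insert b J'" "card J' = 2 * n" "inj_on x J'" "x b \<notin> x ` J'"
        using J b by (auto simp: J'_def inj_on_diff inj_on_def)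
      show "poly p y = 0"
      \<comment> \<open>Equal labels make the collision factor vanish; opposite labels leave
        \<open>J'\<close> balanced, so that the induction hypothesis applies.\<close>
      proof (cases "\<epsilon> a = \<epsilon> b")
        case True
        then show ?thesis unfolding pp b(2) J'(3) using J' by (simp add: Nsum_root)
      next
        case False
        have ab: "\<epsilon> a + \<epsilon> b = 0" using False Suc.prems(4)[OF a] Suc.prems(4)[of b] b J by auto
        have "(\<Sum>i\<in>I. \<epsilon> i) = \<epsilon> a + (\<epsilon> b + (\<Sum>i\<in>J'. \<epsilon> i))" using J J' by simp
        then have "(\<Sum>i\<in>J'. \<epsilon> i) = 0" using ab Suc.prems(5) by simp
        then have IH: "Qsum 1 \<epsilon> (kp 1) x J' n 0 = - 24 * Qsum 1 \<epsilon> one3 x J' n 2"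
          using Suc.prems(4) J J' by (intro Suc.IH) auto
        \<comment> \<open>The two exponents are \<open>n\<close> and \<open>n + 2\<close>.\<close>
        have "(-1::real) ^ (1 * (card J' - (n - 0))) = (-1) ^ (1 * (card J' - (n - 2)))"
          using 3 J'(4) by (auto simp: minus_one_power_iff)
        then show ?thesis unfolding pp b(2) J'(3)
          using J' IH by (simp add: Nsum_root)
      qed
    next
      have "degree (Npoly 1 \<epsilon> (kpoly 1) x a J (Suc n) 0) \<le> n + 2"
        using J by (intro degree_Npoly[where k = 2] degree_kpoly_1) (auto simp: sel_def card_Diff_subset finite_subset)
      moreover have "degree (Npoly 1 \<epsilon> (\<lambda>_ _ _. 1) x a J (Suc n) 2) \<le> n + 2"
        using J 3 by (intro degree_Npoly[where k = 0]) (auto simp: sel_def card_Diff_subset finite_subset)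
      ultimately have "degree p \<le> n + 2"
        unfolding p_def by (intro degree_add_le) auto
      also have "\<dots> < card (x ` J)" using J 3 by (simp add: card_image)
      finally show "degree p < card (x ` J)" .
    qed (use J in auto)
    then show ?thesis using Qsum_eq_from_Npoly[OF pp] J Suc.prems by simp
  qed
qed

text \<open>Value and derivative at a collision are both multiples of the smaller sum, so all roots
  are double. In the step to \<open>Suc n\<close>, the 4 n + 2 roots counted with multiplicity
  exceed the degree 2 n + 2 unless n = 0, which is the case of two points.\<close>

lemma Qsum_beta2:
  assumes "finite I" "card I = 2 * n" "inj_on x I"
  shows "Qsum 2 (\<lambda>_. 1) (kp 1) x I n 0 = 0"
  using assms
proof (induction n arbitrary: I)
  case 0
  then have "I = {}" by simp
  then show ?case by (simp add: Qsum_def sel_0 pdiff_def psum_def kp_0)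
next
  case (Suc n)
  show ?case
  proof (cases "n = 0")
    case True
    then show ?thesis using Qsum_two_points[of I] Suc by simp
  next
    case False
    have "I \<noteq> {}" using Suc.prems by auto
    then obtain a where a: "a \<in> I" by auto
    define J where "J = I - {a}"
    have J: "finite J" "a \<notin> J" "I = insert a J" "card J = 2 * n + 1" "inj_on x J"
      using Suc.prems a by (auto simp: J_def inj_on_diff)
    define p where "p = Npoly 2 (\<lambda>_. 1) (kpoly 1) x a J (Suc n) 0"
    have pp: "poly p y = Nsum 2 (\<lambda>_. 1) (kp 1) x a J (Suc n) 0 y" for y
      unfolding p_def by (simp add: poly_Npoly_kpoly)
    have r: "poly p (x b) = 0 \<and> poly (pderiv p) (x b) = 0" if b: "b \<in> J" for b
    proof -
      define J' where "J' = J - {b}"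
      have J': "finite J'" "b \<notin> J'" "J = insert b J'" "card J' = 2 * n" "inj_on x J'" "x b \<notin> x ` J'"
        using J b by (auto simp: J'_def inj_on_diff inj_on_def)
      have IH: "Qsum 2 (\<lambda>_. 1) (kp 1) x J' n 0 = 0"
        using J' by (intro Suc.IH) auto
      have "(poly p has_field_derivative 0) (at (x b))"
        using Nsum_deriv[OF J'(1,2,6,5) _ _ kp_deriv_plus kp_deriv_minus, of 2 1 a n 0] IH
        unfolding pp J'(3)[symmetric] by (simp add: pp[abs_def, symmetric] fun_eq_iff)
      then have "poly (pderiv p) (x b) = 0" using poly_DERIV DERIV_unique by blast
      then show ?thesis unfolding pp using Nsum_root[OF J'(1,2,6,5)] IH J'(3) by simp
    qed
    have "p = 0"
    proof (rule poly_eq_0_if_many_double_roots[of "x ` J"])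
      have "degree p \<le> 2 * n + 2" unfolding p_def
        using J by (intro degree_Npoly[where k = 2] degree_kpoly_1) (auto simp: sel_def card_Diff_subset finite_subset)
      also have "\<dots> < 2 * card (x ` J)" using J False by (simp add: card_image)
      finally show "degree p < 2 * card (x ` J)" .
    qed (use J r in auto)
    then show ?thesis
      using Qsum_eq_from_Npoly[of p x a 2 "\<lambda>_. 1" "kp 1" J "Suc n" 0 0 "kp 1" 0] J Suc.prems pp[of "x a"] by simp
  qed
qed


lemma one_deriv: "((\<lambda>y. one3 (A + y) (B + y\<^sup>2) (C + y ^ 3)) has_field_derivative (\<lambda>_ _ _ _. 0) (A + y) (B + y\<^sup>2) (C + y ^ 3) y) (at y)"
  "((\<lambda>y. one3 (A - y) (B - y\<^sup>2) (C - y ^ 3)) has_field_derivative - (\<lambda>_ _ _ _. 0) (A - y) (B - y\<^sup>2) (C - y ^ 3) y) (at y)"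
  by simp_all

lemma cross_commute: "even \<beta> \<Longrightarrow> cross \<beta> x S T = cross \<beta> x T S"
proof -
  assume "even \<beta>"
  then have "(u - v) ^ \<beta> = (v - u) ^ \<beta>" for u v :: real
    using power_minus_even[of \<beta> "u - v"] by simp
  then show ?thesis unfolding cross_def by (subst prod.swap) simp
qed

lemma pdiff_commute: "- pdiff k S T x = pdiff k T S x"
  unfolding pdiff_def by simp

lemma smult_sum_right: "smult c (\<Sum>i\<in>A. f i) = (\<Sum>i\<in>A. smult c (f i))"
  by (induction A rule: infinite_finite_induct) (simp_all add: smult_add_right)

text \<open>For even \<beta> a term with \<open>a\<close> in the second block equals the term of the
  complementary splitting with \<open>a\<close> in the first, so the sum of the \<open>?F S\<close>
  occurs twice. Each copy cancels against 3 times the sum of the \<open>?G S\<close>, where 3 is the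
  leading coefficient of \<open>kpoly 4\<close>; hence 6 = 2 * 3. The rest \<open>G\<close>, with
  \<open>a\<close> in the smaller block, is of low degree already.\<close>

lemma degree_Npoly_beta4:
  assumes "finite J" "card J = 2 * n + 1"
  shows "degree (Npoly 4 (\<lambda>_. 1) (kpoly 4) x a J (Suc n) 0 - smult 6 (Npoly 4 (\<lambda>_. 1) (\<lambda>_ _ _. 1) x a J (Suc n) 1)) \<le> 4 * n + 1"
proof -
  let ?h = "\<lambda>S. \<Prod>s\<in>S. [:- x s, 1:] ^ 4"
  let ?K = "\<lambda>S T. kpoly 4 (pdiff 1 S T x) (pdiff 2 S T x) (pdiff 3 S T x)"
  let ?F = "\<lambda>S. smult (1 / cross 4 x S (J - S)) (?h S * ?K S (J - S))"
  let ?G = "\<lambda>S. smult (1 / cross 4 x S (J - S)) (?h (J - S))"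
  have "(\<Sum>S\<in>sel J (Suc n) 0. smult (1 / cross 4 x S (J - S)) (?h (J - S) * ?K (J - S) S)) = (\<Sum>S\<in>sel J n 0. ?F S)"
  proof (rule sum.reindex_bij_witness[of _ "\<lambda>S. J - S" "\<lambda>S. J - S"])
    fix S assume S: "S \<in> sel J (Suc n) 0"
    then have d: "J - (J - S) = S" "finite S" using assms(1) finite_subset by (auto simp: sel_def)
    then show "J - (J - S) = S" "J - S \<in> sel J n 0" using S assms by (auto simp: sel_def card_Diff_subset)
    show "?F (J - S) = smult (1 / cross 4 x S (J - S)) (?h (J - S) * ?K (J - S) S)"
      unfolding d(1) by (simp add: cross_commute[of 4 x S])
  next
    fix S assume S: "S \<in> sel J n 0"
    then have d: "J - (J - S) = S" "finite S" using assms(1) finite_subset by (auto simp: sel_def)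
    then show "J - (J - S) = S" "J - S \<in> sel J (Suc n) 0" using S assms by (auto simp: sel_def card_Diff_subset)
  qed
  then have F: "Npoly 4 (\<lambda>_. 1) (kpoly 4) x a J (Suc n) 0 = (\<Sum>S\<in>sel J n 0. ?F S) + (\<Sum>S\<in>sel J n 0. ?F S)"
    unfolding Npoly_def by (simp add: sel_Suc_Suc pdiff_commute power_mult)
  define G where "G = (\<Sum>S\<in>sel J (Suc n) 2. smult (1 / cross 4 x S (J - S)) (?h S))"
  have dG: "degree G \<le> 4 * n + 1" unfolding G_def
  proof (intro degree_sum_le finite_sel assms(1))
    fix S assume "S \<in> sel J (Suc n) 2"
    then show "degree (smult (1 / cross 4 x S (J - S)) (?h S)) \<le> 4 * n + 1"
      using degree_smult_le[of "1 / cross 4 x S (J - S)" "?h S"] degree_prod_linear[of x 4 S] by (auto simp: sel_def)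
  qed
  have dD: "degree (\<Sum>S\<in>sel J n 0. smult (1 / cross 4 x S (J - S)) (?h S * ?K S (J - S) - smult 3 (?h (J - S)))) \<le> 4 * n + 1" (is "degree ?D \<le> _")
  proof (intro degree_sum_le finite_sel assms(1))
    fix S assume S: "S \<in> sel J n 0"
    then have "finite S" "finite (J - S)" "card (J - S) = Suc (card S)" "card S = n"
      using assms finite_subset[OF _ assms(1)] by (auto simp: sel_def card_Diff_subset)
    then show "degree (smult (1 / cross 4 x S (J - S)) (?h S * ?K S (J - S) - smult 3 (?h (J - S)))) \<le> 4 * n + 1"
      using order_trans[OF degree_smult_le degree_quartic_cancellation[of S "J - S" x]] by simp
  qed
  have eq: "Npoly 4 (\<lambda>_. 1) (kpoly 4) x a J (Suc n) 0 - smult 6 (Npoly 4 (\<lambda>_. 1) (\<lambda>_ _ _. 1) x a J (Suc n) 1) = smult 2 ?D - smult 6 G"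
  proof -
    have N: "Npoly 4 (\<lambda>_. 1) (\<lambda>_ _ _. 1) x a J (Suc n) 1 = G + (\<Sum>S\<in>sel J n 0. ?G S)"
      unfolding Npoly_def G_def Suc_1 using sel_Suc_Suc[of J n 0] by (simp add: power_mult)
    have D: "?D = (\<Sum>S\<in>sel J n 0. ?F S) - smult 3 (\<Sum>S\<in>sel J n 0. ?G S)"
      by (simp add: smult_diff_right sum_subtractf smult_sum_right mult.commute)
    have "(A + A) - smult 6 (C + B) = smult 2 (A - smult 3 B) - smult 6 C" for A B C :: "real poly"
      by (rule poly_eqI) (simp only: coeff_add coeff_diff coeff_smult, simp)
    then show ?thesis unfolding F N D .
  qed
  show ?thesis
    unfolding eq by (rule degree_diff_le[OF order_trans[OF degree_smult_le dD] order_trans[OF degree_smult_le dG]])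
qed

text \<open>The reduced degree 4 n + 1 is only just exceeded by the 4 n + 2 roots counted with
  multiplicity; the unreduced bound 4 n + 4 would be too large for every n.\<close>

lemma Qsum_beta4:
  assumes "finite I" "card I = 2 * n" "inj_on x I"
  shows "Qsum 4 (\<lambda>_. 1) (kp 4) x I n 0 = 6 * Qsum 4 (\<lambda>_. 1) one3 x I n 1"
  using assms
proof (induction n arbitrary: I)
  case 0
  then have "I = {}" by simp
  then show ?case by (simp add: Qsum_def sel_0 sel_eq_empty pdiff_def psum_def kp_0)
next
  case (Suc n)
  have "I \<noteq> {}" using Suc.prems by auto
  then obtain a where a: "a \<in> I" by auto
  define J where "J = I - {a}"
  have J: "finite J" "a \<notin> J" "I = insert a J" "card J = 2 * n + 1" "inj_on x J"
    using Suc.prems a by (auto simp: J_def inj_on_diff)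
  define p where "p = Npoly 4 (\<lambda>_. 1) (kpoly 4) x a J (Suc n) 0 - smult 6 (Npoly 4 (\<lambda>_. 1) (\<lambda>_ _ _. 1) x a J (Suc n) 1)"
  have pp: "poly p y = Nsum 4 (\<lambda>_. 1) (kp 4) x a J (Suc n) 0 y + (- 6) * Nsum 4 (\<lambda>_. 1) one3 x a J (Suc n) 1 y" for y
    unfolding p_def by (simp add: poly_Npoly_kpoly poly_Npoly_1)
  have r: "poly p (x b) = 0 \<and> poly (pderiv p) (x b) = 0" if b: "b \<in> J" for b
  proof -
    define J' where "J' = J - {b}"
    have J': "finite J'" "b \<notin> J'" "J = insert b J'" "card J' = 2 * n" "inj_on x J'" "x b \<notin> x ` J'"
      using J b by (auto simp: J'_def inj_on_diff inj_on_def)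
    have IH: "Qsum 4 (\<lambda>_. 1) (kp 4) x J' n 0 = 6 * Qsum 4 (\<lambda>_. 1) one3 x J' n 1"
      using J' by (intro Suc.IH) auto
    have d1: "(Nsum 4 (\<lambda>_. 1) (kp 4) x a (insert b J') (Suc n) 0 has_field_derivative
        (\<Sum>s\<in>J'. real 4 / (x b - x s)) * Qsum 4 (\<lambda>_. 1) (kp 4) x J' n 0) (at (x b))"
      by (rule Nsum_deriv[OF J'(1,2,6,5) _ _ kp_deriv_plus kp_deriv_minus]) auto
    have d2: "(Nsum 4 (\<lambda>_. 1) one3 x a (insert b J') (Suc n) 1 has_field_derivative
        (\<Sum>s\<in>J'. real 4 / (x b - x s)) * Qsum 4 (\<lambda>_. 1) one3 x J' n 1) (at (x b))"
      by (rule Nsum_deriv[OF J'(1,2,6,5) _ _ one_deriv]) auto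
    have "(poly p has_field_derivative 0) (at (x b))"
      using DERIV_add[OF d1 DERIV_cmult[OF d2, of "- 6"]]
      unfolding J'(3)[symmetric] pp[symmetric] by (simp add: IH)
    then have "poly (pderiv p) (x b) = 0" using poly_DERIV DERIV_unique by blast
    moreover have "poly p (x b) = 0"
      unfolding pp unfolding J'(3) using Nsum_root[OF J'(1,2,6,5), of 4 "\<lambda>_. 1"] IH by simp
    ultimately show ?thesis by simp
  qed
  have "p = 0"
  proof (rule poly_eq_0_if_many_double_roots[of "x ` J"])
    have "degree p \<le> 4 * n + 1" unfolding p_def by (rule degree_Npoly_beta4) (use J in auto)
    also have "\<dots> < 2 * card (x ` J)" using J by (simp add: card_image)
    finally show "degree p < 2 * card (x ` J)" .
  qed (use J r in auto)
  then show ?case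
    using Qsum_eq_from_Npoly[OF pp] J Suc.prems by simp
qed

section \<open>Vandermonde form of the identity\<close>

text \<open>Ordering the pairs by their labels makes sense for every finite set of labels and gives
  the double product of \<open>selberg_density\<close> on an initial segment.\<close>

definition vdm :: "nat \<Rightarrow> (nat \<Rightarrow> real) \<Rightarrow> nat set \<Rightarrow> real" where
  "vdm \<beta> x S = (\<Prod>j\<in>S. \<Prod>i\<in>{i \<in> S. i < j}. \<bar>x j - x i\<bar> ^ \<beta>)"

lemma vdm_insert:
  assumes "finite S" "m \<notin> S"
  shows "vdm \<beta> x (insert m S) = vdm \<beta> x S * (\<Prod>k\<in>S. \<bar>x m - x k\<bar> ^ \<beta>)"
proof -
  have 1: "{i \<in> insert m S. i < m} = {i \<in> S. i < m}" by auto
  have 2: "(\<Prod>i\<in>{i \<in> insert m S. i < j}. \<bar>x j - x i\<bar> ^ \<beta>) =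
      (if m < j then \<bar>x m - x j\<bar> ^ \<beta> else 1) * (\<Prod>i\<in>{i \<in> S. i < j}. \<bar>x j - x i\<bar> ^ \<beta>)" if "j \<in> S" for j
  proof (cases "m < j")
    case True
    then have "{i \<in> insert m S. i < j} = insert m {i \<in> S. i < j}" by auto
    then show ?thesis using True assms by (simp add: abs_minus_commute)
  next
    case False
    then have "{i \<in> insert m S. i < j} = {i \<in> S. i < j}" by auto
    then show ?thesis using False by simp
  qed
  have "(\<Prod>k\<in>S. \<bar>x m - x k\<bar> ^ \<beta>) = (\<Prod>k\<in>S. (if k < m then \<bar>x m - x k\<bar> ^ \<beta> else 1) * (if m < k then \<bar>x m - x k\<bar> ^ \<beta> else 1))"
    by (rule prod.cong) (use assms in auto)
  also have "\<dots> = (\<Prod>k\<in>{i \<in> S. i < m}. \<bar>x m - x k\<bar> ^ \<beta>) * (\<Prod>k\<in>S. if m < k then \<bar>x m - x k\<bar> ^ \<beta> else 1)"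
    using assms by (simp add: prod.distrib prod.inter_filter)
  finally have e: "(\<Prod>k\<in>S. \<bar>x m - x k\<bar> ^ \<beta>) = (\<Prod>k\<in>{i \<in> S. i < m}. \<bar>x m - x k\<bar> ^ \<beta>) * (\<Prod>k\<in>S. if m < k then \<bar>x m - x k\<bar> ^ \<beta> else 1)" .
  have 3: "(\<Prod>j\<in>S. \<Prod>i\<in>{i \<in> insert m S. i < j}. \<bar>x j - x i\<bar> ^ \<beta>) =
      (\<Prod>j\<in>S. (if m < j then \<bar>x m - x j\<bar> ^ \<beta> else 1) * (\<Prod>i\<in>{i \<in> S. i < j}. \<bar>x j - x i\<bar> ^ \<beta>))"
    by (rule prod.cong[OF refl 2])
  show ?thesis
    unfolding vdm_def e prod.insert[OF assms] 1 3 prod.distrib by (simp only: mult_ac)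
qed

lemma vdm_split:
  assumes "finite I" "S \<subseteq> I"
  shows "vdm \<beta> x I = vdm \<beta> x S * vdm \<beta> x (I - S) * \<bar>cross \<beta> x S (I - S)\<bar>"
proof -
  have "vdm \<beta> x (S \<union> T) = vdm \<beta> x S * vdm \<beta> x T * \<bar>cross \<beta> x S T\<bar>"
    if "finite S" "finite T" "S \<inter> T = {}" for S T
    using that
  proof (induction S rule: finite_induct)
    case empty
    then show ?case by (simp add: vdm_def cross_def)
  next
    case (insert s S)
    have "vdm \<beta> x (insert s S \<union> T) = vdm \<beta> x (S \<union> T) * (\<Prod>k\<in>S \<union> T. \<bar>x s - x k\<bar> ^ \<beta>)"
      using insert by (simp add: vdm_insert)
    also have "(\<Prod>k\<in>S \<union> T. \<bar>x s - x k\<bar> ^ \<beta>) = (\<Prod>k\<in>S. \<bar>x s - x k\<bar> ^ \<beta>) * (\<Prod>k\<in>T. \<bar>x s - x k\<bar> ^ \<beta>)"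
      using insert by (intro prod.union_disjoint) auto
    also have "(\<Prod>k\<in>T. \<bar>x s - x k\<bar> ^ \<beta>) = \<bar>\<Prod>k\<in>T. (x k - x s) ^ \<beta>\<bar>"
      by (simp add: abs_prod power_abs abs_minus_commute)
    finally show ?case using insert
      by (simp add: vdm_insert cross_insert_left abs_mult)
  qed
  from this[of S "I - S"] show ?thesis using assms finite_subset by (auto simp: Un_absorb1)
qed

lemma cross_nonzero:
  assumes "inj_on x I" "S \<subseteq> I" "finite I"
  shows "cross \<beta> x S (I - S) \<noteq> 0"
  using assms finite_subset[OF assms(2,3)] unfolding cross_def inj_on_def by (auto simp: prod_zero_iff)

text \<open>
  The label \<open>(-1)\<close> to the number of points below \<open>x s\<close>. It turns the absolute values for \<open>\<beta> = 1\<close> into the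
  signed sum \<open>Qsum\<close>, up to a sign that depends only on the size of the block.
\<close>

definition split_sign :: "nat set \<Rightarrow> (nat \<Rightarrow> real) \<Rightarrow> nat \<Rightarrow> real" where
  "split_sign I x s = (\<Prod>j\<in>I - {s}. sgn (x j - x s))"

lemma split_sign_pm1:
  assumes "finite I" "inj_on x I" "s \<in> I"
  shows "split_sign I x s = 1 \<or> split_sign I x s = - 1"
proof -
  have "\<bar>split_sign I x s\<bar> = 1"
    unfolding split_sign_def abs_prod using assms by (intro prod.neutral) (auto simp: abs_sgn_eq inj_on_def)
  then show ?thesis by linarith
qed

text \<open>In increasing order of the points the labels alternate, starting with +1. The induction
  removes the largest point: all others lie below it, so its label is \<open>(-1) ^ n\<close>, and
  its removal leaves the other labels unchanged.\<close>

lemma sum_split_sign: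
  assumes "finite I" "inj_on x I"
  shows "(\<Sum>s\<in>I. split_sign I x s) = (if even (card I) then 0 else 1)"
  using assms
proof (induction "card I" arbitrary: I)
  case (Suc n)
  then have ne: "I \<noteq> {}" "finite (x ` I)" by auto
  then have "Max (x ` I) \<in> x ` I" by (intro Max_in) auto
  then obtain m where m: "m \<in> I" "x m = Max (x ` I)" by (metis imageE)
  then have gt: "x j < x m" if "j \<in> I - {m}" for j
    using that Suc.prems ne Max_ge[of "x ` I" "x j"] by (force simp: inj_on_def order_less_le)
  have "split_sign I x m = (\<Prod>j\<in>I - {m}. - 1)"
    unfolding split_sign_def using gt by (intro prod.cong) auto
  also have "\<dots> = (-1) ^ n" using Suc.prems m by (simp add: Suc.hyps(2)[symmetric])
  finally have 1: "split_sign I x m = (-1) ^ n" .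
  have 2: "split_sign I x s = split_sign (I - {m}) x s" if "s \<in> I - {m}" for s
  proof -
    have "I - {s} = insert m (I - {m} - {s})" using m that by auto
    then show ?thesis unfolding split_sign_def using gt[OF that] Suc.prems by simp
  qed
  have "(\<Sum>s\<in>I. split_sign I x s) = (-1) ^ n + (\<Sum>s\<in>I - {m}. split_sign (I - {m}) x s)"
    using m Suc.prems 1 2 by (simp add: sum.remove)
  also have "(\<Sum>s\<in>I - {m}. split_sign (I - {m}) x s) = (if even n then 0 else 1)"
  proof -
    have "card (I - {m}) = n" using Suc.prems m by (simp add: Suc.hyps(2)[symmetric])
    then show ?thesis using Suc.hyps(1)[of "I - {m}"] Suc.prems by (metis finite_Diff inj_on_diff)
  qed
  finally show ?case using Suc.hyps(2)[symmetric] by simp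
qed simp

text \<open>Each unordered pair contributes two opposite signs, hence a factor -1, and there are as
  many pairs as the exponent counts.\<close>

lemma prod_sgn_pairs:
  assumes "finite S" "inj_on x S"
  shows "(\<Prod>s\<in>S. \<Prod>t\<in>S - {s}. sgn (x t - x s :: real)) = (-1) ^ (\<Sum>k<card S. k)"
  using assms
proof (induction S rule: finite_induct)
  case (insert a S)
  have 1: "(\<Prod>t\<in>insert a S - {s}. sgn (x t - x s)) = sgn (x a - x s) * (\<Prod>t\<in>S - {s}. sgn (x t - x s))" if "s \<in> S" for s
  proof -
    have "insert a S - {s} = insert a (S - {s})" "a \<notin> S - {s}" using insert that by auto
    then show ?thesis using insert by simp
  qed
  have 2: "insert a S - {a} = S" using insert by auto
  have "(\<Prod>s\<in>insert a S. \<Prod>t\<in>insert a S - {s}. sgn (x t - x s)) =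
     (\<Prod>t\<in>S. sgn (x t - x a)) * ((\<Prod>s\<in>S. sgn (x a - x s)) * (\<Prod>s\<in>S. \<Prod>t\<in>S - {s}. sgn (x t - x s)))"
    using insert 1 2 by (simp add: prod.distrib cong: prod.cong)
  also have "(\<Prod>t\<in>S. sgn (x t - x a)) * ((\<Prod>s\<in>S. sgn (x a - x s)) * (\<Prod>s\<in>S. \<Prod>t\<in>S - {s}. sgn (x t - x s))) =
     (\<Prod>t\<in>S. sgn (x t - x a) * sgn (x a - x t)) * (\<Prod>s\<in>S. \<Prod>t\<in>S - {s}. sgn (x t - x s))"
    by (simp add: prod.distrib mult.assoc)
  also have "(\<Prod>t\<in>S. sgn (x t - x a) * sgn (x a - x t)) = (\<Prod>t\<in>S. - 1)"
    using insert by (intro prod.cong refl) (auto simp: sgn_if inj_on_def)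
  finally show ?case using insert by (simp add: power_add)
qed simp

lemma sgn_prod_real: "sgn (\<Prod>i\<in>A. f i) = (\<Prod>i\<in>A. sgn (f i :: real))"
  by (induction A rule: infinite_finite_induct) (auto simp: sgn_mult)

text \<open>The product of the labels over \<open>S\<close> splits into pairs inside
  \<open>S\<close>, whose sign depends on \<open>card S\<close> alone, and pairs across, which give
  the sign of \<open>cross\<close>. The latter turns the reciprocal of the absolute value of
  \<open>cross\<close> into \<open>1 / cross\<close>.\<close>

lemma vdm_pair_beta1:
  assumes "finite I" "inj_on x I" "S \<subseteq> I"
  shows "vdm 1 x S * vdm 1 x (I - S) = (-1) ^ (\<Sum>k<card S. k) * vdm 1 x I * (\<Prod>s\<in>S. split_sign I x s) / cross 1 x S (I - S)"
proof -
  have fS: "finite S" using assms finite_subset by auto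
  have nz: "cross 1 x S (I - S) \<noteq> 0" using assms by (intro cross_nonzero)
  have "(\<Prod>s\<in>S. split_sign I x s) = (\<Prod>s\<in>S. (\<Prod>t\<in>S - {s}. sgn (x t - x s)) * (\<Prod>t\<in>I - S. sgn (x t - x s)))"
  proof (rule prod.cong[OF refl])
    fix s assume "s \<in> S"
    then have "I - {s} = (S - {s}) \<union> (I - S)" using assms by auto
    then show "split_sign I x s = (\<Prod>t\<in>S - {s}. sgn (x t - x s)) * (\<Prod>t\<in>I - S. sgn (x t - x s))"
      unfolding split_sign_def using assms fS by (simp add: prod.union_disjoint Diff_Int_distrib2)
  qed
  also have "\<dots> = (-1) ^ (\<Sum>k<card S. k) * sgn (cross 1 x S (I - S))"
    using prod_sgn_pairs[OF fS inj_on_subset[OF assms(2,3)]] by (simp add: prod.distrib cross_def sgn_prod_real)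
  finally have e: "(\<Prod>s\<in>S. split_sign I x s) = (-1) ^ (\<Sum>k<card S. k) * sgn (cross 1 x S (I - S))" .
  have s: "sgn c / c = 1 / \<bar>c\<bar>" if "c \<noteq> 0" for c :: real
    using that by (simp add: sgn_if)
  have "(-1::real) ^ (\<Sum>k<card S. k) * vdm 1 x I * (\<Prod>s\<in>S. split_sign I x s) / cross 1 x S (I - S) =
      vdm 1 x I * (sgn (cross 1 x S (I - S)) / cross 1 x S (I - S))"
    unfolding e by (simp flip: power_add mult_2)
  also have "\<dots> = vdm 1 x S * vdm 1 x (I - S)"
    unfolding s[OF nz] vdm_split[OF assms(1,3)] using nz by simp
  finally show ?thesis by simp
qed

lemma vdm_pair_even:
  assumes "finite I" "inj_on x I" "S \<subseteq> I" "even \<beta>"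
  shows "vdm \<beta> x S * vdm \<beta> x (I - S) = vdm \<beta> x I * (\<Prod>s\<in>S. 1) / cross \<beta> x S (I - S)"
proof -
  have nz: "cross \<beta> x S (I - S) \<noteq> 0" using assms by (intro cross_nonzero)
  have "cross \<beta> x S (I - S) \<ge> 0" unfolding cross_def using \<open>even \<beta>\<close> by (intro prod_nonneg) (simp add: zero_le_even_power)
  then show ?thesis unfolding vdm_split[OF assms(1,3)] using nz by simp
qed

definition kp_const :: "nat \<Rightarrow> real" where
  "kp_const \<beta> = (if \<beta> = 1 then 24 else if \<beta> = 4 then 6 else 0)"

lemma vdm_identity_inj:
  assumes "finite I" "card I = 2 * n" "inj_on x I" "\<beta> \<in> {1, 2, 4}"
  shows "(\<Sum>S\<in>sel I n 0. vdm \<beta> x S * vdm \<beta> x (I - S) * kp (eta_coeff \<beta>) (pdiff 1 S (I - S) x) (pdiff 2 S (I - S) x) (pdiff 3 S (I - S) x))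
     = kp_const \<beta> * (\<Sum>S\<in>sel I n (index_shift \<beta>). vdm \<beta> x S * vdm \<beta> x (I - S))"
proof -
  have ev: "(\<Sum>S\<in>sel I n i. vdm \<beta> x S * vdm \<beta> x (I - S) * \<kappa> (pdiff 1 S (I - S) x) (pdiff 2 S (I - S) x) (pdiff 3 S (I - S) x)) =
      vdm \<beta> x I * Qsum \<beta> (\<lambda>_. 1) \<kappa> x I n i" if "even \<beta>" for \<kappa> i
    unfolding Qsum_def sum_distrib_left
    by (intro sum.cong refl, subst vdm_pair_even) (use assms that in \<open>auto simp: sel_def\<close>)
  have od: "(\<Sum>S\<in>sel I n i. vdm 1 x S * vdm 1 x (I - S) * \<kappa> (pdiff 1 S (I - S) x) (pdiff 2 S (I - S) x) (pdiff 3 S (I - S) x)) =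
      (-1) ^ (\<Sum>k<n - i. k) * (vdm 1 x I * Qsum 1 (split_sign I x) \<kappa> x I n i)" for \<kappa> i
    unfolding Qsum_def sum_distrib_left
  proof (intro sum.cong refl, subst vdm_pair_beta1)
    fix S assume "S \<in> sel I n i"
    then have "card S = n - i" "S \<subseteq> I" by (auto simp: sel_def)
    then show "(- 1) ^ \<Sum> {..<card S} * vdm 1 x I * prod (split_sign I x) S / cross 1 x S (I - S) *
          \<kappa> (pdiff 1 S (I - S) x) (pdiff 2 S (I - S) x) (pdiff 3 S (I - S) x) =
          (- 1) ^ \<Sum> {..<n - i} * (vdm 1 x I * (prod (split_sign I x) S *
           \<kappa> (pdiff 1 S (I - S) x) (pdiff 2 S (I - S) x) (pdiff 3 S (I - S) x) / cross 1 x S (I - S)))"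
      by simp
  qed (use assms in \<open>auto simp: sel_def\<close>)
  consider "\<beta> = 1" | "\<beta> = 2" | "\<beta> = 4" using assms by auto
  then show ?thesis
  proof cases
    case 1
    have Q: "Qsum 1 (split_sign I x) (kp 1) x I n 0 = - 24 * Qsum 1 (split_sign I x) one3 x I n 2"
      using assms by (intro Qsum_beta1) (auto simp: split_sign_pm1 sum_split_sign)
    \<comment> \<open>The exponents for \<open>n\<close> and \<open>n - 2\<close> differ by (n - 1)
      + (n - 2) = 2 n - 3, an odd number; this turns the -24 of \<open>Qsum_beta1\<close> into
      \<open>kp_const 1 = 24\<close>. For \<open>n < 2\<close> the sum is empty.\<close>
    have s: "(-1) ^ (\<Sum>k<n - 0. k) * Qsum 1 (split_sign I x) one3 x I n 2 = - ((-1) ^ (\<Sum>k<n - 2. k) * Qsum 1 (split_sign I x) one3 x I n 2)"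
    proof (cases "n \<ge> 2")
      case True
      then obtain m where "n = Suc (Suc m)" by (metis Suc_le_D numeral_2_eq_2 Suc_le_mono)
      then show ?thesis by (simp add: power_add flip: power_mult_distrib)
    qed (simp add: Qsum_def sel_eq_empty)
    have "(-1) ^ (\<Sum>k<n - 0. k) * (vdm 1 x I * Qsum 1 (split_sign I x) (kp 1) x I n 0) =
        (- 24) * vdm 1 x I * ((-1) ^ (\<Sum>k<n - 0. k) * Qsum 1 (split_sign I x) one3 x I n 2)"
      unfolding Q by simp
    also have "\<dots> = 24 * ((-1) ^ (\<Sum>k<n - 2. k) * (vdm 1 x I * Qsum 1 (split_sign I x) one3 x I n 2))"
      unfolding s by simp
    finally show ?thesis
      unfolding 1 od[of "kp 1" 0, symmetric] od[of one3 2, symmetric]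
      by (simp add: eta_coeff_def kp_const_def index_shift_def)
  next
    case 2
    then show ?thesis using ev[of "kp 1" 0] Qsum_beta2[OF assms(1-3)] by (simp add: eta_coeff_def kp_const_def)
  next
    case 3
    then show ?thesis using ev[of "kp 4" 0] ev[of one3 1] Qsum_beta4[OF assms(1-3)]
      by (simp add: eta_coeff_def kp_const_def index_shift_def)
  qed
qed

text \<open>Coinciding points are reached by continuity.\<close>

lemma eventually_inj_perturb:
  assumes "finite I"
  shows "eventually (\<lambda>h. inj_on (\<lambda>i. x i + h * real i) I) (at (0::real))"
proof -
  have "eventually (\<lambda>h. x i + h * real i \<noteq> x j + h * real j) (at (0::real))" if "i \<noteq> j" for i j
  proof (cases "x i = x j")
    case True
    have "eventually (\<lambda>h. h \<noteq> (0::real)) (at 0)" by (simp add: eventually_at_filter)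
    then show ?thesis by eventually_elim (use True that in auto)
  next
    case False
    have "((\<lambda>h. (x i + h * real i) - (x j + h * real j)) \<longlongrightarrow> (x i + 0 * real i) - (x j + 0 * real j)) (at 0)"
      by (intro tendsto_intros)
    then have "eventually (\<lambda>h. (x i + h * real i) - (x j + h * real j) \<noteq> 0) (at 0)"
      by (rule tendsto_imp_eventually_ne) (use False in simp)
    then show ?thesis by eventually_elim simp
  qed
  then have "eventually (\<lambda>h. \<forall>i\<in>I. \<forall>j\<in>I. i \<noteq> j \<longrightarrow> x i + h * real i \<noteq> x j + h * real j) (at (0::real))"
    using assms by (intro eventually_ball_finite ballI) (auto intro: eventually_mono)
  then show ?thesis by eventually_elim (auto simp: inj_on_def)
qed

text \<open>Unlike \<open>Qsum\<close>, both sides are continuous where points coincide, so the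
  perturbed configurations, injective for small nonzero \<open>h\<close>, give the general case in
  the limit.\<close>

lemma vdm_identity:
  assumes "finite I" "card I = 2 * n" "\<beta> \<in> {1, 2, 4}"
  shows "(\<Sum>S\<in>sel I n 0. vdm \<beta> x S * vdm \<beta> x (I - S) * kp (eta_coeff \<beta>) (pdiff 1 S (I - S) x) (pdiff 2 S (I - S) x) (pdiff 3 S (I - S) x))
     = kp_const \<beta> * (\<Sum>S\<in>sel I n (index_shift \<beta>). vdm \<beta> x S * vdm \<beta> x (I - S))" (is "?L x = ?R x")
proof -
  let ?X = "\<lambda>h i. x i + h * real i"
  have "((\<lambda>h. ?L (?X h) - ?R (?X h)) \<longlongrightarrow> ?L (?X 0) - ?R (?X 0)) (at 0)"
    unfolding vdm_def pdiff_def psum_def kp_def by (intro tendsto_intros)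
  moreover have "eventually (\<lambda>h. ?L (?X h) - ?R (?X h) = 0) (at 0)"
    using eventually_inj_perturb[OF assms(1), of x]
    by eventually_elim (use vdm_identity_inj[OF assms(1,2) _ assms(3)] in simp)
  then have "((\<lambda>h. ?L (?X h) - ?R (?X h)) \<longlongrightarrow> 0) (at 0)"
    by (rule tendsto_eventually)
  ultimately have "?L (?X 0) - ?R (?X 0) = 0"
    by (rule tendsto_unique[OF at_neq_bot])
  then show ?thesis by simp
qed

section \<open>Weighted moments\<close>

interpretation lborel_prod: product_sigma_finite "\<lambda>_::nat. lborel :: real measure" ..

abbreviation "LP I \<equiv> PiM I (\<lambda>_::nat. lborel :: real measure)"

lemma abs_exp_minus_1_le: "\<bar>exp u - 1\<bar> \<le> \<bar>u\<bar> * exp \<bar>u\<bar>" for u :: real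
proof (cases "u \<ge> 0")
  case True
  have "(1 - u) * exp u \<le> exp (- u) * exp u"
    using exp_ge_add_one_self[of "- u"] by (intro mult_right_mono) auto
  then have "exp u - 1 \<le> u * exp u" by (simp add: algebra_simps flip: exp_add)
  then show ?thesis using True by simp
next
  case False
  then have "\<bar>exp u - 1\<bar> = 1 - exp u" by simp
  also have "\<dots> \<le> - u" using exp_ge_add_one_self[of u] by linarith
  also have "\<dots> \<le> - u * exp \<bar>u\<bar>" using False mult_left_mono[of 1 "exp \<bar>u\<bar>" "- u"] by simp
  finally show ?thesis using False by simp
qed

text \<open>Dominated convergence, with the difference quotients controlled by
  \<open>abs_exp_minus_1_le\<close>. The bound on \<open>a\<close> is asked only where
  \<open>g\<close> is nonzero because the power sums to which this is applied are bounded on the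
  cube, the support of the weight.\<close>

lemma deriv_exp_integral:
  fixes g a :: "'a \<Rightarrow> real"
  assumes g: "integrable M g" and a: "a \<in> borel_measurable M" and C: "\<And>x. g x \<noteq> 0 \<Longrightarrow> \<bar>a x\<bar> \<le> C"
  shows "((\<lambda>s. \<integral>x. g x * exp (s * a x) \<partial>M) has_field_derivative (\<integral>x. a x * g x * exp (s * a x) \<partial>M)) (at s)"
proof -
  have [measurable]: "g \<in> borel_measurable M" "a \<in> borel_measurable M" using g a by auto
  define D where "D = max C 0"
  have D: "\<bar>a x\<bar> \<le> D" if "g x \<noteq> 0" for x using C[OF that] by (simp add: D_def)
  have D0: "D \<ge> 0" by (simp add: D_def)
  have e: "\<bar>g x\<bar> * exp (s * a x) \<le> \<bar>g x\<bar> * exp (\<bar>s\<bar> * D)" for x s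
  proof (cases "g x = 0")
    case False
    have "s * a x \<le> \<bar>s\<bar> * \<bar>a x\<bar>" by (metis abs_ge_self abs_mult)
    also have "\<dots> \<le> \<bar>s\<bar> * D" using D[OF False] by (intro mult_left_mono) auto
    finally show ?thesis by (intro mult_left_mono) auto
  qed simp
  have int: "integrable M (\<lambda>x. g x * exp (s * a x))" for s
    by (rule Bochner_Integration.integrable_bound[OF integrable_mult_left[OF integrable_abs[OF g], of "exp (\<bar>s\<bar> * D)"]])
       (use e in \<open>auto simp: abs_mult\<close>)
  have "((\<lambda>h. ((\<integral>x. g x * exp ((s + h) * a x) \<partial>M) - (\<integral>x. g x * exp (s * a x) \<partial>M)) / h) \<longlongrightarrow> (\<integral>x. a x * g x * exp (s * a x) \<partial>M)) (at 0)"
    unfolding tendsto_at_iff_sequentially comp_def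
  proof safe
    fix X :: "nat \<Rightarrow> real" assume X: "\<forall>i. X i \<in> UNIV - {0}" "X \<longlonglongrightarrow> 0"
    then obtain B where B: "\<And>n. \<bar>X n\<bar> \<le> B" using convergent_imp_Bseq[of X] by (auto simp: Bseq_def convergent_def)
    have "(\<lambda>i. \<integral>x. (g x * exp ((s + X i) * a x) - g x * exp (s * a x)) / X i \<partial>M) \<longlonglongrightarrow> (\<integral>x. a x * g x * exp (s * a x) \<partial>M)"
    proof (rule integral_dominated_convergence)
      show "integrable M (\<lambda>x. \<bar>g x\<bar> * (exp (\<bar>s\<bar> * D) * (D * exp (B * D))))"
        by (intro integrable_mult_left integrable_abs g)
      show "AE x in M. (\<lambda>i. (g x * exp ((s + X i) * a x) - g x * exp (s * a x)) / X i) \<longlonglongrightarrow> a x * g x * exp (s * a x)"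
      proof (rule AE_I2)
        fix x
        have "((\<lambda>s. g x * exp (s * a x)) has_field_derivative a x * g x * exp (s * a x)) (at s)"
          by (auto intro!: derivative_eq_intros)
        then have "((\<lambda>h. (g x * exp ((s + h) * a x) - g x * exp (s * a x)) / h) \<longlongrightarrow> a x * g x * exp (s * a x)) (at 0)"
          by (simp add: DERIV_def)
        then show "(\<lambda>i. (g x * exp ((s + X i) * a x) - g x * exp (s * a x)) / X i) \<longlonglongrightarrow> a x * g x * exp (s * a x)"
          unfolding tendsto_at_iff_sequentially comp_def using X by auto
      qed
      fix i
      show "AE x in M. norm ((g x * exp ((s + X i) * a x) - g x * exp (s * a x)) / X i) \<le> \<bar>g x\<bar> * (exp (\<bar>s\<bar> * D) * (D * exp (B * D)))"
      proof (rule AE_I2)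
        fix x
        show "norm ((g x * exp ((s + X i) * a x) - g x * exp (s * a x)) / X i) \<le> \<bar>g x\<bar> * (exp (\<bar>s\<bar> * D) * (D * exp (B * D)))"
        proof (cases "g x = 0")
          case False
          have Xi: "X i \<noteq> 0" using X by auto
          have "\<bar>exp (X i * a x) - 1\<bar> \<le> \<bar>X i * a x\<bar> * exp \<bar>X i * a x\<bar>" by (rule abs_exp_minus_1_le)
          also have "\<dots> \<le> (\<bar>X i\<bar> * D) * exp (B * D)"
            unfolding abs_mult using D[OF False] B[of i] D0 by (intro mult_mono) (auto intro!: mult_mono)
          finally have 1: "\<bar>exp (X i * a x) - 1\<bar> / \<bar>X i\<bar> \<le> D * exp (B * D)"
            using Xi by (simp add: field_simps)
          have "norm ((g x * exp ((s + X i) * a x) - g x * exp (s * a x)) / X i) = (\<bar>g x\<bar> * exp (s * a x)) * (\<bar>exp (X i * a x) - 1\<bar> / \<bar>X i\<bar>)"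
          proof -
            have "g x * exp ((s + X i) * a x) - g x * exp (s * a x) = (g x * exp (s * a x)) * (exp (X i * a x) - 1)"
              by (simp add: algebra_simps exp_add)
            then show ?thesis by (simp add: abs_mult)
          qed
          also have "\<dots> \<le> (\<bar>g x\<bar> * exp (\<bar>s\<bar> * D)) * (D * exp (B * D))"
            by (rule mult_mono[OF e 1]) auto
          finally show ?thesis by (simp add: mult.assoc)
        qed simp
      qed
    qed simp_all
    then show "(\<lambda>i. ((\<integral>x. g x * exp ((s + X i) * a x) \<partial>M) - (\<integral>x. g x * exp (s * a x) \<partial>M)) / X i) \<longlonglongrightarrow> (\<integral>x. a x * g x * exp (s * a x) \<partial>M)"
      using int by simp
  qed
  then show ?thesis by (simp add: DERIV_def)
qed

text \<open>This lets integrals over an arbitrary block of labels be compared with those over an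
  initial segment; agreement on boxes determines the product measure.\<close>

lemma LP_reindex:
  assumes h: "bij_betw h J I" and fin: "finite J"
  shows "distr (LP I) (LP J) (\<lambda>x. \<lambda>i\<in>J. x (h i)) = LP J"
proof (rule lborel_prod.PiM_eqI[OF fin])
  have finI: "finite I" using h fin by (simp add: bij_betw_finite)
  have hI: "h i \<in> I" if "i \<in> J" for i using h that by (auto simp: bij_betw_def)
  have m: "(\<lambda>x. \<lambda>i\<in>J. x (h i)) \<in> LP I \<rightarrow>\<^sub>M LP J"
    by (intro measurable_restrict measurable_component_singleton hI)
  show "sets (distr (LP I) (LP J) (\<lambda>x. \<lambda>i\<in>J. x (h i))) = sets (LP J)" by simp
  fix A :: "nat \<Rightarrow> real set" assume A: "\<And>i. i \<in> J \<Longrightarrow> A i \<in> sets lborel"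
  let ?g = "inv_into J h"
  have g: "?g i \<in> J" "h (?g i) = i" if "i \<in> I" for i
    using h that by (auto simp: bij_betw_def inv_into_into f_inv_into_f)
  have gh: "?g (h i) = i" if "i \<in> J" for i using h that by (auto simp: bij_betw_def)
  have "(\<lambda>x. \<lambda>i\<in>J. x (h i)) -` (PiE J A) \<inter> space (LP I) = PiE I (\<lambda>i. A (?g i))"
  proof (intro equalityI subsetI)
    fix x assume "x \<in> (\<lambda>x. \<lambda>i\<in>J. x (h i)) -` (PiE J A) \<inter> space (LP I)"
    then have x: "x \<in> extensional I" "\<And>i. i \<in> J \<Longrightarrow> x (h i) \<in> A i" by (auto simp: space_PiM PiE_iff)
    show "x \<in> PiE I (\<lambda>i. A (?g i))"
      unfolding PiE_iff
    proof (intro conjI ballI)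
      fix i assume "i \<in> I"
      then show "x i \<in> A (?g i)" using x(2)[OF g(1)] g(2) by metis
    qed (rule x(1))
  next
    fix x assume x: "x \<in> PiE I (\<lambda>i. A (?g i))"
    then have "x (h i) \<in> A i" if "i \<in> J" for i using hI[OF that] gh[OF that] by (auto simp: PiE_iff)
    then show "x \<in> (\<lambda>x. \<lambda>i\<in>J. x (h i)) -` (PiE J A) \<inter> space (LP I)"
      using x by (auto simp: space_PiM PiE_iff)
  qed
  moreover have "PiE J A \<in> sets (LP J)" using A fin by (intro sets_PiM_I_finite) auto
  ultimately have "emeasure (distr (LP I) (LP J) (\<lambda>x. \<lambda>i\<in>J. x (h i))) (PiE J A) = emeasure (LP I) (PiE I (\<lambda>i. A (?g i)))"
    using emeasure_distr[OF m] by simp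
  also have "\<dots> = (\<Prod>i\<in>I. emeasure lborel (A (?g i)))"
    using finI A g by (intro lborel_prod.emeasure_PiM) auto
  also have "\<dots> = (\<Prod>i\<in>J. emeasure lborel (A i))"
    by (subst prod.reindex_bij_betw[OF h, symmetric]) (auto simp: gh intro!: prod.cong)
  finally show "emeasure (distr (LP I) (LP J) (\<lambda>x. \<lambda>i\<in>J. x (h i))) (PiE J A) = (\<Prod>i\<in>J. emeasure lborel (A i))" .
qed

lemma psum_cong: "(\<And>i. i \<in> S \<Longrightarrow> x i = y i) \<Longrightarrow> psum k S x = psum k S y"
  unfolding psum_def by simp

lemma vdm_cong: "(\<And>i. i \<in> S \<Longrightarrow> x i = y i) \<Longrightarrow> vdm \<beta> x S = vdm \<beta> y S"
  unfolding vdm_def by (auto intro!: prod.cong)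

lemma psum_reindex: "bij_betw h J I \<Longrightarrow> psum k I x = psum k J (\<lambda>i. x (h i))"
  unfolding psum_def by (subst sum.reindex_bij_betw[symmetric]) auto

text \<open>A monotone relabelling carries the pairs \<open>i < j\<close> to the pairs
  \<open>h i < h j\<close>, so the ordered double product is transported factor by factor.\<close>

lemma vdm_reindex:
  assumes h: "bij_betw h J I" and mono: "strict_mono_on J h"
  shows "vdm \<beta> x I = vdm \<beta> (\<lambda>i. x (h i)) J"
proof -
  have "vdm \<beta> x I = (\<Prod>j\<in>J. \<Prod>i\<in>{i \<in> I. i < h j}. \<bar>x (h j) - x i\<bar> ^ \<beta>)"
    unfolding vdm_def by (subst prod.reindex_bij_betw[OF h, symmetric]) simp
  also have "\<dots> = vdm \<beta> (\<lambda>i. x (h i)) J" unfolding vdm_def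
  proof (rule prod.cong[OF refl])
    fix j assume j: "j \<in> J"
    have lt: "h i < h j \<longleftrightarrow> i < j" if "i \<in> J" for i
      using mono j that unfolding strict_mono_on_def by (metis linorder_neqE_nat order_less_imp_not_less order_less_irrefl)
    have "{i \<in> I. i < h j} = h ` {i \<in> J. i < j}" using h lt by (auto simp: bij_betw_def)
    moreover have "inj_on h {i \<in> J. i < j}" using h by (auto simp: bij_betw_def inj_on_def)
    ultimately have "bij_betw h {i \<in> J. i < j} {i \<in> I. i < h j}" by (simp add: bij_betw_def)
    then show "(\<Prod>i\<in>{i \<in> I. i < h j}. \<bar>x (h j) - x i\<bar> ^ \<beta>) = (\<Prod>i\<in>{i \<in> J. i < j}. \<bar>x (h j) - x (h i)\<bar> ^ \<beta>)"
      by (subst prod.reindex_bij_betw[symmetric]) auto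
  qed
  finally show ?thesis .
qed

lemma psum_measurable [measurable]: "psum k I \<in> borel_measurable (LP I)"
  unfolding psum_def by measurable

lemma vdm_measurable [measurable]: "(\<lambda>x. vdm \<beta> x I) \<in> borel_measurable (LP I)"
  unfolding vdm_def by measurable

lemma vdm_nonneg: "vdm \<beta> x S \<ge> 0"
  unfolding vdm_def by (intro prod_nonneg) auto

lemma vdm_le_1: "(\<And>i. i \<in> S \<Longrightarrow> x i \<in> {0..1}) \<Longrightarrow> vdm \<beta> x S \<le> 1"
proof -
  assume x: "\<And>i. i \<in> S \<Longrightarrow> x i \<in> {0..1}"
  have "\<bar>x j - x i\<bar> \<le> 1" if "i \<in> S" "j \<in> S" for i j using x[OF that(1)] x[OF that(2)] by auto
  then show ?thesis
    unfolding vdm_def by (intro prod_le_1 conjI prod_nonneg zero_le_power power_le_one) auto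
qed

lemma psum_bounds:
  assumes "\<And>i. i \<in> S \<Longrightarrow> x i \<in> {0..1}"
  shows "0 \<le> psum k S x" "psum k S x \<le> card S"
proof -
  show "0 \<le> psum k S x" unfolding psum_def using assms by (intro sum_nonneg) auto
  have "psum k S x \<le> (\<Sum>i\<in>S. 1)" unfolding psum_def using assms by (intro sum_mono power_le_one) auto
  then show "psum k S x \<le> card S" by simp
qed

text \<open>The first two conditions put both exponents above -1, so the density is integrable by
  the Beta integral; \<open>\<beta> \<ge> 1\<close> makes the weight vanish when two points
  coincide.\<close>

locale jacobi_ensemble =
  fixes \<beta> :: nat and \<alpha> :: real and \<delta> :: int
  assumes \<alpha>_gt: "\<alpha> > - 1" and \<delta>_ge: "\<delta> \<ge> - 1" and \<beta>_pos: "\<beta> \<ge> 1"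
begin

text \<open>The indicator is made part of the weight so that all integrals run over the whole
  product space, where Fubini and relabelling apply directly.\<close>

definition wt :: "real \<Rightarrow> real \<Rightarrow> real \<Rightarrow> real" where
  "wt z w t = indicator {0..1} t * (t powr \<alpha> * (1 - t) powr (real_of_int \<delta> / 2)) * exp (- z * t - w * t * (1 - t))"

definition weight :: "real \<Rightarrow> real \<Rightarrow> nat set \<Rightarrow> (nat \<Rightarrow> real) \<Rightarrow> real" where
  "weight z w I x = (\<Prod>i\<in>I. wt z w (x i)) * vdm \<beta> x I"

definition moment :: "real \<Rightarrow> real \<Rightarrow> nat set \<Rightarrow> ((nat \<Rightarrow> real) \<Rightarrow> real) \<Rightarrow> real" where
  "moment z w I f = (\<integral>x. f x * weight z w I x \<partial>LP I)"

text \<open>Boundedness is asked on the cube only, where the weight is supported, so that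
  polynomials in the power sums qualify.\<close>

definition admissible :: "nat set \<Rightarrow> ((nat \<Rightarrow> real) \<Rightarrow> real) \<Rightarrow> bool" where
  "admissible I f \<longleftrightarrow> f \<in> borel_measurable (LP I) \<and> (\<exists>C. \<forall>x. (\<forall>i\<in>I. x i \<in> {0..1}) \<longrightarrow> \<bar>f x\<bar> \<le> C)"

lemma wt_measurable [measurable]: "wt z w \<in> borel_measurable borel"
  unfolding wt_def by measurable

lemma wt_nonneg: "wt z w t \<ge> 0"
  unfolding wt_def by simp

lemma wt_integrable: "integrable lborel (wt z w)"
proof -
  have "set_integrable lborel {0..1} (\<lambda>t. t powr (\<alpha> + 1 - 1) * (1 - t) powr (real_of_int \<delta> / 2 + 1 - 1))"
    by (rule integrable_Beta) (use \<alpha>_gt \<delta>_ge in auto)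
  then have i: "integrable lborel (\<lambda>t. indicator {0..1} t * (t powr \<alpha> * (1 - t) powr (real_of_int \<delta> / 2)))"
    unfolding set_integrable_def by simp
  show ?thesis
  proof (rule Bochner_Integration.integrable_bound[OF integrable_mult_left[OF i, of "exp (\<bar>z\<bar> + \<bar>w\<bar>)"]])
    show "AE t in lborel. norm (wt z w t) \<le> norm (indicator {0..1} t * (t powr \<alpha> * (1 - t) powr (real_of_int \<delta> / 2)) * exp (\<bar>z\<bar> + \<bar>w\<bar>))"
    proof (rule AE_I2)
      fix t :: real
      show "norm (wt z w t) \<le> norm (indicator {0..1} t * (t powr \<alpha> * (1 - t) powr (real_of_int \<delta> / 2)) * exp (\<bar>z\<bar> + \<bar>w\<bar>))"
      proof (cases "t \<in> {0..1}")
        case True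
        have 1: "\<bar>z * t\<bar> \<le> \<bar>z\<bar>"
          using True mult_left_le[of t "\<bar>z\<bar>"] by (simp add: abs_mult)
        have "t * (1 - t) \<le> 1" "0 \<le> t * (1 - t)"
          using True by (simp_all add: mult_le_one)
        then have "\<bar>w * (t * (1 - t))\<bar> \<le> \<bar>w\<bar>"
          using mult_left_le[of "t * (1 - t)" "\<bar>w\<bar>"] by (simp only: abs_mult[of w] abs_of_nonneg abs_ge_zero)
        then have "- z * t - w * (t * (1 - t)) \<le> \<bar>z\<bar> + \<bar>w\<bar>" using 1 by linarith
        then have "exp (- z * t - w * t * (1 - t)) \<le> exp (\<bar>z\<bar> + \<bar>w\<bar>)" by (simp add: mult.assoc)
        then have "(t powr \<alpha> * (1 - t) powr (real_of_int \<delta> / 2)) * exp (- z * t - w * t * (1 - t)) \<le> (t powr \<alpha> * (1 - t) powr (real_of_int \<delta> / 2)) * exp (\<bar>z\<bar> + \<bar>w\<bar>)"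
          by (rule mult_left_mono) simp
        then show ?thesis unfolding wt_def using True by (simp add: abs_mult)
      qed (simp add: wt_def)
    qed
  qed simp
qed

lemma weight_nonneg: "weight z w I x \<ge> 0"
  unfolding weight_def by (intro mult_nonneg_nonneg prod_nonneg vdm_nonneg) (simp add: wt_nonneg)

lemma weight_nonzero_imp: "finite I \<Longrightarrow> weight z w I x \<noteq> 0 \<Longrightarrow> i \<in> I \<Longrightarrow> x i \<in> {0..1}"
  unfolding weight_def wt_def by (auto split: split_indicator_asm)

lemma weight_le: "finite I \<Longrightarrow> weight z w I x \<le> (\<Prod>i\<in>I. wt z w (x i))"
proof (cases "weight z w I x = 0")
  case False
  assume "finite I"
  with False have "vdm \<beta> x I \<le> 1" by (intro vdm_le_1) (metis weight_nonzero_imp)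
  then have "(\<Prod>i\<in>I. wt z w (x i)) * vdm \<beta> x I \<le> (\<Prod>i\<in>I. wt z w (x i)) * 1"
    by (intro mult_left_mono prod_nonneg) (auto simp: wt_nonneg)
  then show ?thesis by (simp add: weight_def)
qed (simp add: prod_nonneg wt_nonneg)

lemma weight_measurable [measurable]: "weight z w I \<in> borel_measurable (LP I)"
  unfolding weight_def by measurable

lemma weight_cong: "(\<And>i. i \<in> I \<Longrightarrow> x i = y i) \<Longrightarrow> weight z w I x = weight z w I y"
  unfolding weight_def using vdm_cong[of I x y] by simp

text \<open>The exponents of all variables add up to -z p_1 - w (p_1 - p_2); a derivative in z or w
  therefore inserts -p_1 or -(p_1 - p_2) into a moment.\<close>

lemma weight_exp:
  assumes "finite I"
  shows "weight z w I x = weight 0 0 I x * exp (- z * psum 1 I x - w * (psum 1 I x - psum 2 I x))"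
proof -
  have "wt z w t = wt 0 0 t * exp (- z * t - w * (t - t\<^sup>2))" for t
    unfolding wt_def by (simp add: algebra_simps power2_eq_square)
  then have "(\<Prod>i\<in>I. wt z w (x i)) = (\<Prod>i\<in>I. wt 0 0 (x i)) * (\<Prod>i\<in>I. exp (- z * x i - w * (x i - (x i)\<^sup>2)))"
    by (simp add: prod.distrib)
  also have "(\<Prod>i\<in>I. exp (- z * x i - w * (x i - (x i)\<^sup>2))) = exp (\<Sum>i\<in>I. - z * x i - w * (x i - (x i)\<^sup>2))"
    using assms by (simp add: exp_sum)
  also have "(\<Sum>i\<in>I. - z * x i - w * (x i - (x i)\<^sup>2)) = - z * psum 1 I x - w * (psum 1 I x - psum 2 I x)"
    unfolding psum_def by (simp add: sum_subtractf sum_distrib_left sum_negf right_diff_distrib)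
  finally show ?thesis unfolding weight_def by simp
qed

lemma admissible_const: "admissible I (\<lambda>_. c)"
  unfolding admissible_def by auto

lemma admissible_mult: "admissible I f \<Longrightarrow> admissible I g \<Longrightarrow> admissible I (\<lambda>x. f x * g x)"
  unfolding admissible_def
proof (elim conjE exE, intro conjI exI allI impI)
  fix C D and x :: "nat \<Rightarrow> real" assume C: "\<forall>x. (\<forall>i\<in>I. x i \<in> {0..1}) \<longrightarrow> \<bar>f x\<bar> \<le> C" "\<forall>x. (\<forall>i\<in>I. x i \<in> {0..1}) \<longrightarrow> \<bar>g x\<bar> \<le> D" "\<forall>i\<in>I. x i \<in> {0..1}"
  then have "\<bar>f x\<bar> \<le> C" "\<bar>g x\<bar> \<le> D" by auto
  then show "\<bar>f x * g x\<bar> \<le> C * D" unfolding abs_mult by (intro mult_mono) auto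
qed auto

lemma admissible_add: "admissible I f \<Longrightarrow> admissible I g \<Longrightarrow> admissible I (\<lambda>x. f x + g x)"
  unfolding admissible_def
proof (elim conjE exE, intro conjI exI allI impI)
  fix C D and x :: "nat \<Rightarrow> real" assume C: "\<forall>x. (\<forall>i\<in>I. x i \<in> {0..1}) \<longrightarrow> \<bar>f x\<bar> \<le> C" "\<forall>x. (\<forall>i\<in>I. x i \<in> {0..1}) \<longrightarrow> \<bar>g x\<bar> \<le> D" "\<forall>i\<in>I. x i \<in> {0..1}"
  then have "\<bar>f x\<bar> \<le> C" "\<bar>g x\<bar> \<le> D" by auto
  then show "\<bar>f x + g x\<bar> \<le> C + D" by linarith
qed auto

lemma admissible_power: "admissible I f \<Longrightarrow> admissible I (\<lambda>x. f x ^ k)"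
  by (induction k) (auto intro: admissible_const admissible_mult)

lemma admissible_psum: "admissible I (psum k I)"
  unfolding admissible_def using psum_bounds by (auto intro!: exI[of _ "real (card I)"] simp: abs_of_nonneg)

lemma admissible_diff: "admissible I f \<Longrightarrow> admissible I g \<Longrightarrow> admissible I (\<lambda>x. f x - g x)"
  using admissible_add[of I f "\<lambda>x. (- 1) * g x"] admissible_mult[OF admissible_const[of I "- 1"], of g] by simp

lemmas admissible_intros = admissible_const admissible_mult admissible_add admissible_diff admissible_power admissible_psum

lemma integrable_weight:
  assumes "finite I" "admissible I f"
  shows "integrable (LP I) (\<lambda>x. f x * weight z w I x)"
proof -
  obtain C where f: "f \<in> borel_measurable (LP I)" and C: "\<And>x. (\<forall>i\<in>I. x i \<in> {0..1}) \<Longrightarrow> \<bar>f x\<bar> \<le> C"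
    using assms(2) unfolding admissible_def by blast
  have "integrable (LP I) (\<lambda>x. \<Prod>i\<in>I. wt z w (x i))"
    by (rule lborel_prod.product_integrable_prod) (use assms wt_integrable in auto)
  then have "integrable (LP I) (\<lambda>x. C * (\<Prod>i\<in>I. wt z w (x i)))" by simp
  then show ?thesis
  proof (rule Bochner_Integration.integrable_bound)
    show "(\<lambda>x. f x * weight z w I x) \<in> borel_measurable (LP I)" using f by measurable
    show "AE x in LP I. norm (f x * weight z w I x) \<le> norm (C * (\<Prod>i\<in>I. wt z w (x i)))"
    proof (rule AE_I2)
      fix x
      show "norm (f x * weight z w I x) \<le> norm (C * (\<Prod>i\<in>I. wt z w (x i)))"
      proof (cases "weight z w I x = 0")
        case False
        then have "\<bar>f x\<bar> \<le> C" using C weight_nonzero_imp[OF assms(1)] by blast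
        then show ?thesis using weight_le[OF assms(1), of z w x] weight_nonneg[of z w I x]
          by (auto simp: abs_mult intro!: mult_mono)
      qed simp
    qed
  qed
qed

lemma moment_add: "finite I \<Longrightarrow> admissible I f \<Longrightarrow> admissible I g \<Longrightarrow> moment z w I (\<lambda>x. f x + g x) = moment z w I f + moment z w I g"
  unfolding moment_def distrib_right by (rule Bochner_Integration.integral_add[OF integrable_weight integrable_weight])

lemma moment_diff: "finite I \<Longrightarrow> admissible I f \<Longrightarrow> admissible I g \<Longrightarrow> moment z w I (\<lambda>x. f x - g x) = moment z w I f - moment z w I g"
  unfolding moment_def left_diff_distrib by (rule Bochner_Integration.integral_diff[OF integrable_weight integrable_weight])

lemma moment_cmult: "moment z w I (\<lambda>x. c * f x) = c * moment z w I f"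
  unfolding moment_def by (simp add: mult.assoc)

lemma moment_deriv_z:
  assumes "finite I" "admissible I f"
  shows "((\<lambda>s. moment s w I f) has_field_derivative - moment z w I (\<lambda>x. psum 1 I x * f x)) (at z)"
proof -
  have e: "weight z w I x = weight 0 w I x * exp (z * - psum 1 I x)" for z x
  proof -
    have "exp (- z * psum 1 I x - w * (psum 1 I x - psum 2 I x)) = exp (- 0 * psum 1 I x - w * (psum 1 I x - psum 2 I x)) * exp (z * - psum 1 I x)"
      unfolding exp_add[symmetric] by simp
    then show ?thesis using weight_exp[OF assms(1), where z = z and w = w and x = x] weight_exp[OF assms(1), where z = 0 and w = w and x = x] by simp
  qed
  have "((\<lambda>s. \<integral>x. (f x * weight 0 w I x) * exp (s * - psum 1 I x) \<partial>LP I) has_field_derivative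
     (\<integral>x. (- psum 1 I x) * (f x * weight 0 w I x) * exp (z * - psum 1 I x) \<partial>LP I)) (at z)"
    by (rule deriv_exp_integral[where C = "card I"])
      (use psum_bounds weight_nonzero_imp[OF assms(1)] assms integrable_weight in \<open>auto simp: abs_of_nonneg\<close>)
  moreover have "(\<integral>x. (- psum 1 I x) * (f x * weight 0 w I x) * exp (z * - psum 1 I x) \<partial>LP I) = - moment z w I (\<lambda>x. psum 1 I x * f x)"
    unfolding moment_def e[of z] integral_minus[symmetric] by (rule Bochner_Integration.integral_cong) simp_all
  moreover have "(\<integral>x. (f x * weight 0 w I x) * exp (s * - psum 1 I x) \<partial>LP I) = moment s w I f" for s
    unfolding moment_def e[of s] mult.assoc ..
  ultimately show ?thesis by simp
qed

lemma moment_deriv_w: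
  assumes "finite I" "admissible I f"
  shows "((\<lambda>s. moment z s I f) has_field_derivative - moment z w I (\<lambda>x. (psum 1 I x - psum 2 I x) * f x)) (at w)"
proof -
  let ?q = "\<lambda>x. psum 1 I x - psum 2 I x"
  have e: "weight z w I x = weight z 0 I x * exp (w * - ?q x)" for w x
  proof -
    have "exp (- z * psum 1 I x - w * ?q x) = exp (- z * psum 1 I x - 0 * ?q x) * exp (w * - ?q x)"
      unfolding exp_add[symmetric] by (simp add: algebra_simps)
    then show ?thesis using weight_exp[OF assms(1), where z = z and w = w and x = x] weight_exp[OF assms(1), where z = z and w = 0 and x = x] by simp
  qed
  have b: "\<bar>- ?q x\<bar> \<le> 2 * card I" if "f x * weight z 0 I x \<noteq> 0" for x
  proof -
    have x: "x i \<in> {0..1}" if "i \<in> I" for i using weight_nonzero_imp[OF assms(1) _ that] \<open>f x * weight z 0 I x \<noteq> 0\<close> by auto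
    have "0 \<le> psum 1 I x" "psum 1 I x \<le> card I" "0 \<le> psum 2 I x" "psum 2 I x \<le> card I"
      by (intro psum_bounds x; assumption)+
    then show ?thesis by linarith
  qed
  have "((\<lambda>s. \<integral>x. (f x * weight z 0 I x) * exp (s * - ?q x) \<partial>LP I) has_field_derivative
     (\<integral>x. (- ?q x) * (f x * weight z 0 I x) * exp (w * - ?q x) \<partial>LP I)) (at w)"
    by (rule deriv_exp_integral[where C = "2 * card I"])
      (use b assms integrable_weight in auto)
  moreover have "(\<integral>x. (- ?q x) * (f x * weight z 0 I x) * exp (w * - ?q x) \<partial>LP I) = - moment z w I (\<lambda>x. ?q x * f x)"
    unfolding moment_def e[of w] integral_minus[symmetric] by (rule Bochner_Integration.integral_cong) (simp_all add: algebra_simps)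
  moreover have "(\<integral>x. (f x * weight z 0 I x) * exp (s * - ?q x) \<partial>LP I) = moment z s I f" for s
    unfolding moment_def e[of s] mult.assoc ..
  ultimately show ?thesis by simp
qed

end

section \<open>Bilinear moment identity\<close>

definition pmono :: "nat \<Rightarrow> nat \<Rightarrow> nat \<Rightarrow> nat set \<Rightarrow> (nat \<Rightarrow> real) \<Rightarrow> real" where
  "pmono a b c S x = psum 1 S x ^ a * psum 2 S x ^ b * psum 3 S x ^ c"

lemma pmono_cong: "(\<And>i. i \<in> S \<Longrightarrow> x i = y i) \<Longrightarrow> pmono a b c S x = pmono a b c S y"
  unfolding pmono_def using psum_cong[of S x y] by simp

lemma pmono_reindex: "bij_betw h J I \<Longrightarrow> pmono a b c I x = pmono a b c J (\<lambda>i. x (h i))"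
  unfolding pmono_def by (simp add: psum_reindex)

lemma card_sel:
  assumes "finite I"
  shows "card (sel I n i) = (if i \<le> n then card I choose (n - i) else 0)"
proof (cases "i \<le> n")
  case True
  then have "sel I n i = {S. S \<subseteq> I \<and> card S = n - i}" unfolding sel_def by auto
  then show ?thesis using True n_subsets[OF assms] by simp
qed (simp add: sel_eq_empty)

context jacobi_ensemble
begin

definition pmoment :: "real \<Rightarrow> real \<Rightarrow> nat \<Rightarrow> nat \<Rightarrow> nat \<Rightarrow> nat \<Rightarrow> real" where
  "pmoment z w k a b c = moment z w {..<k} (pmono a b c {..<k})"

lemma admissible_pmono: "admissible I (pmono a b c I)"
  unfolding pmono_def by (intro admissible_intros)

lemma weight_reindex: "bij_betw h J I \<Longrightarrow> strict_mono_on J h \<Longrightarrow> weight z w I x = weight z w J (\<lambda>i. x (h i))"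
  unfolding weight_def by (simp add: vdm_reindex flip: prod.reindex_bij_betw)

text \<open>Only the size of a block matters: the increasing enumeration of \<open>S\<close>
  transports measure, weight and monomial together. This is what makes all splittings of the same
  type contribute equally.\<close>

lemma moment_pmono:
  assumes "finite S"
  shows "moment z w S (pmono a b c S) = pmoment z w (card S) a b c"
proof -
  obtain h where h: "bij_betw h {..<card S} S" "strict_mono_on {..<card S} h"
    using ex_bij_betw_strict_mono_card[OF assms] .
  let ?J = "{..<card S}"
  have hS: "h i \<in> S" if "i \<in> ?J" for i using h(1) that by (auto simp: bij_betw_def)
  have m: "(\<lambda>x. \<lambda>i\<in>?J. x (h i)) \<in> LP S \<rightarrow>\<^sub>M LP ?J"
    by (intro measurable_restrict measurable_component_singleton hS)
  have meas: "(\<lambda>y. pmono a b c ?J y * weight z w ?J y) \<in> borel_measurable (LP ?J)"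
    unfolding pmono_def by measurable
  have "pmoment z w (card S) a b c = (\<integral>y. pmono a b c ?J y * weight z w ?J y \<partial>distr (LP S) (LP ?J) (\<lambda>x. \<lambda>i\<in>?J. x (h i)))"
    unfolding pmoment_def moment_def LP_reindex[OF h(1) finite_lessThan] ..
  also have "\<dots> = (\<integral>x. pmono a b c ?J (\<lambda>i\<in>?J. x (h i)) * weight z w ?J (\<lambda>i\<in>?J. x (h i)) \<partial>LP S)"
    by (rule integral_distr[OF m meas])
  also have "\<dots> = (\<integral>x. pmono a b c S x * weight z w S x \<partial>LP S)"
  proof (rule Bochner_Integration.integral_cong[OF refl])
    fix x
    have "pmono a b c ?J (\<lambda>i\<in>?J. x (h i)) = pmono a b c ?J (\<lambda>i. x (h i))" by (rule pmono_cong) simp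
    moreover have "weight z w ?J (\<lambda>i\<in>?J. x (h i)) = weight z w ?J (\<lambda>i. x (h i))" by (rule weight_cong) simp
    ultimately show "pmono a b c ?J (\<lambda>i\<in>?J. x (h i)) * weight z w ?J (\<lambda>i\<in>?J. x (h i)) = pmono a b c S x * weight z w S x"
      using pmono_reindex[OF h(1), of a b c x] weight_reindex[OF h, of z w x] by simp
  qed
  finally show ?thesis unfolding moment_def by simp
qed

lemma pmono_bound:
  assumes "\<And>i. i \<in> S \<Longrightarrow> x i \<in> {0..1}"
  shows "\<bar>pmono a b c S x\<bar> \<le> real (card S) ^ a * real (card S) ^ b * real (card S) ^ c"
  unfolding pmono_def abs_mult power_abs
  using psum_bounds[OF assms] by (intro mult_mono power_mono) (auto simp: abs_of_nonneg)

lemma weight_pair: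
  assumes "finite I" "S \<subseteq> I"
  shows "weight z w S x * weight z w (I - S) x = (\<Prod>i\<in>I. wt z w (x i)) * (vdm \<beta> x S * vdm \<beta> x (I - S))"
  unfolding weight_def using prod.subset_diff[OF assms(2,1), of "\<lambda>i. wt z w (x i)"] by (simp add: mult_ac)

lemma measurable_subcoords:
  assumes "A \<subseteq> I" "f \<in> borel_measurable (LP A)" "\<And>x y. (\<And>i. i \<in> A \<Longrightarrow> x i = y i) \<Longrightarrow> f x = f y"
  shows "f \<in> borel_measurable (LP I)"
proof -
  have "(\<lambda>x. f (restrict x A)) \<in> borel_measurable (LP I)"
    by (rule measurable_compose[OF measurable_restrict_subset[OF assms(1)] assms(2)])
  moreover have "f (restrict x A) = f x" for x by (rule assms(3)) simp
  ultimately show ?thesis by simp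
qed

lemma pmono_measurable: "pmono a b c A \<in> borel_measurable (LP A)"
  unfolding pmono_def by measurable

lemma integrable_pair:
  assumes "finite I" "S \<subseteq> I"
  shows "integrable (LP I) (\<lambda>x. pmono a b c S x * pmono a' b' c' (I - S) x * (weight z w S x * weight z w (I - S) x))"
proof -
  let ?T = "I - S"
  define C where "C = (real (card S) ^ a * real (card S) ^ b * real (card S) ^ c) * (real (card ?T) ^ a' * real (card ?T) ^ b' * real (card ?T) ^ c')"
  have fin: "finite S" "finite ?T" using assms finite_subset by auto
  have "integrable (LP I) (\<lambda>x. \<Prod>i\<in>I. wt z w (x i))"
    by (rule lborel_prod.product_integrable_prod) (use assms wt_integrable in auto)
  then have "integrable (LP I) (\<lambda>x. C * (\<Prod>i\<in>I. wt z w (x i)))" by simp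
  then show ?thesis
  proof (rule Bochner_Integration.integrable_bound)
    have [measurable]: "pmono a b c A \<in> borel_measurable (LP I)" "weight z w A \<in> borel_measurable (LP I)" if "A \<subseteq> I" for A a b c
      by (rule measurable_subcoords[OF that pmono_measurable pmono_cong], assumption)
        (rule measurable_subcoords[OF that weight_measurable weight_cong], assumption)
    have T: "?T \<subseteq> I" by auto
    show "(\<lambda>x. pmono a b c S x * pmono a' b' c' ?T x * (weight z w S x * weight z w ?T x)) \<in> borel_measurable (LP I)"
      using assms(2) T by measurable
    show "AE x in LP I. norm (pmono a b c S x * pmono a' b' c' ?T x * (weight z w S x * weight z w ?T x)) \<le> norm (C * (\<Prod>i\<in>I. wt z w (x i)))"
    proof (rule AE_I2)
      fix x
      show "norm (pmono a b c S x * pmono a' b' c' ?T x * (weight z w S x * weight z w ?T x)) \<le> norm (C * (\<Prod>i\<in>I. wt z w (x i)))"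
      proof (cases "weight z w S x * weight z w ?T x = 0")
        case False
        then have S: "\<And>i. i \<in> S \<Longrightarrow> x i \<in> {0..1}" and T: "\<And>i. i \<in> ?T \<Longrightarrow> x i \<in> {0..1}"
          using weight_nonzero_imp fin by (metis mult_eq_0_iff)+
        have "\<bar>pmono a b c S x * pmono a' b' c' ?T x\<bar> \<le> C"
          unfolding C_def abs_mult by (intro mult_mono pmono_bound S T) auto
        moreover have "weight z w S x * weight z w ?T x \<le> (\<Prod>i\<in>I. wt z w (x i))"
        proof -
          have "weight z w S x * weight z w ?T x \<le> (\<Prod>i\<in>S. wt z w (x i)) * (\<Prod>i\<in>?T. wt z w (x i))"
            by (intro mult_mono weight_le fin weight_nonneg prod_nonneg) (simp add: wt_nonneg)
          also have "\<dots> = (\<Prod>i\<in>I. wt z w (x i))" using prod.subset_diff[OF assms(2,1), of "\<lambda>i. wt z w (x i)"] by (simp add: mult_ac)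
          finally show ?thesis .
        qed
        ultimately have "\<bar>pmono a b c S x * pmono a' b' c' ?T x\<bar> * (weight z w S x * weight z w ?T x) \<le> C * (\<Prod>i\<in>I. wt z w (x i))"
          by (intro mult_mono) (auto simp: weight_nonneg C_def)
        then show ?thesis using weight_nonneg[of z w S x] weight_nonneg[of z w ?T x]
          by (simp only: real_norm_def abs_mult[of _ "weight z w S x * weight z w ?T x"] abs_of_nonneg[OF mult_nonneg_nonneg])
      qed auto
    qed
  qed
qed

text \<open>Weights and monomials of complementary blocks depend on disjoint coordinates, so Fubini
  over \<open>merge\<close> factorises the integral.\<close>

lemma integral_pair:
  assumes "finite I" "S \<subseteq> I"
  shows "(\<integral>x. pmono a b c S x * pmono a' b' c' (I - S) x * (weight z w S x * weight z w (I - S) x) \<partial>LP I) =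
    pmoment z w (card S) a b c * pmoment z w (card (I - S)) a' b' c'"
proof -
  let ?T = "I - S"
  have fin: "finite S" "finite ?T" using assms finite_subset by auto
  have U: "S \<union> ?T = I" using assms by auto
  have "(\<integral>x. pmono a b c S x * pmono a' b' c' ?T x * (weight z w S x * weight z w ?T x) \<partial>LP (S \<union> ?T)) =
     (\<integral>x. (\<integral>y. pmono a b c S (merge S ?T (x, y)) * pmono a' b' c' ?T (merge S ?T (x, y)) *
       (weight z w S (merge S ?T (x, y)) * weight z w ?T (merge S ?T (x, y))) \<partial>LP ?T) \<partial>LP S)"
    by (rule lborel_prod.product_integral_fold) (use fin U integrable_pair[OF assms] in auto)
  also have "\<dots> = (\<integral>x. (\<integral>y. (pmono a b c S x * weight z w S x) * (pmono a' b' c' ?T y * weight z w ?T y) \<partial>LP ?T) \<partial>LP S)"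
  proof (intro Bochner_Integration.integral_cong refl)
    fix x y
    have S: "pmono a b c S (merge S ?T (x, y)) = pmono a b c S x" "weight z w S (merge S ?T (x, y)) = weight z w S x"
      by (auto intro!: pmono_cong weight_cong simp: merge_def)
    have T: "pmono a' b' c' ?T (merge S ?T (x, y)) = pmono a' b' c' ?T y" "weight z w ?T (merge S ?T (x, y)) = weight z w ?T y"
      by (auto intro!: pmono_cong weight_cong simp: merge_def)
    show "pmono a b c S (merge S ?T (x, y)) * pmono a' b' c' ?T (merge S ?T (x, y)) *
       (weight z w S (merge S ?T (x, y)) * weight z w ?T (merge S ?T (x, y))) = (pmono a b c S x * weight z w S x) * (pmono a' b' c' ?T y * weight z w ?T y)"
      unfolding S T by (simp only: mult_ac)
  qed
  also have "\<dots> = moment z w S (pmono a b c S) * moment z w ?T (pmono a' b' c' ?T)"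
    unfolding moment_def by simp
  finally show ?thesis unfolding U moment_pmono[OF fin(1)] moment_pmono[OF fin(2)] .
qed

text \<open>All splittings of one type have the same integral, so each sum over \<open>sel\<close>
  becomes a binomial coefficient times one value. Expanding \<open>kp\<close> pairs every monomial
  with its mirror image under exchange of the blocks, whence the even coefficients.\<close>

lemma bilinear_identity:
  fixes n :: nat and z w :: real
  assumes "\<beta> \<in> {1, 2, 4}"
  defines "\<eta> \<equiv> eta_coeff \<beta>" and "i \<equiv> index_shift \<beta>" and "M \<equiv> pmoment z w n"
  shows "real (2 * n choose n) *
     (\<eta> * (2 * M 4 0 0 * M 0 0 0 - 8 * M 3 0 0 * M 1 0 0 + 6 * (M 2 0 0)\<^sup>2)
      + 3 * (2 * M 0 2 0 * M 0 0 0 - 2 * (M 0 1 0)\<^sup>2)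
      - 4 * (2 * M 1 0 1 * M 0 0 0 - 2 * M 1 0 0 * M 0 0 1))
   = kp_const \<beta> * (if i \<le> n then real (2 * n choose (n - i)) * pmoment z w (n - i) 0 0 0 * pmoment z w (n + i) 0 0 0 else 0)"
proof -
  define I where "I = {..<2 * n}"
  have I: "finite I" "card I = 2 * n" by (auto simp: I_def)
  let ?K = "\<eta> * (2 * M 4 0 0 * M 0 0 0 - 8 * M 3 0 0 * M 1 0 0 + 6 * (M 2 0 0)\<^sup>2)
      + 3 * (2 * M 0 2 0 * M 0 0 0 - 2 * (M 0 1 0)\<^sup>2)
      - 4 * (2 * M 1 0 1 * M 0 0 0 - 2 * M 1 0 0 * M 0 0 1)"
  let ?W = "\<lambda>S x. weight z w S x * weight z w (I - S) x"
  let ?kp = "\<lambda>S x. kp \<eta> (pdiff 1 S (I - S) x) (pdiff 2 S (I - S) x) (pdiff 3 S (I - S) x)"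
  have sum_eq: "(\<Sum>S\<in>sel I n 0. ?kp S x * ?W S x) = (\<Sum>S\<in>sel I n i. kp_const \<beta> * ?W S x)" for x
  proof -
    have "(\<Sum>S\<in>sel I n 0. ?kp S x * ?W S x) = (\<Prod>j\<in>I. wt z w (x j)) * (\<Sum>S\<in>sel I n 0. vdm \<beta> x S * vdm \<beta> x (I - S) * ?kp S x)"
      unfolding sum_distrib_left by (intro sum.cong refl, subst weight_pair) (auto simp: I sel_def)
    also have "\<dots> = (\<Prod>j\<in>I. wt z w (x j)) * (kp_const \<beta> * (\<Sum>S\<in>sel I n i. vdm \<beta> x S * vdm \<beta> x (I - S)))"
      unfolding \<eta>_def i_def using vdm_identity[OF I assms(1), of x] by simp
    also have "\<dots> = (\<Sum>S\<in>sel I n i. kp_const \<beta> * ?W S x)"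
      unfolding sum_distrib_left by (intro sum.cong refl, subst weight_pair) (auto simp: I sel_def)
    finally show ?thesis .
  qed
  have hb: "has_bochner_integral (LP I) (\<lambda>x. pmono a b c S x * pmono a' b' c' (I - S) x * ?W S x) (pmoment z w (card S) a b c * pmoment z w (card (I - S)) a' b' c')"
    if "S \<subseteq> I" for S a b c a' b' c'
    unfolding has_bochner_integral_iff using integrable_pair[OF I(1) that] integral_pair[OF I(1) that] by simp
  have L: "has_bochner_integral (LP I) (\<lambda>x. ?kp S x * ?W S x) ?K" if S: "S \<in> sel I n 0" for S
  proof -
    have SI: "S \<subseteq> I" and cS: "card S = n" "card (I - S) = n"
      using S I finite_subset[OF _ I(1)] by (auto simp: sel_def card_Diff_subset)
    note h = hb[OF SI, unfolded cS, folded M_def]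
    let ?f = "\<lambda>a b c a' b' c' x. pmono a b c S x * pmono a' b' c' (I - S) x * ?W S x"
    have "has_bochner_integral (LP I) (\<lambda>x.
        \<eta> * (?f 4 0 0 0 0 0 x - 4 * ?f 3 0 0 1 0 0 x + 6 * ?f 2 0 0 2 0 0 x - 4 * ?f 1 0 0 3 0 0 x + ?f 0 0 0 4 0 0 x)
        + 3 * (?f 0 2 0 0 0 0 x - 2 * ?f 0 1 0 0 1 0 x + ?f 0 0 0 0 2 0 x)
        - 4 * (?f 1 0 1 0 0 0 x - ?f 1 0 0 0 0 1 x - ?f 0 0 1 1 0 0 x + ?f 0 0 0 1 0 1 x))
       (\<eta> * (M 4 0 0 * M 0 0 0 - 4 * (M 3 0 0 * M 1 0 0) + 6 * (M 2 0 0 * M 2 0 0) - 4 * (M 1 0 0 * M 3 0 0) + M 0 0 0 * M 4 0 0)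
        + 3 * (M 0 2 0 * M 0 0 0 - 2 * (M 0 1 0 * M 0 1 0) + M 0 0 0 * M 0 2 0)
        - 4 * (M 1 0 1 * M 0 0 0 - M 1 0 0 * M 0 0 1 - M 0 0 1 * M 1 0 0 + M 0 0 0 * M 1 0 1))"
      by (intro has_bochner_integral_add has_bochner_integral_diff has_bochner_integral_mult_right h)
    also have "(\<lambda>x.
        \<eta> * (?f 4 0 0 0 0 0 x - 4 * ?f 3 0 0 1 0 0 x + 6 * ?f 2 0 0 2 0 0 x - 4 * ?f 1 0 0 3 0 0 x + ?f 0 0 0 4 0 0 x)
        + 3 * (?f 0 2 0 0 0 0 x - 2 * ?f 0 1 0 0 1 0 x + ?f 0 0 0 0 2 0 x)
        - 4 * (?f 1 0 1 0 0 0 x - ?f 1 0 0 0 0 1 x - ?f 0 0 1 1 0 0 x + ?f 0 0 0 1 0 1 x)) = (\<lambda>x. ?kp S x * ?W S x)"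
    proof
      fix x
      have alg: "\<eta> * (a^4*1* v - 4*(a^3*d* v) + 6*(a\<^sup>2*d\<^sup>2* v) - 4*(a*d^3* v) + 1*d^4* v) + 3*(b\<^sup>2*1* v - 2*(b*e* v) + 1*e\<^sup>2* v)
         - 4*((a*c)*1* v - a*f* v - c*d* v + 1*(d*f)* v) = kp \<eta> (a - d) (b - e) (c - f) * v" for a b c d e f v
        unfolding kp_def by algebra
      show "\<eta> * (?f 4 0 0 0 0 0 x - 4 * ?f 3 0 0 1 0 0 x + 6 * ?f 2 0 0 2 0 0 x - 4 * ?f 1 0 0 3 0 0 x + ?f 0 0 0 4 0 0 x)
        + 3 * (?f 0 2 0 0 0 0 x - 2 * ?f 0 1 0 0 1 0 x + ?f 0 0 0 0 2 0 x)
        - 4 * (?f 1 0 1 0 0 0 x - ?f 1 0 0 0 0 1 x - ?f 0 0 1 1 0 0 x + ?f 0 0 0 1 0 1 x) = ?kp S x * ?W S x"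
        unfolding pdiff_def alg[symmetric] pmono_def by simp
    qed
    finally show ?thesis by (rule has_bochner_integral_cong[THEN iffD1, rotated -1]) (simp_all add: power2_eq_square algebra_simps)
  qed
  have R: "has_bochner_integral (LP I) (\<lambda>x. kp_const \<beta> * ?W S x) (kp_const \<beta> * (pmoment z w (n - i) 0 0 0 * pmoment z w (n + i) 0 0 0))"
    if S: "S \<in> sel I n i" for S
  proof -
    have SI: "S \<subseteq> I" and cS: "card S = n - i" "card (I - S) = n + i"
      using S I finite_subset[OF _ I(1)] by (auto simp: sel_def card_Diff_subset)
    have "has_bochner_integral (LP I) (?W S) (pmoment z w (n - i) 0 0 0 * pmoment z w (n + i) 0 0 0)"
      using hb[OF SI, of 0 0 0 0 0 0] by (simp add: cS pmono_def)
    then show ?thesis by (rule has_bochner_integral_mult_right)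
  qed
  have "has_bochner_integral (LP I) (\<lambda>x. \<Sum>S\<in>sel I n 0. ?kp S x * ?W S x) (\<Sum>S\<in>sel I n 0. ?K)"
    by (rule has_bochner_integral_sum) (rule L)
  moreover have "has_bochner_integral (LP I) (\<lambda>x. \<Sum>S\<in>sel I n 0. ?kp S x * ?W S x) (\<Sum>S\<in>sel I n i. kp_const \<beta> * (pmoment z w (n - i) 0 0 0 * pmoment z w (n + i) 0 0 0))"
    unfolding sum_eq by (rule has_bochner_integral_sum) (rule R)
  ultimately have "(\<Sum>S\<in>sel I n 0. ?K) = (\<Sum>S\<in>sel I n i. kp_const \<beta> * (pmoment z w (n - i) 0 0 0 * pmoment z w (n + i) 0 0 0))"
    by (rule has_bochner_integral_eq)
  then show ?thesis by (simp add: card_sel I algebra_simps split: if_splits)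
qed

end

section \<open>Integration by parts\<close>

text \<open>Written as a multiple of the function over \<open>t - a\<close>, the derivative has the
  same form on both sides of \<open>a\<close> and is ready to be used as a logarithmic
  derivative.\<close>

lemma deriv_abs_power:
  fixes a t :: real
  assumes "t \<noteq> a"
  shows "((\<lambda>t. \<bar>t - a\<bar> ^ \<beta>) has_field_derivative real \<beta> * \<bar>t - a\<bar> ^ \<beta> / (t - a)) (at t)"
proof (cases "\<beta> = 0")
  case False
  then obtain k where k: "\<beta> = Suc k" by (metis not0_implies_Suc)
  define s where "s = sgn (t - a)"
  have s: "\<bar>t - a\<bar> = s * (t - a)" "s * s = 1" using assms by (auto simp: s_def sgn_if)
  have "((\<lambda>t. (s * (t - a)) ^ \<beta>) has_field_derivative real \<beta> * (s * (t - a)) ^ k * s) (at t)"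
  proof -
    have "((\<lambda>t. s * (t - a)) has_field_derivative s) (at t)" by (auto intro!: derivative_eq_intros)
    from DERIV_power[OF this, of "Suc k"] show ?thesis unfolding k by (simp add: mult_ac)
  qed
  moreover have "real \<beta> * (s * (t - a)) ^ k * s = real \<beta> * \<bar>t - a\<bar> ^ \<beta> / (t - a)"
    unfolding s(1) k using assms by (simp add: field_simps)
  moreover have "((\<lambda>t. (s * (t - a)) ^ \<beta>) has_field_derivative d) (at t) \<Longrightarrow> ((\<lambda>t. \<bar>t - a\<bar> ^ \<beta>) has_field_derivative d) (at t)" for d
  proof (erule has_field_derivative_transform_within_open[where S = "if t > a then {a<..} else {..<a}"])
    show "t \<in> (if t > a then {a<..} else {..<a})" using assms by auto
    show "(s * (u - a)) ^ \<beta> = \<bar>u - a\<bar> ^ \<beta>" if "u \<in> (if t > a then {a<..} else {..<a})" for u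
      using that assms by (auto simp: s_def split: if_splits)
  qed auto
  ultimately show ?thesis by simp
qed simp

lemma continuous_on_Icc_bounded:
  fixes f :: "real \<Rightarrow> real"
  assumes "continuous_on {a..b} f"
  obtains K where "\<And>t. t \<in> {a..b} \<Longrightarrow> \<bar>f t\<bar> \<le> K"
proof -
  have "bounded (f ` {a..b})" using compact_imp_bounded[OF compact_continuous_image[OF assms]] by simp
  then obtain K where "\<forall>y\<in>f ` {a..b}. norm y \<le> K" unfolding bounded_iff by blast
  then show thesis by (intro that[of K]) simp
qed

text \<open>The factor t (1 - t) raises both exponents to positive values, so the boundary terms
  vanish even if the density is singular there. \<open>S\<close> is meant for the other points,
  where the absolute values may fail to be differentiable; continuity of \<open>h\<close> bridges
  them.\<close>

lemma jacobi_integration_by_parts: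
  fixes h h' :: "real \<Rightarrow> real" and \<alpha> \<gamma> :: real
  assumes "\<alpha> > - 1" "\<gamma> > - 1" "finite S"
    and h: "continuous_on {0..1} h" "\<And>t. t \<in> {0<..<1} - S \<Longrightarrow> (h has_field_derivative h' t) (at t)"
    and h': "h' \<in> borel_measurable borel" "\<And>t. t \<in> {0..1} \<Longrightarrow> \<bar>h' t\<bar> \<le> K"
    and hm: "h \<in> borel_measurable borel"
  shows "(\<integral>t. indicator {0..1} t * (t powr \<alpha> * (1 - t) powr \<gamma>) * ((\<alpha> + 1 - (\<alpha> + \<gamma> + 2) * t) * h t + t * (1 - t) * h' t) \<partial>lborel) = 0"
proof -
  let ?f = "\<lambda>t. (t powr \<alpha> * (1 - t) powr \<gamma>) * ((\<alpha> + 1 - (\<alpha> + \<gamma> + 2) * t) * h t + t * (1 - t) * h' t)"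
  let ?F = "\<lambda>t. t powr (\<alpha> + 1) * (1 - t) powr (\<gamma> + 1) * h t"
  have "(?f has_integral (?F 1 - ?F 0)) {0..1}"
  proof (rule fundamental_theorem_of_calculus_interior_strong[OF assms(3)])
    fix t :: real assume t: "t \<in> {0<..<1} - S"
    then have t01: "0 < t" "t < 1" by auto
    have "((\<lambda>t. t powr (\<alpha> + 1)) has_field_derivative (\<alpha> + 1) * t powr \<alpha>) (at t)"
      using t01 by (auto intro!: derivative_eq_intros)
    moreover have "((\<lambda>t. (1 - t) powr (\<gamma> + 1)) has_field_derivative - ((\<gamma> + 1) * (1 - t) powr \<gamma>)) (at t)"
      using t01 by (auto intro!: derivative_eq_intros)
    ultimately have "(?F has_field_derivative ((\<alpha> + 1) * t powr \<alpha> * (1 - t) powr (\<gamma> + 1) + - ((\<gamma> + 1) * (1 - t) powr \<gamma>) * t powr (\<alpha> + 1)) * h t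
        + h' t * (t powr (\<alpha> + 1) * (1 - t) powr (\<gamma> + 1))) (at t)"
      by (rule DERIV_mult[OF DERIV_mult h(2)[OF t]])
    moreover have "((\<alpha> + 1) * t powr \<alpha> * (1 - t) powr (\<gamma> + 1) + - ((\<gamma> + 1) * (1 - t) powr \<gamma>) * t powr (\<alpha> + 1)) * h t
        + h' t * (t powr (\<alpha> + 1) * (1 - t) powr (\<gamma> + 1)) = ?f t"
    proof -
      have "t powr (\<alpha> + 1) = t powr \<alpha> * t" "(1 - t) powr (\<gamma> + 1) = (1 - t) powr \<gamma> * (1 - t)"
        using t01 by (simp_all add: powr_add)
      moreover have "((a + 1) * A * (B * (1 - t)) + - ((c + 1) * B) * (A * t)) * H + H' * (A * t * (B * (1 - t))) =
          A * B * ((a + 1 - (a + c + 2) * t) * H + t * (1 - t) * H')" for a c A B H H' :: real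
        by algebra
      ultimately show ?thesis by presburger
    qed
    ultimately show "(?F has_vector_derivative ?f t) (at t)"
      by (simp add: has_real_derivative_iff_has_vector_derivative)
  next
    show "continuous_on {0..1} ?F"
      using assms(1,2) h(1) by (intro continuous_intros continuous_on_powr') auto
  qed simp
  then have "(?f has_integral 0) {0..1}" by simp
  \<comment> \<open>The fundamental theorem yields a gauge integral; absolute integrability allows
    it to be read as a Lebesgue integral.\<close>
  moreover have "set_integrable lborel {0..1} ?f"
  proof -
    obtain H where H: "\<And>t. t \<in> {0..1} \<Longrightarrow> \<bar>h t\<bar> \<le> H"
      using continuous_on_Icc_bounded[OF h(1)] by blast
    have "set_integrable lborel {0..1} (\<lambda>t. t powr (\<alpha> + 1 - 1) * (1 - t) powr (\<gamma> + 1 - 1))"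
      by (rule integrable_Beta) (use assms in auto)
    then have i: "integrable lborel (\<lambda>t. indicator {0..1} t * (t powr \<alpha> * (1 - t) powr \<gamma>) * ((\<bar>\<alpha> + 1\<bar> + \<bar>\<alpha> + \<gamma> + 2\<bar>) * H + K))"
      unfolding set_integrable_def by simp
    have "integrable lborel (\<lambda>t. indicator {0..1} t * ?f t)"
    proof (rule Bochner_Integration.integrable_bound[OF i])
      show "(\<lambda>t. indicator {0..1} t * ?f t) \<in> borel_measurable lborel" using h'(1) hm by measurable
      show "AE t in lborel. norm (indicator {0..1} t * ?f t) \<le> norm (indicator {0..1} t * (t powr \<alpha> * (1 - t) powr \<gamma>) * ((\<bar>\<alpha> + 1\<bar> + \<bar>\<alpha> + \<gamma> + 2\<bar>) * H + K))"
      proof (rule AE_I2)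
        fix t :: real
        show "norm (indicator {0..1} t * ?f t) \<le> norm (indicator {0..1} t * (t powr \<alpha> * (1 - t) powr \<gamma>) * ((\<bar>\<alpha> + 1\<bar> + \<bar>\<alpha> + \<gamma> + 2\<bar>) * H + K))"
        proof (cases "t \<in> {0..1}")
          case True
          then have t: "0 \<le> t" "t \<le> 1" by auto
          have "\<bar>(\<alpha> + \<gamma> + 2) * t\<bar> \<le> \<bar>\<alpha> + \<gamma> + 2\<bar>"
            using t mult_left_le[of t "\<bar>\<alpha> + \<gamma> + 2\<bar>"] by (simp add: abs_mult)
          then have "\<bar>\<alpha> + 1 - (\<alpha> + \<gamma> + 2) * t\<bar> \<le> \<bar>\<alpha> + 1\<bar> + \<bar>\<alpha> + \<gamma> + 2\<bar>" by linarith
          then have 1: "\<bar>(\<alpha> + 1 - (\<alpha> + \<gamma> + 2) * t) * h t\<bar> \<le> (\<bar>\<alpha> + 1\<bar> + \<bar>\<alpha> + \<gamma> + 2\<bar>) * H"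
            unfolding abs_mult using H[OF True] by (intro mult_mono) auto
          have "t * (1 - t) \<le> 1" "0 \<le> t * (1 - t)" using t by (simp_all add: mult_le_one)
          then have "\<bar>t * (1 - t) * h' t\<bar> \<le> 1 * K"
            unfolding abs_mult[of "t * (1 - t)"] using h'(2)[OF True] by (intro mult_mono) auto
          with 1 have "\<bar>(\<alpha> + 1 - (\<alpha> + \<gamma> + 2) * t) * h t + t * (1 - t) * h' t\<bar> \<le> (\<bar>\<alpha> + 1\<bar> + \<bar>\<alpha> + \<gamma> + 2\<bar>) * H + K"
            by linarith
          then have "(t powr \<alpha> * (1 - t) powr \<gamma>) * \<bar>(\<alpha> + 1 - (\<alpha> + \<gamma> + 2) * t) * h t + t * (1 - t) * h' t\<bar> \<le> (t powr \<alpha> * (1 - t) powr \<gamma>) * \<bar>(\<bar>\<alpha> + 1\<bar> + \<bar>\<alpha> + \<gamma> + 2\<bar>) * H + K\<bar>"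
            by (intro mult_left_mono) auto
          then show ?thesis using True by (simp add: abs_mult)
        qed simp
      qed
    qed
    then show ?thesis unfolding set_integrable_def by simp
  qed
  ultimately have "(LINT t:{0..1}|lborel. ?f t) = 0"
    using set_borel_integral_eq_integral(2)[of "{0..1}" ?f] by (auto dest: integral_unique)
  then show ?thesis unfolding set_lebesgue_integral_def by (simp add: mult.assoc)
qed

context jacobi_ensemble
begin

abbreviation "\<gamma> \<equiv> real_of_int \<delta> / 2"

lemma weight_tie: "finite I \<Longrightarrow> j \<in> I \<Longrightarrow> k \<in> I \<Longrightarrow> j \<noteq> k \<Longrightarrow> x j = x k \<Longrightarrow> weight z w I x = 0"
proof -
  assume *: "finite I" "j \<in> I" "k \<in> I" "j \<noteq> k" "x j = x k"
  then have I: "I = insert j (I - {j})" by auto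
  have "(\<Prod>i\<in>I - {j}. \<bar>x j - x i\<bar> ^ \<beta>) = 0"
    using * \<beta>_pos by (auto simp: prod_zero_iff intro!: bexI[of _ k])
  then show ?thesis unfolding weight_def by (subst (2) I, subst vdm_insert) (use * in auto)
qed

text \<open>On the cube all factors are at most 1, so a single one may be kept. It compensates the
  pole of the logarithmic derivative, even for \<beta> = 1.\<close>

lemma vdm_le_dist:
  assumes "finite I" "j \<in> I" "k \<in> I" "j \<noteq> k" and x: "\<And>i. i \<in> I \<Longrightarrow> x i \<in> {0..1}"
  shows "vdm \<beta> x I \<le> \<bar>x j - x k\<bar>"
proof -
  have I: "I = insert j (I - {j})" using assms by auto
  have d: "\<bar>x a - x b\<bar> \<le> 1" if "a \<in> I" "b \<in> I" for a b using x[OF that(1)] x[OF that(2)] by auto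
  have "vdm \<beta> x I = vdm \<beta> x (I - {j}) * (\<bar>x j - x k\<bar> ^ \<beta> * (\<Prod>i\<in>I - {j} - {k}. \<bar>x j - x i\<bar> ^ \<beta>))"
    using assms by (subst I, subst vdm_insert) (auto simp: prod.remove[of "I - {j}" k])
  also have "\<dots> \<le> 1 * (\<bar>x j - x k\<bar> ^ \<beta> * 1)"
    using assms d by (intro mult_mono vdm_le_1 prod_le_1 conjI mult_nonneg_nonneg prod_nonneg power_le_one) auto
  also have "\<bar>x j - x k\<bar> ^ \<beta> \<le> \<bar>x j - x k\<bar> ^ 1"
    using \<beta>_pos d[OF assms(2,3)] by (intro power_decreasing) auto
  finally show ?thesis by simp
qed

lemma integrable_weight_div:
  assumes "finite I" "j \<in> I" "k \<in> I" "admissible I f"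
  shows "integrable (LP I) (\<lambda>x. f x * (weight z w I x / (x j - x k)))"
proof (cases "j = k")
  case False
  obtain C where f: "f \<in> borel_measurable (LP I)" and C: "\<And>x. (\<forall>i\<in>I. x i \<in> {0..1}) \<Longrightarrow> \<bar>f x\<bar> \<le> C"
    using assms(4) unfolding admissible_def by blast
  have "integrable (LP I) (\<lambda>x. \<Prod>i\<in>I. wt z w (x i))"
    by (rule lborel_prod.product_integrable_prod) (use assms wt_integrable in auto)
  then have "integrable (LP I) (\<lambda>x. C * (\<Prod>i\<in>I. wt z w (x i)))" by simp
  then show ?thesis
  proof (rule Bochner_Integration.integrable_bound)
    have [measurable]: "(\<lambda>x. x i) \<in> borel_measurable (LP I)" if "i \<in> I" for i
      using measurable_component_singleton[OF that, of "\<lambda>_. lborel"] by simp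
    show "(\<lambda>x. f x * (weight z w I x / (x j - x k))) \<in> borel_measurable (LP I)" using f assms(2,3) by measurable
    show "AE x in LP I. norm (f x * (weight z w I x / (x j - x k))) \<le> norm (C * (\<Prod>i\<in>I. wt z w (x i)))"
    proof (rule AE_I2)
      fix x
      show "norm (f x * (weight z w I x / (x j - x k))) \<le> norm (C * (\<Prod>i\<in>I. wt z w (x i)))"
      proof (cases "weight z w I x = 0")
        case nz: False
        have cube: "x i \<in> {0..1}" if "i \<in> I" for i using weight_nonzero_imp[OF assms(1) nz that] .
        have ne: "x j \<noteq> x k" using weight_tie[OF assms(1-3) False] nz by auto
        have "\<bar>f x\<bar> \<le> C" using C cube by blast
        moreover have "weight z w I x / \<bar>x j - x k\<bar> \<le> (\<Prod>i\<in>I. wt z w (x i))"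
        proof -
          have "vdm \<beta> x I / \<bar>x j - x k\<bar> \<le> 1"
            using vdm_le_dist[OF assms(1-3) False cube] ne by simp
          then have "(\<Prod>i\<in>I. wt z w (x i)) * (vdm \<beta> x I / \<bar>x j - x k\<bar>) \<le> (\<Prod>i\<in>I. wt z w (x i)) * 1"
            by (intro mult_left_mono prod_nonneg) (auto simp: wt_nonneg)
          then show ?thesis by (simp add: weight_def)
        qed
        ultimately have "\<bar>f x\<bar> * (weight z w I x / \<bar>x j - x k\<bar>) \<le> C * (\<Prod>i\<in>I. wt z w (x i))"
          by (intro mult_mono) (auto simp: weight_nonneg)
        then have "\<bar>f x\<bar> * (weight z w I x / \<bar>x j - x k\<bar>) \<le> \<bar>C * (\<Prod>i\<in>I. wt z w (x i))\<bar>"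
          by (rule order_trans[OF _ abs_ge_self])
        then show ?thesis using weight_nonneg[of z w I x] by (simp add: abs_mult)
      qed simp
    qed
  qed
qed simp


text \<open>Integration by parts in \<open>x j\<close> with test function c_0 + c_1 p_1 gives terms
  from the one-variable density and from the test function, collected here, and terms from the
  Vandermonde factor, collected in \<open>repulsion\<close>.\<close>

definition drift :: "real \<Rightarrow> real \<Rightarrow> nat set \<Rightarrow> nat \<Rightarrow> real \<Rightarrow> real \<Rightarrow> (nat \<Rightarrow> real) \<Rightarrow> real" where
  "drift z w I j c0 c1 x = (\<alpha> + 1 - (\<alpha> + \<gamma> + 2) * x j) * (c0 + c1 * psum 1 I x) +
     x j * (1 - x j) * ((- z - w * (1 - 2 * x j)) * (c0 + c1 * psum 1 I x) + c1)"

text \<open>Unlike \<open>drift\<close> this includes the weight: only the quotient of the weight by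
  \<open>x j - x k\<close>, not the reciprocal alone, is controlled near coinciding points.\<close>

definition repulsion :: "real \<Rightarrow> real \<Rightarrow> nat set \<Rightarrow> nat \<Rightarrow> real \<Rightarrow> real \<Rightarrow> (nat \<Rightarrow> real) \<Rightarrow> real" where
  "repulsion z w I j c0 c1 x = (\<Sum>k\<in>I - {j}. (x j * (1 - x j) * real \<beta> * (c0 + c1 * psum 1 I x)) * (weight z w I x / (x j - x k)))"

lemma admissible_coord: "j \<in> I \<Longrightarrow> admissible I (\<lambda>x. x j)"
  unfolding admissible_def using measurable_component_singleton[of j I "\<lambda>_. lborel"] by (auto intro!: exI[of _ 1])

lemma admissible_drift: "j \<in> I \<Longrightarrow> admissible I (drift z w I j c0 c1)"
  unfolding drift_def by (intro admissible_intros admissible_coord)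

lemma integrable_repulsion: "finite I \<Longrightarrow> j \<in> I \<Longrightarrow> integrable (LP I) (repulsion z w I j c0 c1)"
  unfolding repulsion_def
  by (intro Bochner_Integration.integrable_sum integrable_weight_div admissible_intros admissible_coord) auto

lemma integral_coord:
  assumes "finite I" "j \<in> I"
  shows "(\<integral>x. drift z w I j c0 c1 x * weight z w I x + repulsion z w I j c0 c1 x \<partial>LP I) = 0"
proof -
  define J where "J = I - {j}"
  have J: "finite J" "j \<notin> J" "I = insert j J" using assms by (auto simp: J_def)
  let ?D = "\<lambda>x. drift z w I j c0 c1 x * weight z w I x + repulsion z w I j c0 c1 x"
  have "(\<integral>x. ?D x \<partial>LP (insert j J)) = (\<integral>x. (\<integral>t. ?D (x(j := t)) \<partial>lborel) \<partial>LP J)"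
    by (rule lborel_prod.product_integral_insert[OF J(1,2)])
      (use integrable_weight[OF assms(1) admissible_drift[OF assms(2)]] integrable_repulsion[OF assms] J(3) in auto)
  \<comment> \<open>With the other coordinates frozen, the inner integral is \<open>c\<close> times
    an instance of \<open>jacobi_integration_by_parts\<close> for \<open>h\<close>.\<close>
  also have "\<dots> = (\<integral>x. 0 \<partial>LP J)"
  proof (rule Bochner_Integration.integral_cong[OF refl])
    fix x
    define c where "c = (\<Prod>i\<in>J. wt z w (x i)) * vdm \<beta> x J"
    define P where "P = (\<lambda>t. \<Prod>k\<in>J. \<bar>t - x k\<bar> ^ \<beta>)"
    define g where "g = (\<lambda>t. c0 + c1 * (t + psum 1 J x))"
    define e where "e = (\<lambda>t. exp (- z * t - w * t * (1 - t)))"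
    define h where "h = (\<lambda>t. e t * P t * g t)"
    define h' where "h' = (\<lambda>t. e t * P t * ((- z - w * (1 - 2 * t)) * g t + c1) + (\<Sum>k\<in>J. e t * g t * (\<beta> * (P t / (t - x k)))))"
    have w: "weight z w I (x(j := t)) = wt z w t * c * P t" for t
    proof -
      have "vdm \<beta> (x(j := t)) J = vdm \<beta> x J" by (rule vdm_cong) (use J in auto)
      moreover have "(\<Prod>k\<in>J. \<bar>t - (x(j := t)) k\<bar> ^ \<beta>) = P t" unfolding P_def by (rule prod.cong) (use J in auto)
      moreover have "(\<Prod>i\<in>J. wt z w ((x(j := t)) i)) = (\<Prod>i\<in>J. wt z w (x i))" by (rule prod.cong) (use J in auto)
      ultimately show ?thesis unfolding weight_def c_def using J by (simp add: vdm_insert)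
    qed
    have p: "psum 1 I (x(j := t)) = t + psum 1 J x" for t
    proof -
      have "psum 1 J (x(j := t)) = psum 1 J x" by (rule psum_cong) (use J in auto)
      then show ?thesis using J by (simp add: psum_insert)
    qed
    have D: "?D (x(j := t)) = c * (indicator {0..1} t * (t powr \<alpha> * (1 - t) powr \<gamma>) * ((\<alpha> + 1 - (\<alpha> + \<gamma> + 2) * t) * h t + t * (1 - t) * h' t))" for t
    proof -
      have "repulsion z w I j c0 c1 (x(j := t)) = (\<Sum>k\<in>J. (t * (1 - t) * real \<beta> * g t) * (wt z w t * c * P t / (t - x k)))"
        unfolding repulsion_def w p g_def J_def by (intro sum.cong) auto
      also have "\<dots> = c * (wt z w t * (t * (1 - t)) * (\<Sum>k\<in>J. g t * (\<beta> * (P t / (t - x k)))))"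
        unfolding sum_distrib_left by (intro sum.cong) auto
      finally have r: "repulsion z w I j c0 c1 (x(j := t)) = c * (wt z w t * (t * (1 - t)) * (\<Sum>k\<in>J. g t * (\<beta> * (P t / (t - x k)))))" .
      have d: "drift z w I j c0 c1 (x(j := t)) = (\<alpha> + 1 - (\<alpha> + \<gamma> + 2) * t) * g t + t * (1 - t) * ((- z - w * (1 - 2 * t)) * g t + c1)"
        unfolding drift_def p g_def by simp
      have h'2: "h' t = e t * (P t * ((- z - w * (1 - 2 * t)) * g t + c1) + (\<Sum>k\<in>J. g t * (\<beta> * (P t / (t - x k)))))"
        unfolding h'_def distrib_left sum_distrib_left by (simp add: mult.assoc)
      have wte: "wt z w t = indicator {0..1} t * (t powr \<alpha> * (1 - t) powr \<gamma>) * e t" unfolding wt_def e_def by simp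
      show ?thesis unfolding r d w h'2 h_def wte by (simp add: algebra_simps)
    qed
    show "(\<integral>t. ?D (x(j := t)) \<partial>lborel) = 0"
    proof (cases "c = 0")
      case False
      then have cube: "x i \<in> {0..1}" if "i \<in> J" for i
        using weight_nonzero_imp[OF J(1) _ that, of z w x] unfolding c_def weight_def by auto
      obtain K1 where K1: "\<And>t. t \<in> {0..1} \<Longrightarrow> \<bar>e t * P t * ((- z - w * (1 - 2 * t)) * g t + c1)\<bar> \<le> K1"
      proof -
        have "continuous_on {0..1} (\<lambda>t. e t * P t * ((- z - w * (1 - 2 * t)) * g t + c1))"
          unfolding e_def P_def g_def by (intro continuous_intros)
        from continuous_on_Icc_bounded[OF this] that show ?thesis by blast
      qed
      obtain K2 where K2: "\<And>t. t \<in> {0..1} \<Longrightarrow> \<bar>e t * g t\<bar> \<le> K2"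
      proof -
        have "continuous_on {0..1} (\<lambda>t. e t * g t)"
          unfolding e_def g_def by (intro continuous_intros)
        from continuous_on_Icc_bounded[OF this] that show ?thesis by blast
      qed
      have PK: "\<bar>P t / (t - x k)\<bar> \<le> 1" if t: "t \<in> {0..1}" and k: "k \<in> J" for t k
      proof (cases "t = x k")
        case ne: False
        have d: "\<bar>t - x i\<bar> \<le> 1" if "i \<in> J" for i using t cube[OF that] by auto
        have "P t = \<bar>t - x k\<bar> ^ \<beta> * (\<Prod>i\<in>J - {k}. \<bar>t - x i\<bar> ^ \<beta>)"
          unfolding P_def using J(1) k by (simp add: prod.remove)
        also have "\<dots> \<le> \<bar>t - x k\<bar> ^ \<beta> * 1"
          using d by (intro mult_left_mono prod_le_1 conjI power_le_one) auto
        also have "\<bar>t - x k\<bar> ^ \<beta> * 1 \<le> \<bar>t - x k\<bar> ^ 1"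
          using \<beta>_pos d[OF k] power_decreasing[of 1 \<beta> "\<bar>t - x k\<bar>"] by simp
        finally have "P t \<le> \<bar>t - x k\<bar>" by simp
        moreover have "P t \<ge> 0" unfolding P_def by (intro prod_nonneg) auto
        ultimately show ?thesis using ne by simp
      qed simp
      have "(\<integral>t. indicator {0..1} t * (t powr \<alpha> * (1 - t) powr \<gamma>) * ((\<alpha> + 1 - (\<alpha> + \<gamma> + 2) * t) * h t + t * (1 - t) * h' t) \<partial>lborel) = 0"
      proof (rule jacobi_integration_by_parts[where S = "x ` J" and K = "K1 + (\<Sum>k\<in>J. K2 * \<beta>)"])
        show "\<alpha> > - 1" "\<gamma> > - 1" using \<alpha>_gt \<delta>_ge by auto
        show "finite (x ` J)" using J by simp
        show "continuous_on {0..1} h" unfolding h_def e_def P_def g_def by (intro continuous_intros)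
        show "h \<in> borel_measurable borel" unfolding h_def e_def P_def g_def by measurable
        show "h' \<in> borel_measurable borel" unfolding h'_def e_def P_def g_def by measurable
        show "\<bar>h' t\<bar> \<le> K1 + (\<Sum>k\<in>J. K2 * \<beta>)" if "t \<in> {0..1}" for t
        proof -
          have "\<bar>e t * g t * (\<beta> * (P t / (t - x k)))\<bar> \<le> K2 * \<beta>" if "k \<in> J" for k
          proof -
            have "\<bar>real \<beta> * (P t / (t - x k))\<bar> \<le> \<beta>"
              using PK[OF \<open>t \<in> {0..1}\<close> that] mult_left_mono[of "\<bar>P t / (t - x k)\<bar>" 1 "real \<beta>"] by (simp add: abs_mult)
            then show ?thesis unfolding abs_mult[of "e t * g t"] using K2[OF \<open>t \<in> {0..1}\<close>] by (intro mult_mono) auto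
          qed
          then have "\<bar>\<Sum>k\<in>J. e t * g t * (\<beta> * (P t / (t - x k)))\<bar> \<le> (\<Sum>k\<in>J. K2 * \<beta>)"
            by (intro order_trans[OF sum_abs] sum_mono)
          then show ?thesis unfolding h'_def using K1[OF that] by linarith
        qed
        fix t assume t: "t \<in> {0<..<1} - x ` J"
        have e': "(e has_field_derivative e t * (- z - w * (1 - 2 * t))) (at t)"
          unfolding e_def by (auto intro!: derivative_eq_intros simp: algebra_simps)
        have "(P has_field_derivative P t * (\<Sum>k\<in>J. real \<beta> * \<bar>t - x k\<bar> ^ \<beta> / (t - x k) / \<bar>t - x k\<bar> ^ \<beta>)) (at t)"
          unfolding P_def by (rule has_field_derivative_prod') (use t in \<open>auto intro!: deriv_abs_power\<close>)
        also have "P t * (\<Sum>k\<in>J. real \<beta> * \<bar>t - x k\<bar> ^ \<beta> / (t - x k) / \<bar>t - x k\<bar> ^ \<beta>) = (\<Sum>k\<in>J. \<beta> * (P t / (t - x k)))"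
          unfolding sum_distrib_left by (intro sum.cong) (use t in auto)
        finally have P': "(P has_field_derivative (\<Sum>k\<in>J. \<beta> * (P t / (t - x k)))) (at t)" .
        have g': "(g has_field_derivative c1) (at t)"
          unfolding g_def by (auto intro!: derivative_eq_intros)
        have "(h has_field_derivative (e t * (- z - w * (1 - 2 * t)) * P t + (\<Sum>k\<in>J. \<beta> * (P t / (t - x k))) * e t) * g t + c1 * (e t * P t)) (at t)"
          unfolding h_def by (rule DERIV_mult[OF DERIV_mult[OF e' P'] g'])
        also have "(e t * (- z - w * (1 - 2 * t)) * P t + (\<Sum>k\<in>J. \<beta> * (P t / (t - x k))) * e t) * g t + c1 * (e t * P t) = h' t"
        proof -
          have "(\<Sum>k\<in>J. e t * g t * (\<beta> * (P t / (t - x k)))) = e t * g t * (\<Sum>k\<in>J. \<beta> * (P t / (t - x k)))"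
            unfolding sum_distrib_left ..
          then show ?thesis unfolding h'_def by (simp add: algebra_simps)
        qed
        finally show "(h has_field_derivative h' t) (at t)" .
      qed
      then show ?thesis unfolding D by simp
    qed (simp add: D)
  qed
  finally show ?thesis unfolding J(3) by simp
qed

text \<open>Exchanging j and k symmetrises the sum, and (x_j (1 - x_j) - x_k (1 - x_k)) / (x_j -
  x_k) = 1 - x_j - x_k removes the poles. For coinciding points the weight vanishes.\<close>

lemma sum_repulsion:
  assumes "finite I"
  shows "(\<Sum>j\<in>I. repulsion z w I j c0 c1 x) =
    \<beta> * (card I * (real (card I) - 1) / 2 - (real (card I) - 1) * psum 1 I x) * (c0 + c1 * psum 1 I x) * weight z w I x"
proof (cases "inj_on x I")
  case True
  let ?a = "\<lambda>j k. x j * (1 - x j) / (x j - x k)"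
  \<comment> \<open>Diagonal terms are 0 because division by zero yields 0; the subtracted term
    corrects the formula there.\<close>
  have pair: "?a j k + ?a k j = (1 - x j - x k) - (if j = k then 1 - 2 * x j else 0)" if "j \<in> I" "k \<in> I" for j k
  proof (cases "j = k")
    case False
    then have "x j - x k \<noteq> 0" "x k - x j \<noteq> 0" using True that by (auto simp: inj_on_def)
    have "?a k j = - (x k * (1 - x k) / (x j - x k))"
      by (metis minus_diff_eq minus_divide_right)
    then have "?a j k + ?a k j = (x j * (1 - x j) - x k * (1 - x k)) / (x j - x k)"
      by (simp add: diff_divide_distrib)
    also have "\<dots> = (1 - x j - x k)"
      using \<open>x j - x k \<noteq> 0\<close> by (simp add: field_simps)
    finally show ?thesis using False by simp
  qed simp
  let ?N = "real (card I)"
  have "2 * (\<Sum>j\<in>I. \<Sum>k\<in>I. ?a j k) = (\<Sum>j\<in>I. \<Sum>k\<in>I. ?a j k + ?a k j)"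
    using sum.swap[of ?a I I] by (simp add: sum.distrib)
  also have "\<dots> = (\<Sum>j\<in>I. \<Sum>k\<in>I. (1 - x j - x k) - (if j = k then 1 - 2 * x j else 0))"
    using pair by (intro sum.cong refl) auto
  also have "\<dots> = ?N * ?N - 2 * ?N * psum 1 I x - (?N - 2 * psum 1 I x)"
    using assms by (simp add: sum_subtractf psum_def flip: sum_distrib_left) (simp add: algebra_simps)
  finally have S: "(\<Sum>j\<in>I. \<Sum>k\<in>I. ?a j k) = ?N * (?N - 1) / 2 - (?N - 1) * psum 1 I x"
    by (simp add: field_simps)
  have "(\<Sum>j\<in>I. repulsion z w I j c0 c1 x) = (\<Sum>j\<in>I. \<Sum>k\<in>I. \<beta> * (c0 + c1 * psum 1 I x) * weight z w I x * ?a j k)"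
  proof (rule sum.cong[OF refl])
    fix j assume "j \<in> I"
    have "(\<Sum>k\<in>I. \<beta> * (c0 + c1 * psum 1 I x) * weight z w I x * ?a j k) = (\<Sum>k\<in>I - {j}. \<beta> * (c0 + c1 * psum 1 I x) * weight z w I x * ?a j k)"
      using assms \<open>j \<in> I\<close> by (subst sum.remove[of I j]) auto
    then show "repulsion z w I j c0 c1 x = (\<Sum>k\<in>I. \<beta> * (c0 + c1 * psum 1 I x) * weight z w I x * ?a j k)"
      unfolding repulsion_def by (simp add: mult_ac)
  qed
  also have "\<dots> = \<beta> * (c0 + c1 * psum 1 I x) * weight z w I x * (?N * (?N - 1) / 2 - (?N - 1) * psum 1 I x)"
    unfolding S[symmetric] sum_distrib_left ..
  finally show ?thesis by (simp add: mult_ac)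
next
  case False
  then have "weight z w I x = 0" using weight_tie[OF assms] by (auto simp: inj_on_def)
  then show ?thesis by (simp add: repulsion_def)
qed

text \<open>Differentiating the exponent along t (1 - t) produces t (1 - t) (1 - 2 t) = t - 3 t^2 +
  2 t^3, the source of the third power sum, which thus always comes with the factor w.\<close>

lemma sum_drift:
  assumes "finite I"
  shows "(\<Sum>j\<in>I. drift z w I j c0 c1 x) =
    ((\<alpha> + 1) * card I - (\<alpha> + \<gamma> + 2) * psum 1 I x - z * (psum 1 I x - psum 2 I x) - w * (psum 1 I x - 3 * psum 2 I x + 2 * psum 3 I x)) * (c0 + c1 * psum 1 I x)
    + c1 * (psum 1 I x - psum 2 I x)"
proof -
  let ?g = "c0 + c1 * psum 1 I x"
  have "drift z w I j c0 c1 x = ((\<alpha> + 1) * ?g + ((- (\<alpha> + \<gamma> + 2) - z - w) * ?g + c1) * x j ^ 1 + ((z + 3 * w) * ?g - c1) * x j ^ 2 + (- 2 * w * ?g) * x j ^ 3)" for j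
    unfolding drift_def by (simp add: algebra_simps power2_eq_square power3_eq_cube)
  then have "(\<Sum>j\<in>I. drift z w I j c0 c1 x) = (\<alpha> + 1) * ?g * card I + ((- (\<alpha> + \<gamma> + 2) - z - w) * ?g + c1) * psum 1 I x + ((z + 3 * w) * ?g - c1) * psum 2 I x + (- 2 * w * ?g) * psum 3 I x"
    unfolding psum_def sum_distrib_left by (simp only: sum.distrib) (simp add: mult.commute)
  moreover have "(a + 1) * g * N + ((- (a + c + 2) - z - w) * g + c1) * p + ((z + 3 * w) * g - c1) * q + (- 2 * w * g) * r =
      ((a + 1) * N - (a + c + 2) * p - z * (p - q) - w * (p - 3 * q + 2 * r)) * g + c1 * (p - q)" for a c g N p q r :: real
    by algebra
  ultimately show ?thesis by presburger
qed

text \<open>A loop equation (Virasoro constraint): only after summation over all coordinates do the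
  poles cancel, leaving a relation among power sums.\<close>

lemma virasoro:
  fixes N :: real
  assumes "finite I"
  defines "N \<equiv> real (card I)"
  shows "moment z w I (\<lambda>x. ((\<alpha> + 1) * N + \<beta> * N * (N - 1) / 2 - (\<alpha> + \<gamma> + 2 + \<beta> * (N - 1)) * psum 1 I x
       - z * (psum 1 I x - psum 2 I x) - w * (psum 1 I x - 3 * psum 2 I x + 2 * psum 3 I x)) * (c0 + c1 * psum 1 I x)
       + c1 * (psum 1 I x - psum 2 I x)) = 0"
proof -
  have int: "integrable (LP I) (\<lambda>x. drift z w I j c0 c1 x * weight z w I x + repulsion z w I j c0 c1 x)" if "j \<in> I" for j
    using integrable_weight[OF assms(1) admissible_drift[OF that]] integrable_repulsion[OF assms(1) that]
    by (rule Bochner_Integration.integrable_add)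
  have "(\<integral>x. (\<Sum>j\<in>I. drift z w I j c0 c1 x * weight z w I x + repulsion z w I j c0 c1 x) \<partial>LP I) = 0"
    using int integral_coord[OF assms(1)] by (subst Bochner_Integration.integral_sum) auto
  also have "(\<lambda>x. \<Sum>j\<in>I. drift z w I j c0 c1 x * weight z w I x + repulsion z w I j c0 c1 x) =
    (\<lambda>x. (((\<alpha> + 1) * N + \<beta> * N * (N - 1) / 2 - (\<alpha> + \<gamma> + 2 + \<beta> * (N - 1)) * psum 1 I x
       - z * (psum 1 I x - psum 2 I x) - w * (psum 1 I x - 3 * psum 2 I x + 2 * psum 3 I x)) * (c0 + c1 * psum 1 I x)
       + c1 * (psum 1 I x - psum 2 I x)) * weight z w I x)"
    unfolding sum.distrib sum_distrib_right[symmetric] sum_drift[OF assms(1)] sum_repulsion[OF assms(1)] N_def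
    by (simp add: field_simps)
  finally show ?thesis unfolding moment_def .
qed

end

section \<open>Cumulants\<close>

text \<open>The formulas express joint cumulants through moments. Every derivative of
  \<open>q\<close> brings a minus sign, which survives only in the first-order case; the norming
  constant \<open>c\<close> disappears under the logarithm's derivative.\<close>

lemma cgf_partials:
  fixes q :: "nat \<Rightarrow> nat \<Rightarrow> real \<Rightarrow> real \<Rightarrow> real"
  assumes dz: "\<And>a b z w. ((\<lambda>s. q a b s w) has_field_derivative - q (Suc a) b z w) (at z)"
    and dw: "\<And>a b z w. ((\<lambda>s. q a b z s) has_field_derivative - q a (Suc b) z w) (at w)"
    and pos: "\<And>z w. q 0 0 z w > 0" and c: "c > 0"
    and \<sigma>: "\<sigma> = (\<lambda>z w. ln (q 0 0 z w / c))"
  shows "(partial_z ^^ 2) \<sigma> = (\<lambda>z w. q 2 0 z w / q 0 0 z w - (q 1 0 z w / q 0 0 z w)\<^sup>2)"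
    and "(partial_z ^^ 4) \<sigma> = (\<lambda>z w. q 4 0 z w / q 0 0 z w - 4 * q 1 0 z w * q 3 0 z w / (q 0 0 z w)\<^sup>2
        - 3 * (q 2 0 z w / q 0 0 z w)\<^sup>2 + 12 * (q 1 0 z w)\<^sup>2 * q 2 0 z w / q 0 0 z w ^ 3 - 6 * (q 1 0 z w / q 0 0 z w) ^ 4)"
    and "partial_w \<sigma> = (\<lambda>z w. - q 0 1 z w / q 0 0 z w)"
    and "(partial_w ^^ 2) \<sigma> = (\<lambda>z w. q 0 2 z w / q 0 0 z w - (q 0 1 z w / q 0 0 z w)\<^sup>2)"
    and "partial_z (partial_w \<sigma>) = (\<lambda>z w. q 1 1 z w / q 0 0 z w - q 0 1 z w * q 1 0 z w / (q 0 0 z w)\<^sup>2)"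
proof -
  have nz: "q 0 0 z w \<noteq> 0" for z w using pos[of z w] by simp
  note Dz = dz[THEN DERIV_cong] and Dw = dw[THEN DERIV_cong]
  note simps = nz power2_eq_square power3_eq_cube power4_eq_xxxx numeral_eq_Suc
  have z1: "partial_z \<sigma> = (\<lambda>z w. - q 1 0 z w / q 0 0 z w)"
    unfolding \<sigma> partial_z_def
    by (intro ext DERIV_imp_deriv) (use pos c nz in \<open>auto intro!: derivative_eq_intros Dz simp: field_simps\<close>)
  have z2: "partial_z (\<lambda>z w. - q 1 0 z w / q 0 0 z w) = (\<lambda>z w. q 2 0 z w / q 0 0 z w - (q 1 0 z w / q 0 0 z w)\<^sup>2)"
    unfolding partial_z_def
    by (intro ext DERIV_imp_deriv) (use nz in \<open>auto intro!: derivative_eq_intros Dz simp: field_simps simps\<close>)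
  have z3: "partial_z (\<lambda>z w. q 2 0 z w / q 0 0 z w - (q 1 0 z w / q 0 0 z w)\<^sup>2) =
      (\<lambda>z w. - q 3 0 z w / q 0 0 z w + 3 * q 1 0 z w * q 2 0 z w / (q 0 0 z w)\<^sup>2 - 2 * (q 1 0 z w / q 0 0 z w) ^ 3)"
    unfolding partial_z_def
    by (intro ext DERIV_imp_deriv) (use nz in \<open>auto intro!: derivative_eq_intros Dz simp: field_simps simps\<close>)
  have z4: "partial_z (\<lambda>z w. - q 3 0 z w / q 0 0 z w + 3 * q 1 0 z w * q 2 0 z w / (q 0 0 z w)\<^sup>2 - 2 * (q 1 0 z w / q 0 0 z w) ^ 3) =
      (\<lambda>z w. q 4 0 z w / q 0 0 z w - 4 * q 1 0 z w * q 3 0 z w / (q 0 0 z w)\<^sup>2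
        - 3 * (q 2 0 z w / q 0 0 z w)\<^sup>2 + 12 * (q 1 0 z w)\<^sup>2 * q 2 0 z w / q 0 0 z w ^ 3 - 6 * (q 1 0 z w / q 0 0 z w) ^ 4)"
    unfolding partial_z_def
    by (intro ext DERIV_imp_deriv) (use nz in \<open>auto intro!: derivative_eq_intros Dz simp: field_simps simps\<close>)
  show 2: "(partial_z ^^ 2) \<sigma> = (\<lambda>z w. q 2 0 z w / q 0 0 z w - (q 1 0 z w / q 0 0 z w)\<^sup>2)"
    using z1 z2 by (simp add: numeral_2_eq_2)
  have "(partial_z ^^ 4) \<sigma> = partial_z (partial_z ((partial_z ^^ 2) \<sigma>))"
    by (simp add: numeral_eq_Suc)
  then show "(partial_z ^^ 4) \<sigma> = (\<lambda>z w. q 4 0 z w / q 0 0 z w - 4 * q 1 0 z w * q 3 0 z w / (q 0 0 z w)\<^sup>2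
        - 3 * (q 2 0 z w / q 0 0 z w)\<^sup>2 + 12 * (q 1 0 z w)\<^sup>2 * q 2 0 z w / q 0 0 z w ^ 3 - 6 * (q 1 0 z w / q 0 0 z w) ^ 4)"
    unfolding 2 z3 z4 .
  show w1: "partial_w \<sigma> = (\<lambda>z w. - q 0 1 z w / q 0 0 z w)"
    unfolding \<sigma> partial_w_def
    by (intro ext DERIV_imp_deriv) (use pos c nz in \<open>auto intro!: derivative_eq_intros Dw simp: field_simps\<close>)
  have w2: "partial_w (\<lambda>z w. - q 0 1 z w / q 0 0 z w) = (\<lambda>z w. q 0 2 z w / q 0 0 z w - (q 0 1 z w / q 0 0 z w)\<^sup>2)"
    unfolding partial_w_def
    by (intro ext DERIV_imp_deriv) (use nz in \<open>auto intro!: derivative_eq_intros Dw simp: field_simps simps\<close>)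
  show "(partial_w ^^ 2) \<sigma> = (\<lambda>z w. q 0 2 z w / q 0 0 z w - (q 0 1 z w / q 0 0 z w)\<^sup>2)"
    using w1 w2 by (simp add: numeral_2_eq_2)
  show "partial_z (partial_w \<sigma>) = (\<lambda>z w. q 1 1 z w / q 0 0 z w - q 0 1 z w * q 1 0 z w / (q 0 0 z w)\<^sup>2)"
    unfolding w1 partial_z_def
    by (intro ext DERIV_imp_deriv) (use nz in \<open>auto intro!: derivative_eq_intros Dz simp: field_simps simps\<close>)
qed

section \<open>Positivity and the passage to the generating function\<close>

context jacobi_ensemble
begin

lemma pmoment_pos: "pmoment z w k 0 0 0 > 0"
proof -
  let ?I = "{..<k}"
  have pmoment: "pmoment z w k 0 0 0 = (\<integral>x. weight z w ?I x \<partial>LP ?I)"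
    unfolding pmoment_def moment_def pmono_def by simp
  have int: "integrable (LP ?I) (weight z w ?I)"
    using integrable_weight[OF _ admissible_const[of ?I 1]] by simp
  \<comment> \<open>Middle thirds of the cells [i/k, (i + 1)/k]: they are mutually separated, stay
    away from 0 and 1 and have positive length, so the weight has no zero on their product.\<close>
  define A where "A = (\<lambda>i. {(real i + 1/3) / real k .. (real i + 2/3) / real k})"
  have A: "0 < t" "t < 1" if "t \<in> A i" "i < k" for t i
  proof -
    have k: "real k > 0" "real i + 1 \<le> real k" using that by auto
    have "0 < (real i + 1/3) / real k" using k by (intro divide_pos_pos) auto
    then show "0 < t" using that unfolding A_def by (meson atLeastAtMost_iff less_le_trans)
    have "(real i + 2/3) / real k < 1" using k by (simp add: field_simps)
    then show "t < 1" using that unfolding A_def by (meson atLeastAtMost_iff le_less_trans)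
  qed
  have ne: "s < t" if "s \<in> A i" "t \<in> A j" "i < j" "j < k" for s t i j
  proof -
    have k: "real k > 0" "real i + 1 \<le> real j" using that by auto
    have "s \<le> (real i + 2/3) / real k" using that by (simp add: A_def)
    also have "\<dots> < (real j + 1/3) / real k" using k by (intro divide_strict_right_mono) auto
    also have "\<dots> \<le> t" using that by (simp add: A_def)
    finally show ?thesis .
  qed
  have pos: "weight z w ?I x \<noteq> 0" if x: "x \<in> PiE ?I A" for x
  proof -
    have "wt z w (x i) \<noteq> 0" if "i < k" for i
      using A[of "x i" i] x that by (auto simp: wt_def PiE_iff)
    moreover have "vdm \<beta> x ?I \<noteq> 0"
    proof -
      have "x j \<noteq> x i" if "i < j" "j < k" for i j
        using ne[of "x i" i "x j" j] x that by (auto simp: PiE_iff)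
      then show ?thesis unfolding vdm_def by (auto simp: prod_zero_iff)
    qed
    ultimately show ?thesis by (simp add: weight_def prod_zero_iff)
  qed
  have AS: "PiE ?I A \<in> sets (LP ?I)" by (intro sets_PiM_I_finite) (auto simp: A_def)
  have "pmoment z w k 0 0 0 \<noteq> 0"
  proof
    assume "pmoment z w k 0 0 0 = 0"
    then have "AE x in LP ?I. weight z w ?I x = 0"
      unfolding pmoment using integral_nonneg_eq_0_iff_AE[OF int] by (simp add: weight_nonneg)
    then have "AE x in LP ?I. x \<notin> PiE ?I A" by eventually_elim (use pos in blast)
    then have "emeasure (LP ?I) (PiE ?I A) = 0" using AS by (simp add: AE_iff_null_sets null_setsD1)
    moreover have "emeasure (LP ?I) (PiE ?I A) = (\<Prod>i\<in>?I. emeasure lborel (A i))"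
      by (rule lborel_prod.emeasure_PiM) (auto simp: A_def)
    moreover have "emeasure lborel (A i) \<noteq> 0" if "i < k" for i
    proof -
      have "(real i + 1/3) / real k < (real i + 2/3) / real k" using that by (intro divide_strict_right_mono) auto
      then show ?thesis using that unfolding A_def by auto
    qed
    ultimately show False by (simp add: prod_zero_iff)
  qed
  moreover have "pmoment z w k 0 0 0 \<ge> 0" unfolding pmoment by (intro integral_nonneg_AE) (simp add: weight_nonneg)
  ultimately show ?thesis by simp
qed

lemma cube_integral_eq_pmoment:
  "cube_integral k (\<lambda>T. (\<Prod>j<k. exp (- z * T j - w * T j * (1 - T j))) * selberg_density \<beta> \<alpha> \<delta> k T) = pmoment z w k 0 0 0"
proof -
  let ?I = "{..<k}"
  have "indicator (PiE ?I (\<lambda>_. {0..1})) T *\<^sub>R ((\<Prod>j<k. exp (- z * T j - w * T j * (1 - T j))) * selberg_density \<beta> \<alpha> \<delta> k T) = weight z w ?I T"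
    if "T \<in> space (LP ?I)" for T
  proof -
    have "T \<in> extensional ?I" using that by (auto simp: space_PiM PiE_iff)
    then have i: "indicator (PiE ?I (\<lambda>_. {0..1})) T = (\<Prod>j<k. indicator {0..1} (T j) :: real)"
      by (auto simp: indicator_def PiE_iff prod_zero_iff)
    have v: "(\<Prod>k<k. \<Prod>j<k. \<bar>T k - T j\<bar> ^ \<beta>) = vdm \<beta> T ?I"
      unfolding vdm_def by (intro prod.cong) auto
    show ?thesis unfolding i selberg_density_def v weight_def wt_def by (simp add: prod.distrib mult_ac)
  qed
  then show ?thesis
    unfolding cube_integral_def set_lebesgue_integral_def pmoment_def moment_def pmono_def
    by (intro Bochner_Integration.integral_cong) auto
qed

lemma norm_const_eq_pmoment: "norm_const \<beta> \<alpha> \<delta> k = pmoment 0 0 k 0 0 0"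
  unfolding norm_const_def cube_integral_eq_pmoment[symmetric] by simp

lemma norm_const_pos: "norm_const \<beta> \<alpha> \<delta> k > 0"
  unfolding norm_const_eq_pmoment by (rule pmoment_pos)

lemma exp_joint_cgf: "exp (joint_cgf \<beta> \<alpha> \<delta> k z w) = pmoment z w k 0 0 0 / norm_const \<beta> \<alpha> \<delta> k"
  unfolding joint_cgf_def joint_mgf_def cube_integral_eq_pmoment using pmoment_pos[of z w k] norm_const_pos[of k] by simp

text \<open>The moments adapted to the parameters: a derivative in z raises \<open>a\<close>, one in
  w raises \<open>b\<close>, each with a minus sign.\<close>

definition joint_moment :: "nat \<Rightarrow> nat \<Rightarrow> nat \<Rightarrow> real \<Rightarrow> real \<Rightarrow> real" where
  "joint_moment k a b z w = moment z w {..<k} (\<lambda>x. psum 1 {..<k} x ^ a * (psum 1 {..<k} x - psum 2 {..<k} x) ^ b)"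

lemma joint_moment_deriv_z: "((\<lambda>s. joint_moment k a b s w) has_field_derivative - joint_moment k (Suc a) b z w) (at z)"
  unfolding joint_moment_def using moment_deriv_z[of "{..<k}" "\<lambda>x. psum 1 {..<k} x ^ a * (psum 1 {..<k} x - psum 2 {..<k} x) ^ b" w z]
  by (simp add: admissible_intros mult_ac)

lemma joint_moment_deriv_w: "((\<lambda>s. joint_moment k a b z s) has_field_derivative - joint_moment k a (Suc b) z w) (at w)"
  unfolding joint_moment_def using moment_deriv_w[of "{..<k}" "\<lambda>x. psum 1 {..<k} x ^ a * (psum 1 {..<k} x - psum 2 {..<k} x) ^ b" z w]
  by (simp add: admissible_intros mult_ac)

lemma joint_moment_00: "joint_moment k 0 0 z w = pmoment z w k 0 0 0"
  unfolding joint_moment_def pmoment_def pmono_def by simp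

lemma pmoment_eq_joint_moment: "pmoment z w k a 0 0 = joint_moment k a 0 z w"
  unfolding joint_moment_def pmoment_def pmono_def by simp

lemma pmoment_010: "pmoment z w k 0 1 0 = joint_moment k 1 0 z w - joint_moment k 0 1 z w"
  unfolding joint_moment_def pmoment_def pmono_def by (subst moment_diff[symmetric]) (auto intro!: admissible_intros)

lemma pmoment_020: "pmoment z w k 0 2 0 = joint_moment k 2 0 z w - 2 * joint_moment k 1 1 z w + joint_moment k 0 2 z w"
proof -
  let ?I = "{..<k}"
  have "pmono 0 2 0 ?I = (\<lambda>x. (psum 1 ?I x ^ 2 * (psum 1 ?I x - psum 2 ?I x) ^ 0 - 2 * (psum 1 ?I x ^ 1 * (psum 1 ?I x - psum 2 ?I x) ^ 1))
      + psum 1 ?I x ^ 0 * (psum 1 ?I x - psum 2 ?I x) ^ 2)"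
    unfolding pmono_def by (simp add: algebra_simps power2_eq_square)
  then show ?thesis unfolding pmoment_def joint_moment_def
    by (simp only: moment_add moment_diff moment_cmult admissible_intros finite_lessThan)
qed

text \<open>The test functions are 1 and p_1. Since p_1 - 3 p_2 + 2 p_3 = 3 (p_1 - p_2) - 2 p_1 + 2
  p_3, the only moments outside the adapted family are exactly the two with p_3 that occur in the
  bilinear identity. At \<open>k = n\<close> the constant \<open>\<kappa>\<close> is half the z- and
  w-free part of the last coefficient of the PDE.\<close>

lemma virasoro_joint_moment:
  fixes \<kappa> A z w :: real and k :: nat
  defines "\<kappa> \<equiv> \<alpha> + \<gamma> + 2 + \<beta> * (real k - 1)" and "A \<equiv> (\<alpha> + 1) * real k + \<beta> * real k * (real k - 1) / 2"
  shows "A * joint_moment k 0 0 z w - \<kappa> * joint_moment k 1 0 z w - z * joint_moment k 0 1 z w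
        - w * (3 * joint_moment k 0 1 z w - 2 * joint_moment k 1 0 z w + 2 * pmoment z w k 0 0 1) = 0"
    and "A * joint_moment k 1 0 z w - \<kappa> * joint_moment k 2 0 z w - z * joint_moment k 1 1 z w
        - w * (3 * joint_moment k 1 1 z w - 2 * joint_moment k 2 0 z w + 2 * pmoment z w k 1 0 1) + joint_moment k 0 1 z w = 0"
proof -
  let ?I = "{..<k}"
  let ?f = "\<lambda>a b x. psum 1 ?I x ^ a * (psum 1 ?I x - psum 2 ?I x) ^ b"
  let ?V = "\<lambda>c0 c1 x. ((\<alpha> + 1) * real (card ?I) + \<beta> * real (card ?I) * (real (card ?I) - 1) / 2 - (\<alpha> + \<gamma> + 2 + \<beta> * (real (card ?I) - 1)) * psum 1 ?I x
       - z * (psum 1 ?I x - psum 2 ?I x) - w * (psum 1 ?I x - 3 * psum 2 ?I x + 2 * psum 3 ?I x)) * (c0 + c1 * psum 1 ?I x)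
       + c1 * (psum 1 ?I x - psum 2 ?I x)"
  note adm = moment_add moment_diff moment_cmult admissible_intros admissible_pmono finite_lessThan
  have "?V 1 0 = (\<lambda>x. A * ?f 0 0 x - \<kappa> * ?f 1 0 x - z * ?f 0 1 x - w * (3 * ?f 0 1 x - 2 * ?f 1 0 x + 2 * pmono 0 0 1 ?I x))"
    unfolding A_def \<kappa>_def pmono_def by (rule ext) (simp add: algebra_simps)
  then have "moment z w ?I (\<lambda>x. A * ?f 0 0 x - \<kappa> * ?f 1 0 x - z * ?f 0 1 x - w * (3 * ?f 0 1 x - 2 * ?f 1 0 x + 2 * pmono 0 0 1 ?I x)) = 0"
    using virasoro[of ?I z w 1 0] by simp
  then show "A * joint_moment k 0 0 z w - \<kappa> * joint_moment k 1 0 z w - z * joint_moment k 0 1 z w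
        - w * (3 * joint_moment k 0 1 z w - 2 * joint_moment k 1 0 z w + 2 * pmoment z w k 0 0 1) = 0"
    unfolding joint_moment_def pmoment_def by (simp only: adm)
  have "?V 0 1 = (\<lambda>x. A * ?f 1 0 x - \<kappa> * ?f 2 0 x - z * ?f 1 1 x - w * (3 * ?f 1 1 x - 2 * ?f 2 0 x + 2 * pmono 1 0 1 ?I x) + ?f 0 1 x)"
    unfolding A_def \<kappa>_def pmono_def by (rule ext) (simp add: algebra_simps power2_eq_square)
  then have "moment z w ?I (\<lambda>x. A * ?f 1 0 x - \<kappa> * ?f 2 0 x - z * ?f 1 1 x - w * (3 * ?f 1 1 x - 2 * ?f 2 0 x + 2 * pmono 1 0 1 ?I x) + ?f 0 1 x) = 0"
    using virasoro[of ?I z w 0 1] by simp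
  then show "A * joint_moment k 1 0 z w - \<kappa> * joint_moment k 2 0 z w - z * joint_moment k 1 1 z w
        - w * (3 * joint_moment k 1 1 z w - 2 * joint_moment k 2 0 z w + 2 * pmoment z w k 1 0 1) + joint_moment k 0 1 z w = 0"
    unfolding joint_moment_def pmoment_def by (simp only: adm)
qed


text \<open>The ratio of \<open>2 * n choose (n - i)\<close> to \<open>2 * n choose n\<close> is the
  rational prefactor of \<open>b_coeff\<close>, and \<open>kp_const \<beta>\<close> is 2 * 12 /
  \<beta> for \<beta> = 1 and \<beta> = 4. The norming constants in \<open>b_coeff\<close> cancel
  those hidden in the exponential.\<close>

lemma bilinear_joint_moment:
  fixes n :: nat and z w :: real
  assumes "\<beta> \<in> {1, 2, 4}" "1 \<le> n"
  defines "q \<equiv> \<lambda>a b. joint_moment n a b z w" and "i \<equiv> index_shift \<beta>"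
  shows "eta_coeff \<beta> * (2 * q 4 0 * q 0 0 - 8 * q 3 0 * q 1 0 + 6 * (q 2 0)\<^sup>2)
      + 3 * (2 * (q 2 0 - 2 * q 1 1 + q 0 2) * q 0 0 - 2 * (q 1 0 - q 0 1)\<^sup>2)
      - 4 * (2 * pmoment z w n 1 0 1 * q 0 0 - 2 * q 1 0 * pmoment z w n 0 0 1)
    = 2 * (12 * b_coeff \<beta> \<alpha> \<delta> n / \<beta> *
        exp (joint_cgf \<beta> \<alpha> \<delta> (n - i) z w + joint_cgf \<beta> \<alpha> \<delta> (n + i) z w - 2 * joint_cgf \<beta> \<alpha> \<delta> n z w) * (q 0 0)\<^sup>2)"
    (is "?L = 2 * (12 * _ / _ * ?E * _)")
proof -
  let ?m = "\<lambda>k. pmoment z w k 0 0 0" and ?c = "norm_const \<beta> \<alpha> \<delta>"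
  have nz: "?m k \<noteq> 0" "?c k \<noteq> 0" for k using pmoment_pos[of z w k] norm_const_pos[of k] by simp_all
  have L: "real (2 * n choose n) * ?L = kp_const \<beta> * (if i \<le> n then real (2 * n choose (n - i)) * ?m (n - i) * ?m (n + i) else 0)"
    using bilinear_identity[OF assms(1), where n = n and z = z and w = w]
    unfolding q_def i_def pmoment_020 pmoment_010 joint_moment_00[symmetric] pmoment_eq_joint_moment by simp
  have "?E = ?m (n - i) / ?c (n - i) * (?m (n + i) / ?c (n + i)) / (?m n / ?c n)\<^sup>2"
    by (simp add: exp_diff exp_add exp_double exp_joint_cgf)
  then have E: "?E * (q 0 0)\<^sup>2 = ?m (n - i) * ?m (n + i) * ((?c n)\<^sup>2 / (?c (n - i) * ?c (n + i)))"
    using nz unfolding q_def joint_moment_00 by (simp add: field_simps)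
  have ch: "real (2 * n choose n) \<noteq> 0" by simp
  have c1: "real n * real (2 * n choose n) = (real n + 1) * real (2 * n choose (n - 1))"
  proof -
    have e: "Suc (n - 1) = n" "Suc (n - 1 + n) = 2 * n" using assms(2) by auto
    have "n * (2 * n choose n) = Suc n * (2 * n choose (n - 1))"
      using Suc_times_binomial_add[of "n - 1" n] by (simp only: e)
    then show ?thesis by (metis of_nat_mult of_nat_Suc add.commute)
  qed
  \<comment> \<open>\<open>h\<close> stands for 12 / \<beta>, that is 12 or 3; \<open>C\<close> and
    \<open>D\<close> are the products of norming constants for the shifted and for the unshifted
    indices.\<close>
  have alg: "2 * h * r * M = 2 * (12 * (r * (C / D)) / B * (M * (D / C)))" if "C \<noteq> 0" "D \<noteq> 0" "12 / B = h" for h r M C D B :: real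
    using that by auto
  consider "\<beta> = 1" "n \<ge> 2" | "\<beta> = 1" "n = 1" | "\<beta> = 2" | "\<beta> = 4" using assms by fastforce
  then show ?thesis
  proof cases
    case 1
    then have i: "i = 2" by (simp add: i_def index_shift_def)
    have e: "Suc (n - 2) = n - 1" "Suc (n - 2 + (n + 1)) = 2 * n" "Suc (n + 1) = n + 2" using 1 by auto
    have "(n - 1) * (2 * n choose (n - 1)) = (n + 2) * (2 * n choose (n - 2))"
      using Suc_times_binomial_add[of "n - 2" "n + 1"] by (simp only: e)
    then have c2: "(real n - 1) * real (2 * n choose (n - 1)) = (real n + 2) * real (2 * n choose (n - 2))"
      using 1 by (metis of_nat_mult of_nat_add of_nat_numeral of_nat_1 of_nat_diff assms(2))
    have h: "((real n + 1) * (real n + 2)) * real (2 * n choose (n - 2)) = real n * (real n - 1) * real (2 * n choose n)"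
      using c1 c2 by algebra
    have "(real n + 1) * (real n + 2) \<noteq> 0" by (simp add: add_eq_0_iff)
    then have r: "real (2 * n choose (n - 2)) = real n * (real n - 1) / ((real n + 1) * (real n + 2)) * real (2 * n choose n)"
      by (metis h nonzero_mult_div_cancel_left times_divide_eq_left)
    have "real (2 * n choose n) * ?L = real (2 * n choose n) * (24 * (real n * (real n - 1) / ((real n + 1) * (real n + 2))) * (?m (n - 2) * ?m (n + 2)))"
      unfolding L i r using 1 by (simp add: kp_const_def)
    then have "?L = 2 * 12 * (real n * (real n - 1) / ((real n + 1) * (real n + 2))) * (?m (n - 2) * ?m (n + 2))"
      using ch by (simp only: mult_cancel_left) simp
    also have "\<dots> = 2 * (12 * b_coeff \<beta> \<alpha> \<delta> n / \<beta> * (?E * (q 0 0)\<^sup>2))"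
    proof -
      have b: "b_coeff \<beta> \<alpha> \<delta> n = real n * (real n - 1) / ((real n + 1) * (real n + 2)) * (?c (n - 2) * ?c (n + 2) / (?c n)\<^sup>2)"
        using 1 by (simp add: b_coeff_def)
      show ?thesis unfolding E unfolding i b by (rule alg[where h = 12]) (use 1 nz in simp_all)
    qed
    finally show ?thesis by (simp only: mult.assoc)
  next
    \<comment> \<open>The shift exceeds \<open>n\<close>, so the splitting sum is empty, and
      \<open>b_coeff\<close> vanishes through the factor \<open>real n - 1\<close>.\<close>
    case 2
    then have "i = 2" by (simp add: i_def index_shift_def)
    then have "?L = 0" using L 2 ch by simp
    moreover have "b_coeff \<beta> \<alpha> \<delta> n = 0" using 2 by (simp add: b_coeff_def)
    ultimately show ?thesis by (simp only: mult_zero_left mult_zero_right div_0)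
  next
    case 3
    then have "?L = 0" using L ch by (simp add: kp_const_def)
    moreover have "b_coeff \<beta> \<alpha> \<delta> n = 0" using 3 by (simp add: b_coeff_def)
    ultimately show ?thesis by (simp only: mult_zero_left mult_zero_right div_0)
  next
    case 4
    then have i: "i = 1" by (simp add: i_def index_shift_def)
    have r: "real (2 * n choose (n - 1)) = real n / (real n + 1) * real (2 * n choose n)"
      using c1 by (simp add: field_simps)
    have "real (2 * n choose n) * ?L = real (2 * n choose n) * (6 * (real n / (real n + 1)) * (?m (n - 1) * ?m (n + 1)))"
      unfolding L i r using 4 assms(2) by (simp add: kp_const_def)
    then have "?L = 2 * 3 * (real n / (real n + 1)) * (?m (n - 1) * ?m (n + 1))"
      using ch by (simp only: mult_cancel_left) simp
    also have "\<dots> = 2 * (12 * b_coeff \<beta> \<alpha> \<delta> n / \<beta> * (?E * (q 0 0)\<^sup>2))"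
    proof -
      have b: "b_coeff \<beta> \<alpha> \<delta> n = real n / (real n + 1) * (?c (n - 1) * ?c (n + 1) / (?c n)\<^sup>2)"
        using 4 by (simp add: b_coeff_def)
      show ?thesis unfolding E unfolding i b by (rule alg[where h = 3]) (use 4 nz in simp_all)
    qed
    finally show ?thesis by (simp only: mult.assoc)
  qed
qed

end

section \<open>Elimination of the third power sum and the differential equation\<close>

lemma pde_from_bilinear:
  fixes t q1 q2 q3 q4 p p2 r M N \<eta> w z \<kappa> A B :: real
  assumes "t \<noteq> 0"
    and V0: "A * t - \<kappa> * q1 - z * p - w * (3 * p - 2 * q1 + 2 * M) = 0"
    and V1: "A * q1 - \<kappa> * q2 - z * r - w * (3 * r - 2 * q2 + 2 * N) + p = 0"
    and bil: "\<eta> * (2 * q4 * t - 8 * q3 * q1 + 6 * q2\<^sup>2) + 3 * (2 * (q2 - 2 * r + p2) * t - 2 * (q1 - p)\<^sup>2)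
       - 4 * (2 * N * t - 2 * q1 * M) = 2 * (B * t\<^sup>2)"
  shows "\<eta> * w * (q4 / t - 4 * q1 * q3 / t\<^sup>2 - 3 * (q2 / t)\<^sup>2 + 12 * q1\<^sup>2 * q2 / t ^ 3 - 6 * (q1 / t) ^ 4)
     + 6 * \<eta> * w * (q2 / t - (q1 / t)\<^sup>2)\<^sup>2 + 2 * z * (r / t - p * q1 / t\<^sup>2) + 3 * w * (p2 / t - (p / t)\<^sup>2)
     + 2 * (- p / t) + (2 * \<kappa> - w) * (q2 / t - (q1 / t)\<^sup>2) = B * w"
proof -
  define u where "u = 1 / t"
  have u: "u * t = 1" using assms(1) by (simp add: u_def)
  have "\<eta> * w * (q4 * u - 4 * q1 * q3 * u\<^sup>2 - 3 * (q2 * u)\<^sup>2 + 12 * q1\<^sup>2 * q2 * u ^ 3 - 6 * (q1 * u) ^ 4)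
     + 6 * \<eta> * w * (q2 * u - (q1 * u)\<^sup>2)\<^sup>2 + 2 * z * (r * u - p * q1 * u\<^sup>2) + 3 * w * (p2 * u - (p * u)\<^sup>2)
     + 2 * (- p * u) + (2 * \<kappa> - w) * (q2 * u - (q1 * u)\<^sup>2)
     = u\<^sup>2 * (\<eta> * w * (q4 * t - 4 * q1 * q3 + 3 * q2\<^sup>2) + 2 * z * (r * t - p * q1) + 3 * w * (p2 * t - p\<^sup>2) - 2 * p * t + (2 * \<kappa> - w) * (q2 * t - q1\<^sup>2))"
    using u by algebra
  \<comment> \<open>In \<open>t * V1 - q1 * V0\<close> the constant \<open>A\<close> cancels, and
    the result expresses w (N t - q1 M) through known moments. Inserted into w times
    \<open>bil\<close>, it contributes -4 w (q2 t - q1^2), which together with 3 w from the square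
    of the second difference leaves the coefficient -w; the terms 6 w (r t - p q1) cancel.\<close>
  also have "\<eta> * w * (q4 * t - 4 * q1 * q3 + 3 * q2\<^sup>2) + 2 * z * (r * t - p * q1) + 3 * w * (p2 * t - p\<^sup>2) - 2 * p * t + (2 * \<kappa> - w) * (q2 * t - q1\<^sup>2)
     = B * w * t\<^sup>2"
    using V0 V1 bil by algebra
  also have "u\<^sup>2 * (B * w * t\<^sup>2) = B * w" using u by algebra
  finally show ?thesis unfolding u_def by (simp add: power_divide)
qed

theorem theorem2p4:
  fixes m n \<beta> :: nat and \<delta> :: int and \<alpha> z w :: real
    and \<sigma> :: "nat \<Rightarrow> real \<Rightarrow> real \<Rightarrow> real"
  assumes "1 \<le> n" and "n \<le> m"
    and "(\<beta>, \<delta>) \<in> {(1, 0), (2, 0), (4, 0), (4, 2), (2, 1), (1, -1), (2, -1)}"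
    and "\<alpha> = real \<beta> / 2 * (real m - real n + 1) - 1"
    and "\<sigma> = joint_cgf \<beta> \<alpha> \<delta>"
  shows "eta_coeff \<beta> * w * (partial_z ^^ 4) (\<sigma> n) z w
       + 6 * eta_coeff \<beta> * w * ((partial_z ^^ 2) (\<sigma> n) z w)\<^sup>2
       + 2 * z * partial_z (partial_w (\<sigma> n)) z w
       + 3 * w * (partial_w ^^ 2) (\<sigma> n) z w
       + 2 * partial_w (\<sigma> n) z w
       + (2 * (\<alpha> + real_of_int \<delta> / 2 + real n * real \<beta> + 2 - real \<beta>) - w)
           * (partial_z ^^ 2) (\<sigma> n) z w
     = 12 * b_coeff \<beta> \<alpha> \<delta> n / real \<beta> * w *
         exp (\<sigma> (n - index_shift \<beta>) z w + \<sigma> (n + index_shift \<beta>) z w - 2 * \<sigma> n z w)"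
proof -
  have \<beta>: "\<beta> \<in> {1, 2, 4}" "\<beta> \<ge> 1" and \<delta>: "\<delta> \<ge> - 1" using assms(3) by auto
  \<comment> \<open>Since \<open>n \<le> m\<close>, the factor m - n + 1 is at least 1, whence
    \<open>\<alpha> > - 1\<close>.\<close>
  have "real \<beta> / 2 * (real m - real n + 1) > 0" using \<beta>(2) assms(2) by (intro mult_pos_pos) auto
  then interpret jacobi_ensemble \<beta> \<alpha> \<delta>
    using \<beta> \<delta> assms(4) by unfold_locales auto
  have \<sigma>: "\<sigma> n = (\<lambda>z w. ln (joint_moment n 0 0 z w / norm_const \<beta> \<alpha> \<delta> n))"
    unfolding assms(5) by (intro ext) (simp only: joint_cgf_def joint_mgf_def cube_integral_eq_pmoment joint_moment_00, simp)
  have pos: "joint_moment n 0 0 z w > 0" for z w unfolding joint_moment_00 by (rule pmoment_pos)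
  note partials = cgf_partials[OF joint_moment_deriv_z joint_moment_deriv_w pos norm_const_pos \<sigma>]
  have \<kappa>: "\<alpha> + real_of_int \<delta> / 2 + real n * real \<beta> + 2 - real \<beta> = \<alpha> + \<gamma> + 2 + \<beta> * (real n - 1)"
    by (simp add: algebra_simps)
  \<comment> \<open>The mixed derivative is rewritten first, since \<open>partials(3)\<close> would
    otherwise rewrite the inner \<open>partial_w\<close> and destroy its pattern.\<close>
  show ?thesis
    unfolding partials(5) unfolding partials \<kappa>
    by (rule trans[OF pde_from_bilinear[OF _ virasoro_joint_moment bilinear_joint_moment[OF \<beta>(1) assms(1)]]])
      (use pos[of z w] in \<open>auto simp: assms(5)\<close>)
qed

end
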